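(* Let $H\in(0,\frac12)$ and $T>0$, and let $b:[0,T]\times\mathbb{R}\to\mathbb{R}$ be Borel measurable such that (i) there is a constant $K>0$ with $|b(t,x)-b(t,y)|\le K|x-y|$ for all $x,y\in\mathbb{R}$, $t\in[0,T]$, and (ii) $t\mapsto b(t,0)$ is bounded on $[0,T]$. Let $P_Tf(x)=\mathbb{E}f(X_T^x)$, where $X^x$ is the solution of $dX_t=b(t,X_t)\,dt+dB_t^H$, $X_0=x$. Then for all $x,y\in\mathbb{R}$ and every bounded measurable $f:\mathbb{R}\to\mathbb{R}$ with $f\ge1$, $$P_T(\log f)(x)\le\log P_Tf(y)+C(T,K,H)|x-y|^2,$$ where $$C(T,K,H)=\left(\frac{\mathrm{B}(\frac32-H,\frac12-H)}{\Gamma(\frac12-H)}\right)^2\frac{T^{2-2H}}{K^{-2}(1-e^{-2KT})^2(1-H)}.$$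
   Context: $\Gamma$ is the Gamma function and $\mathrm{B}(\cdot,\cdot)$ is the Euler Beta function. $B^H=(B^H_t)_{t\in[0,T]}$ is a fractional Brownian motion with Hurst parameter $H$, with the normalization given by the integral representation $B^H_t=\int_0^tK_H(t,s)\,dW_s$, where $W$ is a standard one-dimensional Wiener process and, for $0<s<t\le T$, $$K_H(t,s)=\Gamma(H+\tfrac12)^{-1}(t-s)^{H-\frac12}F\left(H-\tfrac12,\tfrac12-H,H+\tfrac12,1-\tfrac ts\right),$$ $F$ being the Gauss hypergeometric function (analytically continued). Thus $B^H$ is a centered Gaussian process with covariance $\mathbb{E}(B^H_tB^H_s)=\int_0^{t\wedge s}K_H(t,r)K_H(s,r)\,dr$, which is proportional to $t^{2H}+s^{2H}-|t-s|^{2H}$. A solution $X^x$ of the equation is a continuous adapted process with $X^x_t=x+\int_0^tb(s,X^x_s)\,ds+B^H_t$ for $t\in[0,T]$; under the stated hypotheses on $b$ there is a unique (strong) solution. *)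

theory Defs
  imports
    "HOL-Probability.Probability"
    "HOL-Complex_Analysis.Complex_Analysis"
begin

text \<open>
  Gauss's hypergeometric function, continued analytically from the germ of its power series at
  \<open>0\<close> to the plane cut along \<open>[1, \<infinity>)\<close>. The cut plane is connected, so the continuation is unique;
  the value is unspecified on the cut, and meaningless if \<open>c\<close> is a non-positive integer. The last
  argument of \<^const>\<open>fps_hypergeo\<close> is a scaling factor for the variable.
\<close>

definition hypergeo_2F1 :: "complex \<Rightarrow> complex \<Rightarrow> complex \<Rightarrow> complex \<Rightarrow> complex" where
  "hypergeo_2F1 a b c z =
     (THE w. \<exists>F. F holomorphic_on - (complex_of_real ` {1..}) \<and>
                 F has_fps_expansion fps_hypergeo [a, b] [c] 1 \<and> w = F z)"

text \<open>
  The argument \<open>1 - t/s\<close> is negative for \<open>0 < s < t\<close>, hence off the cut, and the value of the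
  hypergeometric function is real there.
\<close>

definition fbm_kernel :: "real \<Rightarrow> real \<Rightarrow> real \<Rightarrow> real" where
  "fbm_kernel H t s =
     (if 0 < s \<and> s < t
      then inverse (Gamma (H + 1/2)) * (t - s) powr (H - 1/2) *
           Re (hypergeo_2F1 (of_real (H - 1/2)) (of_real (1/2 - H)) (of_real (H + 1/2))
                            (of_real (1 - t / s)))
      else 0)"

text \<open>Processes are written \<open>X t \<omega>\<close>; only times in \<open>[0, T]\<close> matter.\<close>

definition adapted_on :: "real \<Rightarrow> (real \<Rightarrow> 'a measure) \<Rightarrow> (real \<Rightarrow> 'a \<Rightarrow> real) \<Rightarrow> bool" where
  "adapted_on T F X \<longleftrightarrow> (\<forall>t\<in>{0..T}. X t \<in> borel_measurable (F t))"

definition continuous_paths_on :: "'a measure \<Rightarrow> real \<Rightarrow> (real \<Rightarrow> 'a \<Rightarrow> real) \<Rightarrow> bool" where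
  "continuous_paths_on M T X \<longleftrightarrow> (AE \<omega> in M. continuous_on {0..T} (\<lambda>t. X t \<omega>))"

definition wiener_process ::
    "'a measure \<Rightarrow> (real \<Rightarrow> 'a measure) \<Rightarrow> real \<Rightarrow> (real \<Rightarrow> 'a \<Rightarrow> real) \<Rightarrow> bool" where
  "wiener_process M F T W \<longleftrightarrow>
     adapted_on T F W \<and>
     continuous_paths_on M T W \<and>
     (AE \<omega> in M. W 0 \<omega> = 0) \<and>
     (\<forall>s t. 0 \<le> s \<and> s < t \<and> t \<le> T \<longrightarrow>
        distributed M lborel (\<lambda>\<omega>. W t \<omega> - W s \<omega>) (normal_density 0 (sqrt (t - s))) \<and>
        prob_space.indep_set M (sets (F s))
          {(\<lambda>\<omega>. W t \<omega> - W s \<omega>) -` A \<inter> space M | A. A \<in> sets borel})"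

text \<open>
  The list entry \<open>(c, u, v)\<close> stands for the step function with value \<open>c\<close> on \<open>(u, v]\<close> and \<open>0\<close>
  elsewhere; a list stands for the sum of its entries.
\<close>

definition step_function :: "(real \<times> real \<times> real) list \<Rightarrow> real \<Rightarrow> real" where
  "step_function S r = (\<Sum>(c, u, v)\<leftarrow>S. c * indicator {u<..v} r)"

definition step_integral ::
    "(real \<Rightarrow> 'a \<Rightarrow> real) \<Rightarrow> (real \<times> real \<times> real) list \<Rightarrow> 'a \<Rightarrow> real" where
  "step_integral W S \<omega> = (\<Sum>(c, u, v)\<leftarrow>S. c * (W v \<omega> - W u \<omega>))"

text \<open>
  \<open>Y\<close> is (a version of) the Wiener integral of the deterministic integrand \<open>\<phi>\<close> over \<open>[0, t]\<close>: the
  \<open>L\<^sup>2\<close> limit of the integrals of step functions that converge to \<open>\<phi>\<close> in \<open>L\<^sup>2([0, t])\<close>.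
\<close>

definition has_wiener_integral ::
    "'a measure \<Rightarrow> (real \<Rightarrow> 'a \<Rightarrow> real) \<Rightarrow> real \<Rightarrow> (real \<Rightarrow> real) \<Rightarrow> ('a \<Rightarrow> real) \<Rightarrow> bool" where
  "has_wiener_integral M W t \<phi> Y \<longleftrightarrow>
     \<phi> \<in> borel_measurable (restrict_space lborel {0..t}) \<and>
     Y \<in> borel_measurable M \<and>
     (\<exists>S :: nat \<Rightarrow> (real \<times> real \<times> real) list.
        (\<forall>n. \<forall>(c, u, v)\<in>set (S n). 0 \<le> u \<and> u \<le> v \<and> v \<le> t) \<and>
        (\<lambda>n. \<integral>\<^sup>+ r. ennreal ((\<phi> r - step_function (S n) r)\<^sup>2) \<partial>restrict_space lborel {0..t})
          \<longlonglongrightarrow> 0 \<and>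
        (\<lambda>n. \<integral>\<^sup>+ \<omega>. ennreal ((Y \<omega> - step_integral W (S n) \<omega>)\<^sup>2) \<partial>M) \<longlonglongrightarrow> 0)"

definition fractional_brownian_motion ::
    "'a measure \<Rightarrow> (real \<Rightarrow> 'a \<Rightarrow> real) \<Rightarrow> real \<Rightarrow> real \<Rightarrow> (real \<Rightarrow> 'a \<Rightarrow> real) \<Rightarrow> bool" where
  "fractional_brownian_motion M W H T B \<longleftrightarrow>
     continuous_paths_on M T B \<and>
     (\<forall>t\<in>{0..T}. has_wiener_integral M W t (fbm_kernel H t) (B t))"

definition sde_solution ::
    "'a measure \<Rightarrow> (real \<Rightarrow> 'a measure) \<Rightarrow> real \<Rightarrow> (real \<Rightarrow> real \<Rightarrow> real) \<Rightarrow>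
     (real \<Rightarrow> 'a \<Rightarrow> real) \<Rightarrow> real \<Rightarrow> (real \<Rightarrow> 'a \<Rightarrow> real) \<Rightarrow> bool" where
  "sde_solution M F T b B x X \<longleftrightarrow>
     adapted_on T F X \<and>
     continuous_paths_on M T X \<and>
     (AE \<omega> in M. \<forall>t\<in>{0..T}. X t \<omega> = x + (LBINT s:{0..t}. b s (X s \<omega>)) + B t \<omega>)"

text \<open>\<open>X x\<close> is the solution started at \<open>x\<close>.\<close>

definition transition_op ::
    "'a measure \<Rightarrow> (real \<Rightarrow> real \<Rightarrow> 'a \<Rightarrow> real) \<Rightarrow> real \<Rightarrow> (real \<Rightarrow> real) \<Rightarrow> real \<Rightarrow> real" where
  "transition_op M X T f x = (\<integral>\<omega>. f (X x T \<omega>) \<partial>M)"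

definition harnack_const :: "real \<Rightarrow> real \<Rightarrow> real \<Rightarrow> real" where
  "harnack_const T K H =
     (Beta (3/2 - H) (1/2 - H) / Gamma (1/2 - H))\<^sup>2 *
     (T powr (2 - 2 * H) / (K powi (-2) * (1 - exp (- 2 * K * T))\<^sup>2 * (1 - H)))"

end

theory Submission
  imports Defs
begin

text \<open>
Both sides of the inequality are read off one and the same functional. As the noise enters additively
and \<open>b\<close> is Lipschitz, the solution from \<open>y\<close> at time \<open>T\<close> is \<open>\<Phi>(B)\<close> for a continuous functional \<open>\<Phi>\<close> of
the driving path. Let \<open>X\<close> start at \<open>x\<close>, and let \<open>h\<close> be the deterministic function with \<open>h(0) = x - y\<close>,
\<open>h(T) = 0\<close> and \<open>K h - h' = const\<close>. Then \<open>X - h\<close> starts at \<open>y\<close>, ends at \<open>X(T)\<close> and solves the same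
equation with the noise \<open>B + \<integral>g\<close>, where \<open>g = b(X) - b(X - h) - h'\<close>; so \<open>X(T) = \<Phi>(B + \<integral>g)\<close>. The choice of
\<open>h\<close> makes \<open>\<bar>g\<bar> \<le> K \<bar>h\<bar> + \<bar>h'\<bar> = \<eta>\<close> with \<open>\<eta> = K \<bar>x - y\<bar> / (1 - exp (- K T))\<close>
(\<open>shifted_euler_limit\<close>, \<open>g_bound\<close>). This deterministic shift replaces a coupling that is steered by the
current distance of the two solutions, and its cost is not larger.

The drift \<open>g\<close> of the fractional noise comes from a drift of the Wiener process:
\<open>\<integral>\<^sub>0\<^sup>t g = \<integral>\<^sub>0\<^sup>t K\<^sub>H(t,s) v(s) ds\<close> with
\<open>v(s) = s\<^sup>H\<^sup>-\<^sup>1\<^sup>/\<^sup>2 / \<Gamma>(1/2 - H) \<integral>\<^sub>0\<^sup>s (s - r)\<^sup>-\<^sup>1\<^sup>/\<^sup>2\<^sup>-\<^sup>H r\<^sup>1\<^sup>/\<^sup>2\<^sup>-\<^sup>H g(r) dr\<close>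
(\<open>kernel_integral\<close>). The Beta integral gives \<open>\<bar>v(s)\<bar> \<le> \<eta> B(3/2 - H, 1/2 - H) / \<Gamma>(1/2 - H) s\<^sup>1\<^sup>/\<^sup>2\<^sup>-\<^sup>H\<close>.
By Fubini, the identity amounts to \<open>fbm_kernel_inversion\<close>, which is a comparison of power series with
nonnegative terms once the kernel is known as such a series. The hypergeometric function in the kernel
has third parameter one above the first; it therefore satisfies the first order equation
\<open>z F' = b (F - (1 - z)\<^sup>-\<^sup>b)\<close>, \<open>b = 1/2 - H\<close>, and this equation identifies it on the negative axis
(\<open>hyp_ode\<close>, \<open>hyp_negative_axis\<close>).

What remains is that an adapted drift \<open>v\<close> with \<open>\<bar>v\<bar> \<le> c\<close> for a deterministic \<open>c\<close> satisfies
\<open>E ln \<Phi>(W + \<integral>v) \<le> ln E \<Phi>(W) + 1/2 \<integral>c\<^sup>2\<close>. This is the easy half of the variational formula for the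
relative entropy with respect to Wiener measure. It is proved without Girsanov's theorem: for a single
Gaussian variable it is the bound \<open>gauss_shift_log\<close>; for finitely many increments of \<open>W\<close>, each shifted by
an amount that depends on the past only, the one-dimensional bounds add up (\<open>gauss_chain_log\<close>); refining
the time grid gives finitely many Wiener integrals (\<open>wiener_shift_log\<close>); and the Euler scheme, which
depends on finitely many values of the noise, converges to \<open>\<Phi>\<close> path by path (\<open>euler_converges\<close>). The
limits need a Lipschitz \<open>f\<close>; bounded measurable \<open>f\<close> follow by approximation in \<open>L\<^sup>1\<close> under both laws.
\<close>

section \<open>The Gauss hypergeometric function with third parameter one above the first\<close>

text \<open>
A factor of \<open>(-b)\<^sub>n\<^sub>+\<^sub>1\<close> can be split off at either end: \<open>(-b)\<^sub>n (n - b) = (-b)\<^sub>n\<^sub>+\<^sub>1 = -b (1 - b)\<^sub>n\<close>. This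
cancellation is special to a third parameter that exceeds the first by one.
\<close>

lemma pochhammer_shift_ratio:
  fixes b :: real assumes "0<b" "b<1"
  shows "pochhammer (-b) n / pochhammer (1-b) n = - b / (real n - b)"
proof -
  have p: "pochhammer (1-b) n > 0" using assms by (intro pochhammer_pos) auto
  have "pochhammer (-b) (Suc n) = pochhammer (-b) n * (real n - b)" by (simp add: pochhammer_Suc algebra_simps)
  moreover have "pochhammer (-b) (Suc n) = - b * pochhammer (1-b) n" by (simp add: pochhammer_rec algebra_simps)
  moreover have "real n - b \<noteq> 0"
  proof (cases n) case 0 then show ?thesis using assms by simp next case (Suc m) then show ?thesis using assms by simp qed
  ultimately show ?thesis using p by (simp add: field_simps)
qed

definition cut_plane :: "complex set" where "cut_plane = - (complex_of_real ` {1..})"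

text \<open>
The coefficients of \<open>F(-b, b; 1 - b; z)\<close>, after this cancellation.
\<close>

definition hyp_coeff :: "real \<Rightarrow> nat \<Rightarrow> real" where
  "hyp_coeff b n = - b / (real n - b) * (pochhammer b n / fact n)"

lemma fps_hypergeo_nth_shift:
  assumes "0<b" "b<1"
  shows "fps_nth (fps_hypergeo [complex_of_real (-b), of_real b] [of_real (1-b)] 1) n = of_real (hyp_coeff b n)"
proof -
  have "fps_nth (fps_hypergeo [complex_of_real (-b), of_real b] [of_real (1-b)] 1) n
     = of_real (pochhammer (-b) n / pochhammer (1-b) n * (pochhammer b n / fact n))"
    by (simp only: fps_hypergeo_nth foldl.simps power_one mult_1_left mult_1_right pochhammer_of_real
          of_real_divide of_real_mult of_real_fact of_nat_fact times_divide_times_eq)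
  then show ?thesis unfolding pochhammer_shift_ratio[OF assms] hyp_coeff_def .
qed

lemma cut_plane_iff: "z \<in> cut_plane \<longleftrightarrow> \<not> (Im z = 0 \<and> 1 \<le> Re z)"
proof -
  have "z \<in> complex_of_real ` {1..} \<longleftrightarrow> Im z = 0 \<and> 1 \<le> Re z"
    by (auto simp: image_iff complex_eq_iff)
  then show ?thesis by (simp add: cut_plane_def)
qed

lemma cut_plane_powr_args: "z \<in> cut_plane \<Longrightarrow> 1 - z \<notin> \<real>\<^sub>\<le>\<^sub>0"
  unfolding cut_plane_iff complex_nonpos_Reals_iff by auto

lemma open_cut_plane: "open cut_plane"
proof -
  have "cut_plane = - ({z. Im z = 0} \<inter> {z. 1 \<le> Re z})" using cut_plane_iff by auto
  show ?thesis unfolding \<open>cut_plane = _\<close> by (intro open_Compl closed_Int closed_Collect_eq closed_Collect_le continuous_intros)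
qed

lemma segment_cut_plane:
  assumes "z \<in> cut_plane" "0 \<le> t" "t \<le> 1" shows "of_real t * z \<in> cut_plane"
proof -
  have False if "1 \<le> t * Re z" "Im z = 0 \<or> t = 0"
  proof -
    from that have "t \<noteq> 0" by auto
    with that assms have "Re z < 1" by (simp add: cut_plane_iff)
    moreover have "t * Re z \<le> t * max 0 (Re z)" using assms by (intro mult_left_mono) auto
    moreover have "t * max 0 (Re z) \<le> 1 * max 0 (Re z)" using assms by (intro mult_right_mono) auto
    ultimately show False using that by auto
  qed
  then show ?thesis unfolding cut_plane_iff by auto
qed

lemma connected_cut_plane: "connected cut_plane"
proof (rule starlike_imp_connected)
  show "starlike cut_plane" unfolding starlike_def
  proof (intro bexI[of _ 0] ballI subsetI)
    fix x w assume "x \<in> cut_plane" "w \<in> closed_segment 0 x"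
    then show "w \<in> cut_plane" using segment_cut_plane[of x]
      by (auto simp: in_segment scaleR_conv_of_real)
  qed (auto simp: cut_plane_iff)
qed

lemma one_minus_powr_sums:
  assumes "norm z < 1"
  shows "(\<lambda>n. complex_of_real (pochhammer b n / fact n) * z ^ n) sums (1 - z) powr (- of_real b)"
proof -
  have "(\<lambda>n. ((- of_real b) gchoose n) * (- z) ^ n) sums (1 + - z) powr (- of_real b)"
    using assms by (intro gen_binomial_complex) auto
  moreover have "((- of_real b) gchoose n) * (- z) ^ n = complex_of_real (pochhammer b n / fact n) * z ^ n" for n
  proof -
    have 1: "(- z) ^ n = (- 1) ^ n * z ^ n" by (rule power_minus)
    have 2: "(- 1) ^ n * (- 1) ^ n = (1::complex)" by (simp flip: power_mult_distrib)
    have "((- of_real b) gchoose n) * (- z) ^ n = ((- 1) ^ n * (- 1) ^ n) * (pochhammer (of_real b) n / fact n * z ^ n)"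
      unfolding gbinomial_pochhammer 1 by simp
    then show ?thesis unfolding 2
      by (simp only: mult_1_left pochhammer_of_real of_real_divide of_real_fact mult_1_right)
  qed
  ultimately show ?thesis by simp
qed

lemma has_fps_expansion_powr_neg:
  "(\<lambda>z. (1 - z) powr (- of_real b)) has_fps_expansion Abs_fps (\<lambda>n. complex_of_real (pochhammer b n / fact n))"
proof (rule has_fps_expansionI)
  have "eventually (\<lambda>u::complex. u \<in> ball 0 1) (nhds 0)" by (intro eventually_nhds_in_open) auto
  then show "\<forall>\<^sub>F u in nhds 0. (\<lambda>n. fps_nth (Abs_fps (\<lambda>n. complex_of_real (pochhammer b n / fact n))) n * u ^ n) sums (1 - u) powr (- of_real b)"
    by eventually_elim (unfold fps_nth_Abs_fps, rule one_minus_powr_sums, simp)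
qed

lemma fps_X_deriv_nth: "fps_nth (fps_X * fps_deriv (f :: complex fps)) n = of_nat n * fps_nth f n"
  by (simp only: fps_X_mult_nth fps_deriv_nth) (cases n; simp only: simp_thms if_True if_False nat.distinct diff_Suc_1 Suc_eq_plus1[symmetric] of_nat_0 mult_zero_left)

text \<open>
On coefficients the equation reads \<open>n f\<^sub>n = b (f\<^sub>n - (b)\<^sub>n / n!)\<close>, which is the definition of
\<^const>\<open>hyp_coeff\<close>. The identity theorem carries it from the disc of convergence to the cut plane, so it holds
for every analytic continuation, whatever its construction.
\<close>

lemma hyp_ode:
  assumes b: "0<b" "b<1" and F: "F holomorphic_on cut_plane"
    "F has_fps_expansion Abs_fps (\<lambda>n. complex_of_real (hyp_coeff b n))" and z: "z \<in> cut_plane"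
  shows "z * deriv F z = of_real b * (F z - (1 - z) powr (- of_real b))"
proof -
  define E where "E z = z * deriv F z - of_real b * (F z - (1 - z) powr (- of_real b))" for z
  have holE: "E holomorphic_on cut_plane" unfolding E_def
    by (intro holomorphic_intros F(1) open_cut_plane holomorphic_deriv cut_plane_powr_args)
  have fpsE: "E has_fps_expansion (fps_X * fps_deriv (Abs_fps (\<lambda>n. complex_of_real (hyp_coeff b n)))
     - fps_const (of_real b) * (Abs_fps (\<lambda>n. complex_of_real (hyp_coeff b n)) - Abs_fps (\<lambda>n. complex_of_real (pochhammer b n / fact n))))"
    (is "_ has_fps_expansion ?Q")
    unfolding E_def by (intro fps_expansion_intros F(2) has_fps_expansion_powr_neg)
  have "?Q = 0"
  proof (rule fps_ext)
    fix n
    have ne: "real n - b \<noteq> 0"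
    proof (cases n) case 0 then show ?thesis using assms by simp next case (Suc m) then show ?thesis using assms by simp qed
    have "real n * hyp_coeff b n - b * (hyp_coeff b n - pochhammer b n / fact n) = 0"
      using ne by (simp add: hyp_coeff_def field_simps)
    then have 1: "complex_of_real (real n * hyp_coeff b n - b * (hyp_coeff b n - pochhammer b n / fact n)) = 0"
      by (simp only: of_real_0)
    have "fps_nth ?Q n = complex_of_real (real n * hyp_coeff b n - b * (hyp_coeff b n - pochhammer b n / fact n))"
      by (simp only: fps_sub_nth fps_X_deriv_nth fps_mult_left_const_nth fps_nth_Abs_fps of_real_diff of_real_mult of_real_of_nat_eq)
    then show "fps_nth ?Q n = fps_nth 0 n" by (simp only: 1 fps_zero_nth)
  qed
  with fpsE have "E has_fps_expansion 0" by simp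
  then have "eventually (\<lambda>z. eval_fps 0 z = E z) (nhds 0)" by (simp add: has_fps_expansion_def)
  then have "eventually (\<lambda>z. E z = 0) (nhds 0)" by eventually_elim simp
  then obtain U where U: "open U" "0 \<in> U" "\<And>z. z\<in>U \<Longrightarrow> E z = 0" unfolding eventually_nhds by auto
  have "E z = 0"
  proof (rule analytic_continuation_open[OF _ open_cut_plane _ connected_cut_plane _ holE _ _ z])
    show "open (U \<inter> cut_plane)" using U open_cut_plane by auto
    have "0 \<in> U \<inter> cut_plane" using U(2) by (simp add: cut_plane_iff)
    then show "U \<inter> cut_plane \<noteq> {}" by blast
    show "U \<inter> cut_plane \<subseteq> cut_plane" by simp
    show "E w = 0" if "w \<in> U \<inter> cut_plane" for w using U(3) that by blast
  qed (rule holomorphic_on_const)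
  then show ?thesis by (simp add: E_def)
qed

lemma hyp_continuation_unique:
  assumes F: "F holomorphic_on cut_plane" "F has_fps_expansion f"
    and G: "G holomorphic_on cut_plane" "G has_fps_expansion f" and z: "z \<in> cut_plane"
  shows "F z = G z"
proof -
  have "(\<lambda>z. F z - G z) has_fps_expansion f - f" by (intro fps_expansion_intros F G)
  then have "eventually (\<lambda>z. eval_fps 0 z = F z - G z) (nhds 0)" by (simp add: has_fps_expansion_def)
  then have "eventually (\<lambda>z. F z = G z) (nhds 0)" by eventually_elim simp
  then obtain U where U: "open U" "0 \<in> U" "\<And>z. z\<in>U \<Longrightarrow> F z = G z" unfolding eventually_nhds by auto
  show ?thesis
  proof (rule analytic_continuation_open[OF _ open_cut_plane _ connected_cut_plane _ F(1) G(1) _ z])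
    show "open (U \<inter> cut_plane)" using U open_cut_plane by auto
    have "0 \<in> U \<inter> cut_plane" using U(2) by (simp add: cut_plane_iff)
    then show "U \<inter> cut_plane \<noteq> {}" by blast
    show "U \<inter> cut_plane \<subseteq> cut_plane" by simp
    show "F w = G w" if "w \<in> U \<inter> cut_plane" for w using U(3) that by blast
  qed
qed

text \<open>
Writing \<open>-b / (n - b) = 1 - n / (n - b)\<close> in \<^const>\<open>hyp_coeff\<close> turns the series into
\<open>(1 - z)\<^sup>-\<^sup>b - b z \<integral>\<^sub>0\<^sup>1 t\<^sup>-\<^sup>b (1 - z t)\<^sup>-\<^sup>b\<^sup>-\<^sup>1 dt\<close>. The substitution \<open>t = \<tau>\<^sup>1\<^sup>/\<^sup>(\<^sup>1\<^sup>-\<^sup>b\<^sup>)\<close> absorbs the singular weight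
and leaves a continuous integrand, to which differentiation under the integral sign applies.
\<close>

definition hyp_integrand :: "real \<Rightarrow> complex \<Rightarrow> real \<Rightarrow> complex" where
  "hyp_integrand b z \<tau> = (1 - z * of_real (\<tau> powr (1 / (1 - b)))) powr (- of_real b - 1)"

lemma cut_plane_scale:
  assumes "z \<in> cut_plane" "0 \<le> t" "t \<le> 1" "b < 1"
  shows "z * of_real (t powr (1 / (1 - b))) \<in> cut_plane"
proof -
  have "t powr (1 / (1 - b)) \<le> 1" using assms by (simp add: powr_le1)
  then show ?thesis using segment_cut_plane[OF assms(1), of "t powr (1 / (1 - b))"] by (simp add: mult.commute)
qed

lemma continuous_on_root_powr: "b < 1 \<Longrightarrow> continuous_on {0..1} (\<lambda>t::real. t powr (1 / (1 - b)))"
  by (rule continuous_on_powr'[OF continuous_on_id continuous_on_const]) simp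

lemma continuous_on_one_minus_powr: "continuous_on cut_plane (\<lambda>z. (1 - z) powr c)"
  by (intro holomorphic_on_imp_continuous_on holomorphic_intros) (rule cut_plane_powr_args)

lemma continuous_on_hyp_integrand:
  assumes "b < 1" "z \<in> cut_plane"
  shows "continuous_on {0..1} (hyp_integrand b z)"
  unfolding hyp_integrand_def
  by (rule continuous_on_compose2[OF continuous_on_one_minus_powr])
     (auto intro!: continuous_intros continuous_on_root_powr cut_plane_scale assms)

lemma holomorphic_hyp_integral:
  assumes b: "0 < b" "b < 1"
  shows "(\<lambda>z. integral (cbox 0 1) (hyp_integrand b z)) holomorphic_on cut_plane"
proof -
  have "(\<lambda>z. integral (cbox 0 1) (hyp_integrand b z)) field_differentiable (at z)" if z: "z \<in> cut_plane" for z
  proof -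
    obtain e where e: "e > 0" "ball z e \<subseteq> cut_plane" by (rule openE[OF open_cut_plane z])
    have "(\<lambda>z. integral (cbox 0 1) (hyp_integrand b z)) holomorphic_on ball z e"
    proof (rule leibniz_rule_holomorphic[where fx="\<lambda>z t. (of_real b + 1) * of_real (t powr (1 / (1 - b))) * (1 - z * of_real (t powr (1 / (1 - b)))) powr (- of_real b - 2)"])
      fix w t assume w: "w \<in> ball z e" and t: "t \<in> cbox 0 (1::real)"
      then have "w \<in> cut_plane" using e(2) by blast
      then have "w * of_real (t powr (1 / (1 - b))) \<in> cut_plane" using t b(2) by (intro cut_plane_scale) simp_all
      then have n: "1 - w * of_real (t powr (1 / (1 - b))) \<notin> \<real>\<^sub>\<le>\<^sub>0" by (rule cut_plane_powr_args)
      have d: "((\<lambda>w. 1 - w * of_real (t powr (1 / (1 - b)))) has_field_derivative - of_real (t powr (1 / (1 - b)))) (at w within ball z e)"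
        by (rule DERIV_cong[OF DERIV_diff[OF DERIV_const DERIV_cmult_right[OF DERIV_ident]]]) simp
      from DERIV_chain2[OF has_field_derivative_powr[OF n] d, of "- of_real b - 1"]
      show "((\<lambda>w. hyp_integrand b w t) has_field_derivative (of_real b + 1) * of_real (t powr (1 / (1 - b))) * (1 - w * of_real (t powr (1 / (1 - b)))) powr (- of_real b - 2)) (at w within ball z e)"
        unfolding hyp_integrand_def by (rule DERIV_cong) (simp add: algebra_simps)
    next
      fix w assume "w \<in> ball z e"
      then have "w \<in> cut_plane" using e(2) by blast
      from continuous_on_hyp_integrand[OF b(2) this] show "hyp_integrand b w integrable_on cbox 0 1"
        unfolding cbox_interval by (rule integrable_continuous_real)
    next
      have sub: "dist z w < e \<Longrightarrow> w \<in> cut_plane" for w using e(2) by auto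
      have c: "continuous_on (ball z e \<times> cbox 0 1) (\<lambda>x::complex \<times> real. (snd x) powr (1 / (1 - b)))"
      proof (rule continuous_on_powr'[OF continuous_on_snd[OF continuous_on_id] continuous_on_const], rule ballI)
        fix x assume "x \<in> ball z e \<times> cbox 0 (1::real)"
        then have "0 \<le> snd x" unfolding cbox_interval mem_Times_iff atLeastAtMost_iff by blast
        then show "0 \<le> snd x \<and> (snd x = 0 \<longrightarrow> 0 < 1 / (1 - b))" using b by simp
      qed
      show "continuous_on (ball z e \<times> cbox 0 1) (\<lambda>(z, t). (of_real b + 1) * of_real (t powr (1 / (1 - b))) * (1 - z * of_real (t powr (1 / (1 - b)))) powr (- of_real b - 2))"
        unfolding case_prod_beta
      proof (intro continuous_on_mult continuous_on_const continuous_on_of_real c)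
        show "continuous_on (ball z e \<times> cbox 0 1) (\<lambda>x. (1 - fst x * complex_of_real (snd x powr (1 / (1 - b)))) powr (- of_real b - 2))"
        proof (rule continuous_on_compose2[OF continuous_on_one_minus_powr])
          show "continuous_on (ball z e \<times> cbox 0 1) (\<lambda>x. fst x * complex_of_real (snd x powr (1 / (1 - b))))"
            by (intro continuous_on_mult continuous_on_of_real c continuous_on_fst continuous_on_id)
        qed (use sub b in \<open>auto intro!: cut_plane_scale\<close>)
      qed
    qed (rule convex_ball)
    then show ?thesis using e(1) holomorphic_on_imp_differentiable_at[OF _ open_ball centre_in_ball[THEN iffD2]] by blast
  qed
  then show ?thesis by (auto simp: holomorphic_on_def field_differentiable_at_within)
qed

lemma hyp_integral_sums:
  assumes b: "0 < b" "b < 1" and z: "norm z < 1"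
  shows "(\<lambda>n. of_real (pochhammer (b + 1) n / fact n * ((1 - b) / (real n + 1 - b))) * z ^ n) sums integral (cbox 0 1) (hyp_integrand b z)"
proof -
  define p where "p = 1 / (1 - b)"
  define cf where "cf n = complex_of_real (pochhammer (b + 1) n / fact n)" for n
  have p: "p > 0" using b by (simp add: p_def)
  have *: "(\<lambda>n. cf n * w ^ n) sums (1 - w) powr (- of_real b - 1)" if "norm w < 1" for w
  proof -
    have "- complex_of_real (b + 1) = - of_real b - 1" by simp
    then show ?thesis using one_minus_powr_sums[OF that, of "b + 1"] unfolding cf_def by (simp only:)
  qed
  have sm: "summable (\<lambda>n. norm (cf n) * norm z ^ n)"
  proof -
    have "conv_radius cf \<ge> 1"
    proof (rule conv_radius_geI_ex)
      fix r :: real assume r: "0 < r" "ereal r < 1"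
      then have "r < 1" by (metis one_ereal_def less_ereal.simps(1))
      with r show "\<exists>w. norm w = r \<and> summable (\<lambda>n. cf n * w ^ n)"
        using sums_summable[OF *[of "of_real r"]] r by (intro exI[of _ "of_real r"]) simp
    qed
    moreover have "ereal (norm z) < ereal 1" using z by simp
    ultimately have "ereal (norm z) < conv_radius cf" unfolding one_ereal_def by (rule less_le_trans[rotated])
    from abs_summable_in_conv_radius[OF this] show ?thesis by (simp only: norm_mult norm_power)
  qed
  have trm: "((\<lambda>t. cf n * (z * of_real (t powr p)) ^ n) has_integral of_real (pochhammer (b + 1) n / fact n * ((1 - b) / (real n + 1 - b))) * z ^ n) {0..1}" for n :: nat
  proof -
    have pn: "0 \<le> p * n" using p by simp
    have h0: "((\<lambda>t. t powr (p * n)) has_integral 1 powr (p*n+1) / (p * n + 1)) {0..1}"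
      by (rule has_integral_powr_from_0) (use pn in linarith)+
    have "((\<lambda>t. complex_of_real (t powr (p * n))) has_integral of_real (1 / (p * n + 1))) {0..1}"
      using has_integral_of_real[OF h0, where 'b=complex] unfolding powr_one_eq_one .
    from has_integral_mult_right[OF this, of "cf n * z ^ n"]
    have "((\<lambda>t. cf n * z ^ n * complex_of_real (t powr (p * n))) has_integral cf n * z ^ n * of_real (1 / (p * n + 1))) {0..1}" .
    then have "((\<lambda>t. cf n * (z * of_real (t powr p)) ^ n) has_integral cf n * z ^ n * of_real (1 / (p * n + 1))) {0..1}"
    proof (rule has_integral_spike_finite[of "{0}", rotated 2])
      fix t assume "t \<in> {0..1} - {0::real}"
      then have "0 < t powr p" by simp
      have "t powr (p * n) = (t powr p) powr n" by (rule powr_powr[symmetric])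
      also have "\<dots> = (t powr p) ^ n" by (rule powr_realpow) fact
      finally show "cf n * (z * of_real (t powr p)) ^ n = cf n * z ^ n * complex_of_real (t powr (p * n))"
        by (simp only: power_mult_distrib of_real_power mult.assoc)
    qed simp
    moreover have e: "1 / (p * n + 1) = (1 - b) / (real n + 1 - b)" using b by (simp add: p_def field_simps)
    have "cf n * z ^ n * of_real (1 / (p * n + 1)) = of_real (pochhammer (b + 1) n / fact n * ((1 - b) / (real n + 1 - b))) * z ^ n"
      unfolding e cf_def of_real_mult by (metis mult.assoc mult.commute)
    ultimately show ?thesis by (rule subst[rotated])
  qed
  have unif: "uniform_limit {0..1} (\<lambda>N t. \<Sum>n<N. cf n * (z * of_real (t powr p)) ^ n) (\<lambda>t. \<Sum>n. cf n * (z * of_real (t powr p)) ^ n) sequentially"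
  proof (rule Weierstrass_m_test[OF _ sm])
    fix n t assume t: "t \<in> {0..1::real}"
    have "t powr p \<le> 1" using t p by (simp add: powr_le1)
    then have "norm z * t powr p \<le> norm z * 1" by (intro mult_left_mono) auto
    then show "norm (cf n * (z * of_real (t powr p)) ^ n) \<le> norm (cf n) * norm z ^ n"
      unfolding norm_mult norm_power norm_of_real by (intro mult_left_mono power_mono) (simp_all add: abs_of_nonneg)
  qed
  have eq: "(\<Sum>n. cf n * (z * of_real (t powr p)) ^ n) = hyp_integrand b z t" if t: "t \<in> {0..1}" for t
  proof -
    have "t powr p \<le> 1" using t p by (simp add: powr_le1)
    then have "norm z * t powr p \<le> norm z * 1" by (intro mult_left_mono) auto
    then have "norm (z * of_real (t powr p)) < 1" using z by (simp add: norm_mult)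
    from sums_unique[OF *[OF this]] show ?thesis by (simp add: hyp_integrand_def p_def)
  qed
  obtain I J where I: "\<And>N. ((\<lambda>t. \<Sum>n<N. cf n * (z * of_real (t powr p)) ^ n) has_integral I N) {0..1}"
    and J: "((\<lambda>t. \<Sum>n. cf n * (z * of_real (t powr p)) ^ n) has_integral J) {0..1}" and IJ: "I \<longlonglongrightarrow> J"
    by (rule uniform_limit_integral[OF unif])
       (unfold p_def, intro continuous_on_sum continuous_on_mult continuous_on_power continuous_on_const continuous_on_of_real
          continuous_on_root_powr[OF b(2)], simp, blast)
  have I_eq: "I N = (\<Sum>n<N. of_real (pochhammer (b + 1) n / fact n * ((1 - b) / (real n + 1 - b))) * z ^ n)" for N
    by (rule has_integral_unique[OF I]) (intro has_integral_sum trm finite_lessThan)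
  moreover have "J = integral (cbox 0 1) (hyp_integrand b z)"
    using has_integral_eq[OF eq J] by (simp add: integral_unique)
  ultimately show ?thesis using IJ unfolding sums_def I_eq by (simp only:)
qed

text \<open>
The description of \<^const>\<open>hypergeo_2F1\<close> as a unique value is meaningful only if a continuation to the whole cut
plane exists; the integral of \<^const>\<open>hyp_integrand\<close> provides it.
\<close>

lemma hyp_continuation_exists:
  assumes b: "0 < b" "b < 1"
  shows "\<exists>F. F holomorphic_on cut_plane \<and> F has_fps_expansion Abs_fps (\<lambda>n. complex_of_real (hyp_coeff b n))"
proof -
  define F where "F z = (1 - z) powr (- of_real b) - of_real (b / (1 - b)) * (z * integral (cbox 0 1) (hyp_integrand b z))" for z
  have "F holomorphic_on cut_plane" unfolding F_def
    by (intro holomorphic_intros holomorphic_hyp_integral b) (rule cut_plane_powr_args)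
  define I where "I = Abs_fps (\<lambda>n. complex_of_real (pochhammer (b + 1) n / fact n * ((1 - b) / (real n + 1 - b))))"
  have I: "(\<lambda>z. integral (cbox 0 1) (hyp_integrand b z)) has_fps_expansion I"
  proof (rule has_fps_expansionI)
    have "eventually (\<lambda>u::complex. u \<in> ball 0 1) (nhds 0)" by (intro eventually_nhds_in_open) auto
    then show "\<forall>\<^sub>F u in nhds 0. (\<lambda>n. fps_nth I n * u ^ n) sums integral (cbox 0 1) (hyp_integrand b u)"
      by eventually_elim (unfold I_def fps_nth_Abs_fps, rule hyp_integral_sums[OF b], simp)
  qed
  have "F has_fps_expansion (Abs_fps (\<lambda>n. complex_of_real (pochhammer b n / fact n)) - fps_const (of_real (b / (1 - b))) * (fps_X * I))"
    (is "_ has_fps_expansion ?Q") unfolding F_def by (intro fps_expansion_intros I has_fps_expansion_powr_neg)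
  moreover have "?Q = Abs_fps (\<lambda>n. complex_of_real (hyp_coeff b n))"
  proof (rule fps_ext)
    fix n
    show "fps_nth ?Q n = fps_nth (Abs_fps (\<lambda>n. complex_of_real (hyp_coeff b n))) n"
    proof (cases n)
      case 0
      have "complex_of_real (hyp_coeff b 0) = 1" using b by (simp add: hyp_coeff_def)
      then show ?thesis using 0 by (simp only: fps_sub_nth fps_X_mult_nth fps_mult_left_const_nth fps_nth_Abs_fps simp_thms if_True mult_zero_right pochhammer_0 fact_0 div_by_1 of_real_1 diff_zero)
    next
      case (Suc m)
      have ne: "real m + 1 - b \<noteq> 0" "1 - b \<noteq> 0" using b by auto
      have "pochhammer b n / fact n - b / (1 - b) * (pochhammer (b + 1) m / fact m * ((1 - b) / (real m + 1 - b)))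
         = pochhammer b n / fact n - b * pochhammer (b + 1) m / fact m / (real m + 1 - b)"
        using ne by simp
      also have "b * pochhammer (b + 1) m / fact m / (real m + 1 - b) = (real n / (real n - b)) * (pochhammer b n / fact n)"
        using ne by (simp add: Suc pochhammer_rec divide_simps)
      also have "pochhammer b n / fact n - (real n / (real n - b)) * (pochhammer b n / fact n) = hyp_coeff b n"
      proof -
        have "1 - real n / (real n - b) = - b / (real n - b)" using ne by (simp add: Suc field_simps)
        then show ?thesis unfolding hyp_coeff_def by (metis left_diff_distrib mult_1_left)
      qed
      finally have "complex_of_real (pochhammer b n / fact n - b / (1 - b) * (pochhammer (b + 1) m / fact m * ((1 - b) / (real m + 1 - b)))) = of_real (hyp_coeff b n)"
        by (rule arg_cong)
      then show ?thesis
        unfolding I_def Suc by (simp only: fps_sub_nth fps_X_mult_nth fps_mult_left_const_nth fps_nth_Abs_fps simp_thms nat.distinct if_False of_real_diff of_real_mult diff_Suc_1)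
    qed
  qed
  ultimately show ?thesis using \<open>F holomorphic_on cut_plane\<close> by auto
qed

lemma hypergeo_2F1_eq:
  assumes b: "0 < b" "b < 1"
  obtains F where "F holomorphic_on cut_plane" "F has_fps_expansion Abs_fps (\<lambda>n. complex_of_real (hyp_coeff b n))"
    "\<And>z. z \<in> cut_plane \<Longrightarrow> hypergeo_2F1 (of_real (-b)) (of_real b) (of_real (1 - b)) z = F z"
proof -
  have fps: "fps_hypergeo [complex_of_real (-b), of_real b] [of_real (1-b)] 1 = Abs_fps (\<lambda>n. complex_of_real (hyp_coeff b n))"
    by (rule fps_ext) (simp only: fps_hypergeo_nth_shift[OF b] fps_nth_Abs_fps)
  obtain F where F: "F holomorphic_on cut_plane" "F has_fps_expansion Abs_fps (\<lambda>n. complex_of_real (hyp_coeff b n))"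
    using hyp_continuation_exists[OF b] by auto
  have "hypergeo_2F1 (of_real (-b)) (of_real b) (of_real (1 - b)) z = F z" if z: "z \<in> cut_plane" for z
    unfolding hypergeo_2F1_def fps cut_plane_def[symmetric]
  proof (rule the_equality)
    show "\<exists>G. G holomorphic_on cut_plane \<and> G has_fps_expansion Abs_fps (\<lambda>n. complex_of_real (hyp_coeff b n)) \<and> F z = G z"
      using F by auto
  next
    fix w assume "\<exists>G. G holomorphic_on cut_plane \<and> G has_fps_expansion Abs_fps (\<lambda>n. complex_of_real (hyp_coeff b n)) \<and> w = G z"
    then show "w = F z" using hyp_continuation_unique[OF _ _ F z] by auto
  qed
  with F that show ?thesis by blast
qed

section \<open>The Volterra kernel and its fractional inversion\<close>

text \<open>
This is \<open>F(1, b; 1 - b; u)\<close>. Its coefficients are nonnegative, in contrast to those of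
\<open>F(-b, b; 1 - b; z)\<close>, and \<open>u = z / (z - 1)\<close> maps the negative axis into the interval of convergence.
\<close>

definition ratio_series :: "real \<Rightarrow> real \<Rightarrow> real" where
  "ratio_series b u = (\<Sum>n. pochhammer b n / pochhammer (1 - b) n * u ^ n)"

context
  fixes b :: real
  assumes b: "0 < b" "b < 1/2"
begin

lemma ratio_coeff_bounds:
  "0 \<le> pochhammer b n / pochhammer (1 - b) n" "pochhammer b n / pochhammer (1 - b) n \<le> 1"
proof -
  have p: "0 < pochhammer b n" "0 < pochhammer (1 - b) n" for n using b by (auto intro!: pochhammer_pos)
  show "0 \<le> pochhammer b n / pochhammer (1 - b) n" using p[of n] by simp
  have "pochhammer b n \<le> pochhammer (1 - b) n"
  proof (induction n)
    case (Suc n)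
    show ?case unfolding pochhammer_Suc using Suc p[of n] b by (intro mult_mono) auto
  qed simp
  then show "pochhammer b n / pochhammer (1 - b) n \<le> 1" using p[of n] by simp
qed

lemma ratio_summable:
  assumes "norm (u::real) < 1" shows "summable (\<lambda>n. pochhammer b n / pochhammer (1 - b) n * u ^ n)"
proof (rule summable_comparison_test')
  show "summable (\<lambda>n. norm u ^ n)" using assms by (simp add: summable_geometric)
  show "norm (pochhammer b n / pochhammer (1 - b) n * u ^ n) \<le> norm u ^ n" if "n \<ge> 0" for n
  proof -
    have "norm (pochhammer b n / pochhammer (1 - b) n * u ^ n) = (pochhammer b n / pochhammer (1 - b) n) * norm u ^ n"
      unfolding real_norm_def abs_mult power_abs abs_of_nonneg[OF ratio_coeff_bounds(1)[of n]] ..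
    also have "\<dots> \<le> 1 * norm u ^ n" by (intro mult_right_mono ratio_coeff_bounds) simp
    finally show ?thesis by simp
  qed
qed

lemma ratio_series_sums:
  assumes "norm u < 1" shows "(\<lambda>n. pochhammer b n / pochhammer (1 - b) n * u ^ n) sums ratio_series b u"
  unfolding ratio_series_def by (rule summable_sums[OF ratio_summable[OF assms]])

text \<open>
The recursion \<open>(n + 1 - b) g\<^sub>n\<^sub>+\<^sub>1 = (n + b) g\<^sub>n\<close> of the coefficients, summed over \<open>n\<close>.
\<close>

lemma ratio_series_ode:
  assumes u: "norm u < 1"
  obtains G' where "(ratio_series b has_real_derivative G') (at u)"
    "u * (1 - u) * G' = b * (ratio_series b u - 1) + b * u * ratio_series b u"
proof -
  define g where "g n = pochhammer b n / pochhammer (1 - b) n" for n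
  define G' where "G' = (\<Sum>n. diffs g n * u ^ n)"
  have sm: "summable (\<lambda>n. g n * x ^ n)" if "norm x < 1" for x unfolding g_def by (rule ratio_summable[OF that])
  have D: "(ratio_series b has_real_derivative G') (at u)"
    using termdiffs_strong'[OF sm u] unfolding G'_def ratio_series_def g_def .
  have "(\<lambda>n. diffs g n * u ^ n) sums G'"
    unfolding G'_def by (rule summable_sums[OF termdiff_converges[OF u sm]])
  from sums_mult[OF this, of u] have A: "(\<lambda>n. real (Suc n) * g (Suc n) * u ^ Suc n) sums (u * G')"
    by (simp add: diffs_def mult_ac)
  then have B: "(\<lambda>n. real n * g n * u ^ n) sums (u * G')"
    using sums_Suc_iff[of "\<lambda>n. real n * g n * u ^ n" "u * G'"] by simp
  have C: "(\<lambda>n. g n * u ^ n) sums ratio_series b u"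
    unfolding g_def by (rule ratio_series_sums[OF u])
  have g0: "g 0 = 1" by (simp add: g_def)
  have E: "(\<lambda>n. g (Suc n) * u ^ Suc n) sums (ratio_series b u - 1)"
    using C sums_Suc_iff[of "\<lambda>n. g n * u ^ n" "ratio_series b u - 1"] g0 by simp
  have rec: "(real (Suc n) - b) * g (Suc n) = (real n + b) * g n" for n
  proof -
    have p: "0 < pochhammer (1 - b) n" "0 < 1 - b + real n" using b by (auto intro!: pochhammer_pos)
    then have q: "real (Suc n) - b = 1 - b + real n" "1 - b + real n \<noteq> 0" "pochhammer (1 - b) n \<noteq> 0" by auto
    show ?thesis unfolding g_def pochhammer_Suc q(1) using q(2,3) by (simp add: divide_simps)
  qed
  have "(\<lambda>n. real (Suc n) * g (Suc n) * u ^ Suc n - u * (real n * g n * u ^ n) - b * (g (Suc n) * u ^ Suc n) - b * u * (g n * u ^ n))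
     sums (u * G' - u * (u * G') - b * (ratio_series b u - 1) - b * u * ratio_series b u)"
    by (intro sums_diff sums_mult A B C E)
  moreover have "real (Suc n) * g (Suc n) * u ^ Suc n - u * (real n * g n * u ^ n) - b * (g (Suc n) * u ^ Suc n) - b * u * (g n * u ^ n) = 0" for n
  proof -
    have "real (Suc n) * g (Suc n) * u ^ Suc n - u * (real n * g n * u ^ n) - b * (g (Suc n) * u ^ Suc n) - b * u * (g n * u ^ n)
      = u ^ Suc n * ((real (Suc n) - b) * g (Suc n) - (real n + b) * g n)" by (simp add: algebra_simps)
    then show ?thesis unfolding rec by simp
  qed
  ultimately have "(\<lambda>n::nat. 0::real) sums (u * G' - u * (u * G') - b * (ratio_series b u - 1) - b * u * ratio_series b u)" by (simp only:)
  then have "u * G' - u * (u * G') - b * (ratio_series b u - 1) - b * u * ratio_series b u = 0"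
    using sums_unique2 sums_zero by blast
  then have "u * (1 - u) * G' = b * (ratio_series b u - 1) + b * u * ratio_series b u" by (simp add: algebra_simps)
  with D that show ?thesis by blast
qed

text \<open>
Pfaff's transformation for these parameters. Both sides, as functions of \<open>u\<close>, solve
\<open>u (1 - u) P' = b (P - (1 - u)\<^sup>b)\<close>. Their difference solves the homogeneous equation and is therefore a
multiple of \<open>(u / (1 - u))\<^sup>b\<close>; being differentiable at \<open>0\<close>, where it vanishes, it is \<open>O(u)\<close>, and \<open>b < 1\<close>
forces the multiple to be zero.
\<close>

lemma hyp_negative_axis:
  assumes F: "F holomorphic_on cut_plane"
    "F has_fps_expansion Abs_fps (\<lambda>n. complex_of_real (hyp_coeff b n))" and u: "0 < u" "u < 1"
  shows "Re (F (of_real (- u / (1 - u)))) = (1 - u) powr b * ratio_series b u"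
proof -
  have b1: "b < 1" using b by simp
  define p where "p x = Re (F (of_real x))" for x
  define p' where "p' x = Re (deriv F (of_real x))" for x
  have cp: "complex_of_real x \<in> cut_plane" if "x < 1" for x using that by (simp add: cut_plane_iff)
  have dp: "(p has_real_derivative p' x) (at x)" if "x < 1" for x
  proof -
    have "(F has_field_derivative deriv F (of_real x)) (at (of_real x))"
      using holomorphic_derivI[OF F(1) open_cut_plane cp[OF that]] .
    from bounded_linear.has_vector_derivative[OF bounded_linear_Re has_vector_derivative_real_field[OF this, of UNIV]]
    show ?thesis by (simp add: p_def[abs_def] p'_def has_real_derivative_iff_has_vector_derivative)
  qed
  have ode: "x * p' x = b * (p x - (1 - x) powr (- b))" if "x < 1" for x
  proof -
    have "of_real x * deriv F (of_real x) = of_real b * (F (of_real x) - (1 - of_real x) powr (- of_real b))"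
      by (rule hyp_ode[OF b(1) b1 F cp[OF that]])
    moreover have "(1 - complex_of_real x) powr (- of_real b) = of_real ((1 - x) powr (- b))"
      using powr_of_real[of "1 - x" "- b"] that by simp
    ultimately have "Re (of_real x * deriv F (of_real x)) = Re (of_real b * (F (of_real x) - of_real ((1 - x) powr (- b))))" by simp
    then show ?thesis by (simp add: p_def p'_def)
  qed
  define D where "D u = p (- u / (1 - u)) - (1 - u) powr b * ratio_series b u" for u
  have DD: "\<exists>D'. (D has_real_derivative D') (at u) \<and> u * (1 - u) * D' = b * D u" if u: "norm u < 1" for u
  proof -
    obtain G' where G': "(ratio_series b has_real_derivative G') (at u)"
      "u * (1 - u) * G' = b * (ratio_series b u - 1) + b * u * ratio_series b u" using ratio_series_ode[OF u] .
    have u1: "0 < 1 - u" using u by simp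
    define x where "x = - u / (1 - u)"
    have x1: "1 - x = 1 / (1 - u)" using u1 by (simp add: x_def field_simps)
    then have "x < 1" using u1 by (smt (verit) divide_pos_pos)
    have dx: "((\<lambda>u. - u / (1 - u)) has_real_derivative - 1 / (1 - u)^2) (at u)"
      using u1 by (auto intro!: derivative_eq_intros simp: field_simps power2_eq_square)
    have d1: "((\<lambda>u. p (- u / (1 - u))) has_real_derivative p' x * (- 1 / (1 - u)^2)) (at u)"
      using DERIV_chain2[OF _ dx, of p "p' x"] dp[OF \<open>x < 1\<close>] by (simp add: x_def)
    have d2: "((\<lambda>u. (1 - u) powr b) has_real_derivative - (b * (1 - u) powr (b - 1))) (at u)"
      using u1 by (auto intro!: derivative_eq_intros)
    have d3: "(D has_real_derivative p' x * (- 1 / (1 - u)^2) - (- (b * (1 - u) powr (b - 1)) * ratio_series b u + G' * (1 - u) powr b)) (at u)"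
      unfolding D_def by (intro DERIV_diff d1 DERIV_mult d2 G'(1))
    have "(1 - u) * (- 1 / (1 - u)^2) = - 1 / (1 - u)" using u1 by (simp add: power2_eq_square)
    moreover have "u * (1 - u) * (q * (- 1 / (1 - u)^2)) = u * q * ((1 - u) * (- 1 / (1 - u)^2))" for q by (simp only: mult_ac)
    ultimately have e1: "u * (1 - u) * (p' x * (- 1 / (1 - u)^2)) = x * p' x" by (simp add: x_def)
    have e2: "(1 - u) * (1 - u) powr (b - 1) = (1 - u) powr b" using u1 by (simp add: powr_diff)
    have e3: "(1 - x) powr (- b) = (1 - u) powr b" unfolding x1 using u1 by (simp add: powr_divide powr_minus)
    have "u * (1 - u) * (p' x * (- 1 / (1 - u)^2) - (- (b * (1 - u) powr (b - 1)) * ratio_series b u + G' * (1 - u) powr b))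
      = u * (1 - u) * (p' x * (- 1 / (1 - u)^2)) + b * u * ratio_series b u * ((1 - u) * (1 - u) powr (b - 1)) - (u * (1 - u) * G') * (1 - u) powr b"
      by (simp add: algebra_simps)
    also have "\<dots> = b * (p x - (1 - u) powr b) + b * u * ratio_series b u * (1 - u) powr b - (b * (ratio_series b u - 1) + b * u * ratio_series b u) * (1 - u) powr b"
      unfolding e1 e2 G'(2) ode[OF \<open>x < 1\<close>] e3 ..
    also have "\<dots> = b * D u" unfolding D_def x_def by (simp add: algebra_simps)
    finally show ?thesis using d3 by blast
  qed
  \<comment> \<open>The homogeneous equation for \<open>D\<close> makes \<open>D(u) ((1 - u) / u)\<^sup>b\<close> constant.\<close>
  define R where "R u = D u * exp (b * (ln (1 - u) - ln u))" for u
  have "\<exists>c. \<forall>u\<in>{0<..<1}. R u = c"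
  proof (rule has_field_derivative_zero_constant)
    fix u :: real assume u: "u \<in> {0<..<1}"
    obtain D' where D': "(D has_real_derivative D') (at u)" "u * (1 - u) * D' = b * D u" using DD[of u] u by auto
    have "(R has_real_derivative D' * exp (b * (ln (1 - u) - ln u)) + (exp (b * (ln (1 - u) - ln u)) * (b * (- 1 / (1 - u) - 1 / u))) * D u) (at u)"
      unfolding R_def using u by (intro DERIV_mult D'(1)) (auto intro!: derivative_eq_intros)
    moreover have "D' * exp (b * (ln (1 - u) - ln u)) + (exp (b * (ln (1 - u) - ln u)) * (b * (- 1 / (1 - u) - 1 / u))) * D u = 0"
    proof -
      have "D' = b * D u / (u * (1 - u))" using D'(2) u by (simp add: field_simps)
      moreover have "- 1 / (1 - u) - 1 / u = - 1 / (u * (1 - u))" using u by (simp add: divide_simps)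
      moreover have "D' * E + (E * (b * q)) * D u = E * (D' + b * D u * q)" for E q by (simp add: algebra_simps)
      ultimately show ?thesis by simp
    qed
    ultimately show "(R has_real_derivative 0) (at u within {0<..<1})" by (simp add: has_field_derivative_at_within)
  qed simp
  then obtain c where c: "\<And>u. u \<in> {0<..<1} \<Longrightarrow> R u = c" by blast
  \<comment> \<open>The constant is zero: \<open>R(u) = (D(u) / u) u\<^sup>1\<^sup>-\<^sup>b (1 - u)\<^sup>b\<close>, where the first factor stays bounded.\<close>
  have "(R \<longlongrightarrow> 0) (at_right 0)"
  proof -
    obtain D' where D': "(D has_real_derivative D') (at 0)" using DD[of 0] by auto
    have D0: "D 0 = 0"
    proof -
      have "F 0 = fps_nth (Abs_fps (\<lambda>n. complex_of_real (hyp_coeff b n))) 0"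
        using has_fps_expansion_imp_0_eq_fps_nth_0[OF F(2)] .
      then have "F 0 = 1" using b by (simp add: hyp_coeff_def)
      moreover have "ratio_series b 0 = 1" unfolding ratio_series_def by (simp only: powser_zero) simp
      ultimately show ?thesis by (simp add: D_def p_def)
    qed
    have "((\<lambda>u. D u / u) \<longlongrightarrow> D') (at_right 0)"
      using D' unfolding has_field_derivative_iff D0 by (simp add: filterlim_at_split)
    moreover have "((\<lambda>u. u powr (1 - b) * (1 - u) powr b) \<longlongrightarrow> 0 powr (1 - b) * (1 - 0) powr b) (at_right (0::real))"
      using b by (intro tendsto_mult tendsto_powr' tendsto_diff tendsto_const tendsto_ident_at) (auto simp: eventually_at_right_less eventually_at_filter)
    ultimately have "((\<lambda>u. D u / u * (u powr (1 - b) * (1 - u) powr b)) \<longlongrightarrow> D' * 0) (at_right 0)"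
      using tendsto_mult[of "\<lambda>u. D u / u" D' "at_right 0" "\<lambda>u. u powr (1 - b) * (1 - u) powr b" 0] by simp
    moreover have "\<forall>\<^sub>F u in at_right 0. D u / u * (u powr (1 - b) * (1 - u) powr b) = R u"
      using eventually_at_right_real[of 0 1]
    proof (rule eventually_mono)
      fix u :: real assume u: "u \<in> {0<..<1}"
      have "exp (b * (ln (1 - u) - ln u)) = (1 - u) powr b / u powr b"
        using u by (simp add: powr_def right_diff_distrib exp_diff)
      moreover have "u powr (1 - b) = u / u powr b" using u by (simp add: powr_diff)
      ultimately show "D u / u * (u powr (1 - b) * (1 - u) powr b) = R u" using u by (simp add: R_def)
    qed simp
    ultimately show ?thesis by (simp add: tendsto_cong)
  qed
  moreover have "(R \<longlongrightarrow> c) (at_right 0)"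
    using eventually_at_right_real[of 0 1] by (intro tendsto_eventually) (auto elim!: eventually_mono intro: c)
  ultimately have "c = 0" using tendsto_unique trivial_limit_at_right_real by blast
  then have "R u = 0" using c u by simp
  then show ?thesis by (simp add: R_def D_def p_def)
qed

end

lemma fbm_kernel_eq:
  assumes H: "0 < H" "H < 1/2" and st: "0 < s" "s < t"
  shows "fbm_kernel H t s = inverse (Gamma (H + 1/2)) * (t - s) powr (H - 1/2) * ((s / t) powr (1/2 - H) * ratio_series (1/2 - H) (1 - s / t))"
proof -
  have b: "0 < 1/2 - H" "1/2 - H < 1" "1/2 - H < 1/2" using H by auto
  obtain F where F: "F holomorphic_on cut_plane" "F has_fps_expansion Abs_fps (\<lambda>n. complex_of_real (hyp_coeff (1/2 - H) n))"
    "\<And>z. z \<in> cut_plane \<Longrightarrow> hypergeo_2F1 (of_real (-(1/2-H))) (of_real (1/2-H)) (of_real (1 - (1/2-H))) z = F z"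
    using hypergeo_2F1_eq[OF b(1,2)] by metis
  have e: "- (1 - s / t) / (1 - (1 - s / t)) = 1 - t / s" using st by (simp add: field_simps)
  have "complex_of_real (1 - t / s) \<in> cut_plane" using st by (simp add: cut_plane_iff not_le)
  from F(3)[OF this] have 1: "hypergeo_2F1 (of_real (H - 1/2)) (of_real (1/2-H)) (of_real (H + 1/2)) (of_real (1 - t / s)) = F (of_real (1 - t / s))"
    by (simp add: add.commute)
  have "Re (F (of_real (1 - t / s))) = (1 - (1 - s / t)) powr (1/2 - H) * ratio_series (1/2 - H) (1 - s / t)"
    using hyp_negative_axis[OF b(1,3) F(1,2), of "1 - s / t"] st unfolding e by simp
  then show ?thesis unfolding fbm_kernel_def 1 using st by simp
qed

lemma nn_integral_Beta:
  fixes p q r t :: real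
  assumes pq: "0 < p" "0 < q" and rt: "r < t"
  shows "(\<integral>\<^sup>+s. ennreal ((t - s) powr (p - 1) * (s - r) powr (q - 1)) * indicator {r<..<t} s \<partial>lborel)
     = ennreal ((t - r) powr (p + q - 1) * Beta p q)"
proof -
  define c where "c = t - r"
  have c: "c > 0" and tc: "t = r + c" using rt by (simp_all add: c_def)
  have BB: "0 \<le> Beta p q" using pq by (simp add: Beta_def Gamma_real_pos less_imp_le)
  have B: "((\<lambda>x. x powr (q - 1) * (1 - x) powr (p - 1)) has_integral Beta q p) {0..1}"
    by (rule has_integral_Beta_real[OF pq(2,1)])
  have "((\<lambda>x. indicator {0..1} x * (x powr (q - 1) * (1 - x) powr (p - 1))) has_integral Beta q p) UNIV"
    using B unfolding has_integral_restrict_UNIV[of "{0..1}", symmetric] by (rule has_integral_eq[rotated]) (simp add: indicator_def)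
  then have 1: "(\<integral>\<^sup>+x. ennreal (indicator {0..1} x * (x powr (q - 1) * (1 - x) powr (p - 1))) \<partial>lborel) = ennreal (Beta q p)"
    by (intro nn_integral_has_integral_lborel) auto
  have "(\<integral>\<^sup>+s. ennreal ((t - s) powr (p - 1) * (s - r) powr (q - 1)) * indicator {r<..<t} s \<partial>lborel)
    = ennreal \<bar>c\<bar> * (\<integral>\<^sup>+x. ennreal ((t - (r + c * x)) powr (p - 1) * ((r + c * x) - r) powr (q - 1)) * indicator {r<..<t} (r + c * x) \<partial>lborel)"
    using c by (intro nn_integral_real_affine) auto
  also have "(\<integral>\<^sup>+x. ennreal ((t - (r + c * x)) powr (p - 1) * ((r + c * x) - r) powr (q - 1)) * indicator {r<..<t} (r + c * x) \<partial>lborel)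
     = (\<integral>\<^sup>+x. ennreal (c powr (p - 1 + (q - 1))) * ennreal (indicator {0..1} x * (x powr (q - 1) * (1 - x) powr (p - 1))) \<partial>lborel)"
  proof (rule nn_integral_cong_AE)
    have "AE x in lborel. x \<noteq> 0 \<and> x \<noteq> (1::real)" using AE_lborel_singleton[of 0] AE_lborel_singleton[of 1] by eventually_elim simp
    then show "AE x in lborel. ennreal ((t - (r + c * x)) powr (p - 1) * ((r + c * x) - r) powr (q - 1)) * indicator {r<..<t} (r + c * x)
      = ennreal (c powr (p - 1 + (q - 1))) * ennreal (indicator {0..1} x * (x powr (q - 1) * (1 - x) powr (p - 1)))"
    proof eventually_elim
      case (elim x)
      show ?case
      proof (cases "0 < x \<and> x < 1")
        case True
        have "c * x < c * 1" using True c by (intro mult_strict_left_mono) auto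
        then have "r + c * x < t" using tc by linarith
        then have "indicator {r<..<t} (r + c * x) = (1::ennreal)" using True c by simp
        moreover have "t - (r + c * x) = c * (1 - x)" by (simp add: c_def algebra_simps)
        ultimately show ?thesis using True c powr_add[of c "p - 1" "q - 1"] by (simp add: powr_mult ennreal_mult[symmetric] mult_ac)
      next
        case False
        have "\<not> (r < r + c * x \<and> r + c * x < t)"
        proof
          assume *: "r < r + c * x \<and> r + c * x < t"
          then have "0 < c * x" by simp
          moreover have "c * x < c * 1" using * tc by linarith
          ultimately have "0 < x" "x < 1" using c by (auto simp: zero_less_mult_iff simp del: mult_1_right)
          with False show False by simp
        qed
        then have "indicator {r<..<t} (r + c * x) = (0::ennreal)" by auto
        moreover have "indicator {0..1} x = (0::real)" using False elim by auto
        ultimately show ?thesis by simp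
      qed
    qed
  qed
  also have "\<dots> = ennreal (c powr (p - 1 + (q - 1))) * ennreal (Beta q p)"
    by (subst nn_integral_cmult) (auto simp: 1)
  also have "ennreal \<bar>c\<bar> * (ennreal (c powr (p - 1 + (q - 1))) * ennreal (Beta q p)) = ennreal (c powr (p + q - 1) * Beta p q)"
  proof -
    have "c powr (p + q - 1) = c powr (1 + (p - 1 + (q - 1)))" by (rule arg_cong) simp
    also have "\<dots> = c * c powr (p - 1 + (q - 1))" unfolding powr_add[of c 1] using c by simp
    finally show ?thesis using c BB by (simp add: ennreal_mult[symmetric] Beta_commute[of q p] mult.assoc)
  qed
  finally show ?thesis by (simp add: c_def)
qed

lemma Beta_shift:
  fixes b :: real assumes b: "0 < b" "b < 1"
  shows "Beta (real n + 1 - b) b = pochhammer (1 - b) n * Gamma (1 - b) * Gamma b / fact n"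
proof -
  have "Gamma (1 - b + real n) = pochhammer (1 - b) n * Gamma (1 - b)"
  proof -
    have "1 - b \<notin> \<int>\<^sub>\<le>\<^sub>0" using b by (auto elim!: nonpos_Ints_cases)
    then show ?thesis using pochhammer_Gamma[of "1 - b" n] Gamma_eq_zero_iff[of "1-b"] by simp
  qed
  moreover have "Gamma (real n + 1) = fact n" using Gamma_fact[of n, where 'a=real] by (simp add: add.commute)
  ultimately show ?thesis by (simp add: Beta_def algebra_simps)
qed

text \<open>
Applied to a fractional integral of order \<open>1/2 - H\<close> between suitable power weights, the kernel gives back
plain integration. Inserting the series of \<^const>\<open>ratio_series\<close> and integrating term by term,
each Beta integral \<open>B(n + 1 - b, b)\<close> cancels the denominator \<open>(1 - b)\<^sub>n\<close> of its coefficient; what is left is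
the binomial series of \<open>(r / t)\<^sup>-\<^sup>b\<close>. All terms are nonnegative, so no convergence question arises.
\<close>

lemma fbm_kernel_inversion:
  assumes H: "0 < H" "H < 1/2" and rt: "0 < r" "r < t"
  shows "(\<integral>\<^sup>+s. ennreal (fbm_kernel H t s * (s powr (H - 1/2) * (s - r) powr (- 1/2 - H))) * indicator {r<..<t} s \<partial>lborel)
     = ennreal (Gamma (1/2 - H) * r powr (H - 1/2))"
proof -
  define b where "b = 1/2 - H"
  have b: "0 < b" "b < 1/2" "b < 1" using H by (auto simp: b_def)
  have Hb: "H + 1/2 = 1 - b" "H - 1/2 = - b" "1/2 - H = b" "- 1/2 - H = b - 1" by (auto simp: b_def)
  have t: "0 < t" using rt by simp
  define A where "A = inverse (Gamma (1 - b)) * t powr (- b)"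
  have A: "0 \<le> A" using b by (auto simp: A_def intro!: Gamma_real_pos less_imp_le)
  define g where "g n = pochhammer b n / pochhammer (1 - b) n" for n
  have g: "0 \<le> g n" for n using ratio_coeff_bounds(1)[OF b(1,2)] by (simp add: g_def)
  \<comment> \<open>For \<open>s\<close> between \<open>r\<close> and \<open>t\<close> the power \<open>s\<^sup>-\<^sup>b\<close> cancels \<open>(s / t)\<^sup>b\<close>, and \<open>1 - s / t = (t - s) / t\<close>.\<close>
  have eq: "ennreal (fbm_kernel H t s * (s powr (H - 1/2) * (s - r) powr (- 1/2 - H))) * indicator {r<..<t} s
    = (\<Sum>n. ennreal (A * g n * inverse (t ^ n)) * (ennreal ((t - s) powr (real n + 1 - b - 1) * (s - r) powr (b - 1)) * indicator {r<..<t} s))" for s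
  proof (cases "r < s \<and> s < t")
    case True
    then have s: "0 < s" "0 < t - s" using rt by auto
    have u: "norm (1 - s / t) < 1" using s t True by (auto simp: abs_if field_simps)
    have "(\<lambda>n. (A * (t - s) powr (- b) * (s - r) powr (b - 1)) * (g n * (1 - s / t) ^ n)) sums ((A * (t - s) powr (- b) * (s - r) powr (b - 1)) * ratio_series b (1 - s / t))"
      unfolding g_def by (intro sums_mult ratio_series_sums b u)
    also have "(A * (t - s) powr (- b) * (s - r) powr (b - 1)) * ratio_series b (1 - s / t) = fbm_kernel H t s * (s powr (- b) * (s - r) powr (b - 1))"
      using fbm_kernel_eq[OF H s(1), of t] True s t unfolding Hb A_def by (simp add: powr_divide powr_minus field_simps)
    also have "(\<lambda>n. (A * (t - s) powr (- b) * (s - r) powr (b - 1)) * (g n * (1 - s / t) ^ n)) = (\<lambda>n. (A * g n * inverse (t ^ n)) * ((t - s) powr (real n + 1 - b - 1) * (s - r) powr (b - 1)))"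
    proof
      fix n
      have "1 - s / t = (t - s) / t" using t by (simp add: diff_divide_distrib)
      then have "(1 - s / t) ^ n = (t - s) ^ n / t ^ n" by (simp only: power_divide)
      then have 1: "(1 - s / t) ^ n = (t - s) ^ n * inverse (t ^ n)" by (simp only: divide_inverse)
      have 2: "(t - s) powr (real n + 1 - b - 1) = (t - s) ^ n * (t - s) powr (- b)"
        using s(2) by (simp add: powr_realpow[symmetric] powr_add[symmetric])
      show "(A * (t - s) powr (- b) * (s - r) powr (b - 1)) * (g n * (1 - s / t) ^ n) = (A * g n * inverse (t ^ n)) * ((t - s) powr (real n + 1 - b - 1) * (s - r) powr (b - 1))"
        unfolding 1 2 by (simp only: mult_ac)
    qed
    finally have S: "(\<lambda>n. (A * g n * inverse (t ^ n)) * ((t - s) powr (real n + 1 - b - 1) * (s - r) powr (b - 1))) sums (fbm_kernel H t s * (s powr (- b) * (s - r) powr (b - 1)))" .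
    have "(\<Sum>n. ennreal ((A * g n * inverse (t ^ n)) * ((t - s) powr (real n + 1 - b - 1) * (s - r) powr (b - 1)))) = ennreal (fbm_kernel H t s * (s powr (- b) * (s - r) powr (b - 1)))"
      unfolding sums_unique[OF S] by (rule suminf_ennreal2) (use A g t S in \<open>auto simp: sums_iff\<close>)
    then show ?thesis unfolding Hb using True A g t by (simp add: ennreal_mult[symmetric])
  qed simp
  have "(\<integral>\<^sup>+s. ennreal (fbm_kernel H t s * (s powr (H - 1/2) * (s - r) powr (- 1/2 - H))) * indicator {r<..<t} s \<partial>lborel)
    = (\<Sum>n. ennreal (A * g n * inverse (t ^ n)) * (\<integral>\<^sup>+s. ennreal ((t - s) powr (real n + 1 - b - 1) * (s - r) powr (b - 1)) * indicator {r<..<t} s \<partial>lborel))"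
    unfolding eq by (subst nn_integral_suminf) (auto simp: nn_integral_cmult)
  also have "\<dots> = (\<Sum>n. ennreal ((t powr (- b) * Gamma b) * (pochhammer b n / fact n * (1 - r / t) ^ n)))"
  proof (rule suminf_cong)
    fix n
    have "(\<integral>\<^sup>+s. ennreal ((t - s) powr (real n + 1 - b - 1) * (s - r) powr (b - 1)) * indicator {r<..<t} s \<partial>lborel) = ennreal ((t - r) powr real n * Beta (real n + 1 - b) b)"
      using nn_integral_Beta[of "real n + 1 - b" b r t] b rt by simp
    moreover have "(A * g n * inverse (t ^ n)) * ((t - r) powr real n * Beta (real n + 1 - b) b) = (t powr (- b) * Gamma b) * (pochhammer b n / fact n * (1 - r / t) ^ n)"
    proof -
      have "1 - r / t = (t - r) / t" using t by (simp add: diff_divide_distrib)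
      then have "(1 - r / t) ^ n = (t - r) ^ n / t ^ n" by (simp only: power_divide)
      then have 1: "(1 - r / t) ^ n = (t - r) ^ n * inverse (t ^ n)" by (simp only: divide_inverse)
      have 2: "(t - r) powr real n = (t - r) ^ n" using rt by (simp add: powr_realpow)
      have 3: "pochhammer (1 - b) n > 0" "Gamma (1 - b) > 0" using b by (auto intro!: pochhammer_pos Gamma_real_pos)
      show ?thesis unfolding 1 2 A_def g_def Beta_shift[OF b(1,3)] using 3 by (simp add: field_simps)
    qed
    ultimately show "ennreal (A * g n * inverse (t ^ n)) * (\<integral>\<^sup>+s. ennreal ((t - s) powr (real n + 1 - b - 1) * (s - r) powr (b - 1)) * indicator {r<..<t} s \<partial>lborel) = ennreal ((t powr (- b) * Gamma b) * (pochhammer b n / fact n * (1 - r / t) ^ n))"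
      using A g t by (simp add: ennreal_mult'[symmetric])
  qed
  also have "\<dots> = ennreal (Gamma b * r powr (- b))"
  proof -
    have z: "\<bar>- (1 - r / t)\<bar> < 1" using rt t by (simp add: abs_if field_simps)
    have "(\<lambda>n. ((- b) gchoose n) * (- (1 - r / t)) ^ n) sums (1 + - (1 - r / t)) powr (- b)"
      by (rule gen_binomial_real[OF z])
    moreover have "((- b) gchoose n) * (- (1 - r / t)) ^ n = pochhammer b n / fact n * (1 - r / t) ^ n" for n
    proof -
      have 1: "(- (1 - r / t))^n = (-1)^n * (1 - r / t)^n" by (rule power_minus)
      have 2: "(-1)^n * (-1)^n = (1::real)" by (simp flip: power_mult_distrib)
      have "((- b) gchoose n) * (- (1 - r / t))^n = ((-1)^n * (-1)^n) * (pochhammer b n / fact n * (1 - r / t)^n)"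
        unfolding gbinomial_pochhammer 1 by (simp only: minus_minus times_divide_eq_left times_divide_eq_right mult_ac)
      then show ?thesis unfolding 2 by simp
    qed
    ultimately have "(\<lambda>n. pochhammer b n / fact n * (1 - r / t) ^ n) sums ((r / t) powr (- b))" by simp
    from sums_mult[OF this, of "t powr (- b) * Gamma b"]
    have S: "(\<lambda>n. (t powr (- b) * Gamma b) * (pochhammer b n / fact n * (1 - r / t) ^ n)) sums ((t powr (- b) * Gamma b) * (r / t) powr (- b))" .
    have "(t powr (- b) * Gamma b) * (r / t) powr (- b) = Gamma b * r powr (- b)" using t rt by (simp add: powr_divide)
    with S have S': "(\<lambda>n. (t powr (- b) * Gamma b) * (pochhammer b n / fact n * (1 - r / t) ^ n)) sums (Gamma b * r powr (- b))" by simp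
    have "1 - r / t \<ge> 0" using rt t by (simp add: field_simps)
    then show ?thesis unfolding sums_unique[OF S'] using b S'
      by (intro suminf_ennreal2) (auto simp: sums_iff intro!: mult_nonneg_nonneg divide_nonneg_nonneg less_imp_le[OF Gamma_real_pos] pochhammer_nonneg)
  qed
  finally show ?thesis unfolding Hb .
qed

lemma fbm_kernel_nonneg:
  assumes H: "0 < H" "H < 1/2" shows "0 \<le> fbm_kernel H t s"
proof (cases "0 < s \<and> s < t")
  case True
  have b: "0 < 1/2 - H" "1/2 - H < 1/2" using H by auto
  have "norm (1 - s / t) < 1" and "0 \<le> 1 - s / t" using True by (auto simp: abs_if field_simps)
  have "0 \<le> ratio_series (1/2 - H) (1 - s / t)"
    by (rule sums_le[OF _ sums_zero ratio_series_sums[OF b \<open>norm _ < 1\<close>]])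
       (intro mult_nonneg_nonneg ratio_coeff_bounds(1)[OF b] zero_le_power \<open>0 \<le> 1 - s / t\<close>)
  then show ?thesis using True fbm_kernel_eq[OF H, of s t] H by (auto intro!: mult_nonneg_nonneg less_imp_le[OF Gamma_real_pos])
qed (auto simp: fbm_kernel_def)

section \<open>Relative entropy of Gaussian increments under predictable shifts\<close>

abbreviation gauss :: "real \<Rightarrow> real measure" where
  "gauss \<sigma> \<equiv> density lborel (\<lambda>z. ennreal (normal_density 0 \<sigma> z))"

text \<open>
Functionals of finitely many Gaussian variables are viewed as functionals of a sequence. Then the number
of variables can vary within an induction while the space stays the same.
\<close>

abbreviation seq_space :: "(nat \<Rightarrow> real) measure" where
  "seq_space \<equiv> Pi\<^sub>M UNIV (\<lambda>_. borel)"

lemma abs_ln_le: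
  fixes c C :: real shows "1 \<le> c \<Longrightarrow> c \<le> C \<Longrightarrow> \<bar>ln c\<bar> \<le> ln C"
  by (simp add: ln_ge_zero)

lemma integral_gauss:
  "g \<in> borel_measurable borel \<Longrightarrow> (\<integral>z. g z \<partial>gauss \<sigma>) = (\<integral>z. normal_density 0 \<sigma> z * g z \<partial>lborel)" for g :: "real \<Rightarrow> real"
  by (subst integral_density) auto

text \<open>
The Gibbs inequality for the laws \<open>N(0, \<sigma>\<^sup>2)\<close> and \<open>N(m, \<sigma>\<^sup>2)\<close>, whose relative entropy is \<open>m\<^sup>2 / (2 \<sigma>\<^sup>2)\<close>.
With the density \<open>\<rho>\<close> of the second with respect to the first and \<open>c = \<integral>g\<close>, it is the integral over the
shifted law of \<open>ln (g / (c \<rho>)) \<le> g / (c \<rho>) - 1\<close>, where the right-hand side has mean zero.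
\<close>

lemma gauss_shift_log:
  fixes g :: "real \<Rightarrow> real"
  assumes \<sigma>: "0 < \<sigma>" and g[measurable]: "g \<in> borel_measurable borel" and bd: "\<And>z. 1 \<le> g z" "\<And>z. g z \<le> C"
  shows "(\<integral>z. ln (g (z + m)) \<partial>gauss \<sigma>) \<le> ln (\<integral>z. g z \<partial>gauss \<sigma>) + m\<^sup>2 / (2 * \<sigma>\<^sup>2)"
proof -
  interpret N: prob_space "gauss \<sigma>" by (rule prob_space_normal_density[OF \<sigma>])
  define c where "c = (\<integral>z. g z \<partial>gauss \<sigma>)"
  have nb: "norm (g z) \<le> C" for z using bd[of z] by simp
  have ig: "integrable (gauss \<sigma>) g"
    by (rule N.integrable_const_bound[of _ C]) (use nb in simp_all)
  have "1 \<le> c" unfolding c_def using integral_mono[OF N.integrable_const[of 1] ig bd(1)] N.prob_space by simp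
  then have c: "0 < c" by simp
  have ig0: "integrable lborel (\<lambda>z. normal_density 0 \<sigma> z * g z)"
    using ig by (subst (asm) integrable_density) auto
  have lnb: "\<bar>ln (g z)\<bar> \<le> ln C" for z by (rule abs_ln_le[OF bd])
  have il: "integrable lborel (\<lambda>z. normal_density m \<sigma> z * ln (g z))"
  proof (rule Bochner_Integration.integrable_bound[of _ "\<lambda>z. normal_density m \<sigma> z * ln C"])
    show "AE z in lborel. norm (normal_density m \<sigma> z * ln (g z)) \<le> norm (normal_density m \<sigma> z * ln C)"
      using lnb by (auto simp: abs_mult intro!: mult_left_mono order.trans[OF lnb])
  qed (use \<sigma> in auto)
  have shift: "(\<integral>z. ln (g (z + m)) \<partial>gauss \<sigma>) = (\<integral>z. normal_density m \<sigma> z * ln (g z) \<partial>lborel)"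
  proof -
    have "(\<integral>z. normal_density m \<sigma> z * ln (g z) \<partial>lborel) = \<bar>1\<bar> *\<^sub>R (\<integral>z. normal_density m \<sigma> (m + 1 * z) * ln (g (m + 1 * z)) \<partial>lborel)"
      by (rule lborel_integral_real_affine) simp
    also have "\<dots> = (\<integral>z. normal_density 0 \<sigma> z * ln (g (z + m)) \<partial>lborel)"
      by (simp add: normal_density_def add.commute)
    finally show ?thesis by (subst integral_gauss) auto
  qed
  \<comment> \<open>The logarithm of the density of the shifted Gaussian law with respect to the centred one.\<close>
  define r where "r z = (2 * m * z - m\<^sup>2) / (2 * \<sigma>\<^sup>2)" for z
  have dens: "normal_density m \<sigma> z = normal_density 0 \<sigma> z * exp (r z)" for z
  proof -
    have "- (z - m)\<^sup>2 / (2 * \<sigma>\<^sup>2) = - (z - 0)\<^sup>2 / (2 * \<sigma>\<^sup>2) + r z"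
      unfolding r_def add_divide_distrib[symmetric] by (rule arg_cong[of _ _ "\<lambda>u. u / (2 * \<sigma>\<^sup>2)"]) (simp add: power2_eq_square algebra_simps)
    then show ?thesis unfolding normal_density_def by (simp only: exp_add mult.assoc)
  qed
  have pw: "normal_density m \<sigma> z * ln (g z) \<le> (m / \<sigma>\<^sup>2) * (normal_density m \<sigma> z * z) + (ln c - 1 - m\<^sup>2 / (2 * \<sigma>\<^sup>2)) * normal_density m \<sigma> z + normal_density 0 \<sigma> z * g z / c" for z
  proof -
    have gz: "0 < g z" using bd(1)[of z] by simp
    have "ln (g z / (c * exp (r z))) \<le> g z / (c * exp (r z)) - 1" by (rule ln_le_minus_one) (use gz c in simp)
    moreover have "ln (g z / (c * exp (r z))) = ln (g z) - ln c - r z" using gz c by (simp add: ln_div ln_mult)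
    ultimately have "ln (g z) \<le> r z + ln c - 1 + g z / (c * exp (r z))" by simp
    then have "normal_density m \<sigma> z * ln (g z) \<le> normal_density m \<sigma> z * (r z + ln c - 1 + g z / (c * exp (r z)))"
      by (intro mult_left_mono) auto
    also have "\<dots> = normal_density m \<sigma> z * (r z + ln c - 1) + normal_density 0 \<sigma> z * g z / c"
      using c by (simp add: dens distrib_left)
    also have "r z + ln c - 1 = (m / \<sigma>\<^sup>2) * z + (ln c - 1 - m\<^sup>2 / (2 * \<sigma>\<^sup>2))"
      using \<sigma> by (simp add: r_def diff_divide_distrib)
    finally show ?thesis by (simp add: algebra_simps)
  qed
  have "(\<integral>z. normal_density m \<sigma> z * ln (g z) \<partial>lborel)
    \<le> (\<integral>z. (m / \<sigma>\<^sup>2) * (normal_density m \<sigma> z * z) + (ln c - 1 - m\<^sup>2 / (2 * \<sigma>\<^sup>2)) * normal_density m \<sigma> z + normal_density 0 \<sigma> z * g z / c \<partial>lborel)"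
    using \<sigma> by (intro integral_mono il pw Bochner_Integration.integrable_add integrable_mult_right integrable_normal_moment_nz_1 integrable_normal_density integrable_divide ig0)
  also have "\<dots> = (m / \<sigma>\<^sup>2) * m + (ln c - 1 - m\<^sup>2 / (2 * \<sigma>\<^sup>2)) + c / c"
    using \<sigma> by (simp add: integrable_normal_moment_nz_1 integral_normal_moment_nz_1 ig0 integral_gauss[symmetric] flip: c_def)
  also have "\<dots> = ln c + m\<^sup>2 / (2 * \<sigma>\<^sup>2)" using c \<sigma> by (simp add: power2_eq_square field_simps)
  finally show ?thesis unfolding shift c_def .
qed

text \<open>
A variable independent of \<open>G\<close> can be integrated out first, with every \<open>G\<close>-measurable quantity frozen.
\<close>

lemma (in prob_space) integral_indep_product:
  fixes \<phi> :: "'v \<times> real \<Rightarrow> real"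
  assumes G: "subalgebra M G" and V: "V \<in> measurable G S"
    and D: "distributed M lborel D f"
    and ind: "indep_set (sets G) {D -` A \<inter> space M | A. A \<in> sets borel}"
    and \<phi>[measurable]: "\<phi> \<in> borel_measurable (S \<Otimes>\<^sub>M borel)" and bd: "\<And>x. \<bar>\<phi> x\<bar> \<le> C"
  shows "(\<integral>\<omega>. \<phi> (V \<omega>, D \<omega>) \<partial>M) = (\<integral>\<omega>. (\<integral>z. \<phi> (V \<omega>, z) \<partial>density lborel f) \<partial>M)"
proof -
  have VM[measurable]: "V \<in> measurable M S" using measurable_from_subalg[OF G V] .
  have DM[measurable]: "D \<in> borel_measurable M" using distributed_measurable[OF D] by simp
  have spG: "space G = space M" using G by (simp add: subalgebra_def)
  interpret PV: prob_space "distr M S V" by (rule prob_space_distr) measurable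
  interpret PD: prob_space "distr M borel D" by (rule prob_space_distr) measurable
  have J: "distr M S V \<Otimes>\<^sub>M distr M borel D = distr M (S \<Otimes>\<^sub>M borel) (\<lambda>x. (V x, D x))"
  proof (rule pair_measure_eqI)
    fix A B assume "A \<in> sets (distr M S V)" "B \<in> sets (distr M borel D)"
    then have A[measurable]: "A \<in> sets S" and B[measurable]: "B \<in> sets borel" by auto
    have "prob ((V -` A \<inter> space M) \<inter> (D -` B \<inter> space M)) = prob (V -` A \<inter> space M) * prob (D -` B \<inter> space M)"
      using measurable_sets[OF V A] B spG by (intro indep_setD[OF ind]) auto
    moreover have "(\<lambda>x. (V x, D x)) -` (A \<times> B) \<inter> space M = (V -` A \<inter> space M) \<inter> (D -` B \<inter> space M)" by auto
    ultimately show "emeasure (distr M S V) A * emeasure (distr M borel D) B = emeasure (distr M (S \<Otimes>\<^sub>M borel) (\<lambda>x. (V x, D x))) (A \<times> B)"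
      by (simp add: emeasure_distr emeasure_eq_measure ennreal_mult)
  qed (auto intro: PV.sigma_finite_measure_axioms PD.sigma_finite_measure_axioms)
  interpret P: pair_prob_space "distr M S V" "distr M borel D" ..
  have DD: "distr M borel D = density lborel f"
    using distributed_distr_eq_density[OF D] by (simp cong: distr_cong)
  have int: "integrable (distr M S V \<Otimes>\<^sub>M distr M borel D) \<phi>"
    by (rule P.integrable_const_bound[of _ C]) (use bd in auto)
  have "(\<integral>\<omega>. \<phi> (V \<omega>, D \<omega>) \<partial>M) = (\<integral>x. \<phi> x \<partial>distr M (S \<Otimes>\<^sub>M borel) (\<lambda>x. (V x, D x)))"
    by (subst integral_distr) auto
  also have "\<dots> = (\<integral>v. (\<integral>z. \<phi> (v, z) \<partial>distr M borel D) \<partial>distr M S V)"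
    unfolding J[symmetric] by (rule P.integral_fst'[OF int, symmetric])
  also have "\<dots> = (\<integral>\<omega>. (\<integral>z. \<phi> (V \<omega>, z) \<partial>distr M borel D) \<partial>M)"
    by (subst integral_distr) auto
  finally show ?thesis unfolding DD .
qed

lemma measurable_seq_space_iff:
  "f \<in> measurable N seq_space \<longleftrightarrow> (\<forall>i. (\<lambda>\<omega>. f \<omega> i) \<in> borel_measurable N)"
proof
  assume "f \<in> measurable N seq_space"
  then show "\<forall>i. (\<lambda>\<omega>. f \<omega> i) \<in> borel_measurable N" by (auto intro: measurable_component_singleton[THEN measurable_compose_rev, of _ UNIV] measurable_compose)
next
  assume *: "\<forall>i. (\<lambda>\<omega>. f \<omega> i) \<in> borel_measurable N"
  have "(\<lambda>\<omega> i. f \<omega> i) \<in> measurable N seq_space" by (rule measurable_PiM_single') (use * in auto)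
  then show "f \<in> measurable N seq_space" by simp
qed

text \<open>
The chain rule of relative entropy. Freezing the past, the last variable is shifted by a constant, so
\<open>gauss_shift_log\<close> bounds the logarithm of \<open>\<Phi>\<close> by that of the partial integral \<open>\<Psi>\<close> of \<open>\<Phi>\<close> over its last argument,
at the price of the last summand. Induction applies to \<open>\<Psi>\<close>, and without shifts the passage from \<open>\<Phi>\<close>
to \<open>\<Psi>\<close> is an equality of expectations.
\<close>

lemma (in prob_space) gauss_chain_log:
  fixes D a :: "nat \<Rightarrow> 'a \<Rightarrow> real" and G :: "nat \<Rightarrow> 'a measure" and \<sigma> c :: "nat \<Rightarrow> real"
    and \<Phi> :: "(nat \<Rightarrow> real) \<Rightarrow> real"
  assumes G: "\<And>i. subalgebra M (G i)" and mono: "\<And>i j. i \<le> j \<Longrightarrow> j \<le> n \<Longrightarrow> sets (G i) \<subseteq> sets (G j)"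
    and \<sigma>: "\<And>i. i < n \<Longrightarrow> 0 < \<sigma> i"
    and D: "\<And>i. i < n \<Longrightarrow> distributed M lborel (D i) (\<lambda>z. ennreal (normal_density 0 (\<sigma> i) z))"
    and DG: "\<And>i. i < n \<Longrightarrow> D i \<in> borel_measurable (G (Suc i))"
    and ind: "\<And>i. i < n \<Longrightarrow> indep_set (sets (G i)) {D i -` A \<inter> space M | A. A \<in> sets borel}"
    and aG: "\<And>i. i < n \<Longrightarrow> a i \<in> borel_measurable (G i)"
    and ac: "\<And>i \<omega>. i < n \<Longrightarrow> \<bar>a i \<omega>\<bar> \<le> c i"
    and \<Phi>: "\<Phi> \<in> borel_measurable seq_space" "\<And>z. 1 \<le> \<Phi> z" "\<And>z. \<Phi> z \<le> C"
  shows "(\<integral>\<omega>. ln (\<Phi> (\<lambda>i. if i < n then D i \<omega> + a i \<omega> else 0)) \<partial>M)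
    \<le> ln (\<integral>\<omega>. \<Phi> (\<lambda>i. if i < n then D i \<omega> else 0) \<partial>M) + (\<Sum>i<n. (c i)\<^sup>2 / (2 * (\<sigma> i)\<^sup>2))"
  using mono \<sigma> D DG ind aG ac \<Phi>
proof (induction n arbitrary: \<Phi>)
  case 0
  then show ?case by (simp add: prob_space)
next
  case (Suc n)
  note \<Phi>m[measurable] = Suc.prems(8) and \<Phi>b = Suc.prems(9,10)
  note Dn = Suc.prems(3)[OF lessI] and indn = Suc.prems(5)[OF lessI] and \<sigma>n = Suc.prems(2)[OF lessI]
  define VS where "VS a \<omega> = (\<lambda>i. if i < n then D i \<omega> + a i \<omega> else 0)" for a :: "nat \<Rightarrow> 'a \<Rightarrow> real" and \<omega>
  have VSm: "VS a \<in> measurable (G n) seq_space" if "\<And>i. i < n \<Longrightarrow> a i \<in> borel_measurable (G i)" for a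
    unfolding measurable_seq_space_iff
  proof
    fix i
    have sp: "space (G j) = space M" for j using G[of j] by (simp add: subalgebra_def)
    show "(\<lambda>\<omega>. VS a \<omega> i) \<in> borel_measurable (G n)"
    proof (cases "i < n")
      case True
      have "subalgebra (G n) (G i)" "subalgebra (G n) (G (Suc i))"
        using Suc.prems(1)[of i n] Suc.prems(1)[of "Suc i" n] True by (auto simp: subalgebra_def sp)
      then have "a i \<in> borel_measurable (G n)" "D i \<in> borel_measurable (G n)"
        using that[OF True] Suc.prems(4)[of i] True by (auto intro: measurable_from_subalg)
      then show ?thesis using True by (simp add: VS_def)
    qed (simp add: VS_def)
  qed
  interpret N: prob_space "gauss (\<sigma> n)" by (rule prob_space_normal_density[OF \<sigma>n])
  define \<Psi> where "\<Psi> v = (\<integral>z. \<Phi> (v(n := z)) \<partial>gauss (\<sigma> n))" for v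
  have upd: "(\<lambda>x. (fst x)(n := snd x)) \<in> measurable (seq_space \<Otimes>\<^sub>M borel) seq_space"
    unfolding measurable_seq_space_iff by (intro allI) (simp add: fun_upd_def)
  have \<Phi>u[measurable]: "(\<lambda>x. \<Phi> ((fst x)(n := snd x))) \<in> borel_measurable (seq_space \<Otimes>\<^sub>M borel)"
    by (rule measurable_compose[OF upd \<Phi>m])
  have \<Phi>v[measurable]: "(\<lambda>z. \<Phi> (v(n := z))) \<in> borel_measurable borel" for v
  proof -
    have "(\<lambda>z. (v, z)) \<in> measurable borel (seq_space \<Otimes>\<^sub>M borel)"
      by (rule measurable_Pair1') (simp add: space_PiM)
    from measurable_compose[OF this \<Phi>u] show ?thesis by simp
  qed
  have \<Psi>m: "\<Psi> \<in> borel_measurable seq_space"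
    unfolding \<Psi>_def using N.borel_measurable_lebesgue_integral[of "\<lambda>v z. \<Phi> (v(n := z))" seq_space] \<Phi>u
    by (simp add: case_prod_beta)
  have nb: "norm (\<Phi> z) \<le> C" for z using \<Phi>b[of z] by simp
  have i\<Phi>: "integrable (gauss (\<sigma> n)) (\<lambda>z. \<Phi> (v(n := z)))" for v
    by (rule N.integrable_const_bound[of _ C]) (use nb in simp_all)
  have \<Psi>b: "1 \<le> \<Psi> v" "\<Psi> v \<le> C" for v
  proof -
    show "1 \<le> \<Psi> v" unfolding \<Psi>_def using integral_mono[OF N.integrable_const[of 1] i\<Phi>[of v] \<Phi>b(1)] N.prob_space by (simp del: fun_upd_apply)
    show "\<Psi> v \<le> C" unfolding \<Psi>_def using integral_mono[OF i\<Phi>[of v] N.integrable_const[of C] \<Phi>b(2)] N.prob_space by (simp del: fun_upd_apply)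
  qed
  have lnb: "\<bar>ln (\<Phi> z)\<bar> \<le> ln C" for z by (rule abs_ln_le[OF \<Phi>b])
  have lnb': "\<bar>ln (\<Psi> z)\<bar> \<le> ln C" for z by (rule abs_ln_le[OF \<Psi>b])
  have VSa: "VS a \<in> measurable (G n) seq_space" by (rule VSm) (use Suc.prems(6) in auto)
  have VS0: "VS (\<lambda>_ _. 0) \<in> measurable (G n) seq_space" by (rule VSm) auto
  have an: "a n \<in> borel_measurable (G n)" by (rule Suc.prems(6)) simp
  have split: "(\<lambda>i. if i < Suc n then D i \<omega> + a i \<omega> else 0) = (VS a \<omega>)(n := D n \<omega> + a n \<omega>)" for a :: "nat \<Rightarrow> 'a \<Rightarrow> real" and \<omega>
    by (auto simp: VS_def)
  define \<phi> where "\<phi> x = ln (\<Phi> ((fst (fst x))(n := snd x + snd (fst x))))" for x :: "((nat \<Rightarrow> real) \<times> real) \<times> real"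
  have \<phi>m: "\<phi> \<in> borel_measurable ((seq_space \<Otimes>\<^sub>M borel) \<Otimes>\<^sub>M borel)"
  proof -
    have "(\<lambda>x. (fst (fst x), snd x + snd (fst x))) \<in> measurable ((seq_space \<Otimes>\<^sub>M borel) \<Otimes>\<^sub>M borel) (seq_space \<Otimes>\<^sub>M (borel :: real measure))" by measurable
    from measurable_compose[OF this \<Phi>u] show ?thesis unfolding \<phi>_def by simp
  qed
  have 1: "(\<integral>\<omega>. \<phi> ((VS a \<omega>, a n \<omega>), D n \<omega>) \<partial>M) = (\<integral>\<omega>. (\<integral>z. \<phi> ((VS a \<omega>, a n \<omega>), z) \<partial>gauss (\<sigma> n)) \<partial>M)"
    by (rule integral_indep_product[OF G _ Dn indn \<phi>m, of _ "ln C"]) (use VSa an in \<open>auto simp: \<phi>_def lnb\<close>)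
  have pw: "(\<integral>z. \<phi> ((VS a \<omega>, a n \<omega>), z) \<partial>gauss (\<sigma> n)) \<le> ln (\<Psi> (VS a \<omega>)) + (c n)\<^sup>2 / (2 * (\<sigma> n)\<^sup>2)" for \<omega>
  proof -
    have "(\<integral>z. \<phi> ((VS a \<omega>, a n \<omega>), z) \<partial>gauss (\<sigma> n)) \<le> ln (\<Psi> (VS a \<omega>)) + (a n \<omega>)\<^sup>2 / (2 * (\<sigma> n)\<^sup>2)"
      unfolding \<phi>_def \<Psi>_def fst_conv snd_conv by (rule gauss_shift_log[OF \<sigma>n \<Phi>v]) (use \<Phi>b in auto)
    also have "(a n \<omega>)\<^sup>2 \<le> (c n)\<^sup>2" using Suc.prems(7)[of n \<omega>] by (intro abs_le_square_iff[THEN iffD1]) auto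
    finally show ?thesis using \<sigma>n by (simp add: divide_right_mono)
  qed
  have VSaM: "VS a \<in> measurable M seq_space" by (rule measurable_from_subalg[OF G VSa])
  have anM: "a n \<in> borel_measurable M" by (rule measurable_from_subalg[OF G an])
  have il: "integrable M (\<lambda>\<omega>. ln (\<Psi> (VS a \<omega>)))"
    by (rule integrable_const_bound[of _ "ln C"]) (use lnb' measurable_compose[OF VSaM \<Psi>m] in auto)
  have il2: "integrable M (\<lambda>\<omega>. \<integral>z. \<phi> ((VS a \<omega>, a n \<omega>), z) \<partial>gauss (\<sigma> n))"
  proof (rule integrable_const_bound[of _ "ln C"])
    have "\<bar>\<integral>z. \<phi> ((VS a \<omega>, a n \<omega>), z) \<partial>gauss (\<sigma> n)\<bar> \<le> ln C" for \<omega>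
    proof -
      have "(\<lambda>z. ((VS a \<omega>, a n \<omega>), z)) \<in> measurable borel ((seq_space \<Otimes>\<^sub>M borel) \<Otimes>\<^sub>M borel)"
        by (rule measurable_Pair1') (simp add: space_PiM space_pair_measure)
      from measurable_compose[OF this \<phi>m] have m: "(\<lambda>z. \<phi> ((VS a \<omega>, a n \<omega>), z)) \<in> borel_measurable borel" by simp
      have "integrable (gauss (\<sigma> n)) (\<lambda>z. \<phi> ((VS a \<omega>, a n \<omega>), z))"
        by (rule N.integrable_const_bound[of _ "ln C"]) (use m in \<open>auto simp: \<phi>_def lnb\<close>)
      then have "\<bar>\<integral>z. \<phi> ((VS a \<omega>, a n \<omega>), z) \<partial>gauss (\<sigma> n)\<bar> \<le> (\<integral>z. ln C \<partial>gauss (\<sigma> n))"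
        by (intro order.trans[OF integral_abs_bound] integral_mono integrable_abs N.integrable_const) (auto simp: \<phi>_def lnb)
      then show ?thesis using N.prob_space by simp
    qed
    then show "AE \<omega> in M. norm (\<integral>z. \<phi> ((VS a \<omega>, a n \<omega>), z) \<partial>gauss (\<sigma> n)) \<le> ln C" by simp
    have "(\<lambda>v. \<integral>z. \<phi> (v, z) \<partial>gauss (\<sigma> n)) \<in> borel_measurable (seq_space \<Otimes>\<^sub>M borel)"
      using N.borel_measurable_lebesgue_integral[of "\<lambda>v z. \<phi> (v, z)" "seq_space \<Otimes>\<^sub>M borel"] \<phi>m by (simp add: case_prod_beta)
    from measurable_compose[OF measurable_Pair[OF VSaM anM] this]
    show "(\<lambda>\<omega>. \<integral>z. \<phi> ((VS a \<omega>, a n \<omega>), z) \<partial>gauss (\<sigma> n)) \<in> borel_measurable M" .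
  qed
  have "(\<integral>\<omega>. ln (\<Phi> (\<lambda>i. if i < Suc n then D i \<omega> + a i \<omega> else 0)) \<partial>M) = (\<integral>\<omega>. \<phi> ((VS a \<omega>, a n \<omega>), D n \<omega>) \<partial>M)"
    unfolding split \<phi>_def by simp
  also have "\<dots> \<le> (\<integral>\<omega>. ln (\<Psi> (VS a \<omega>)) + (c n)\<^sup>2 / (2 * (\<sigma> n)\<^sup>2) \<partial>M)"
    unfolding 1 by (intro integral_mono il2 Bochner_Integration.integrable_add il integrable_const pw)
  also have "\<dots> = (\<integral>\<omega>. ln (\<Psi> (VS a \<omega>)) \<partial>M) + (c n)\<^sup>2 / (2 * (\<sigma> n)\<^sup>2)"
    using il by (simp add: prob_space)
  also have "(\<integral>\<omega>. ln (\<Psi> (VS a \<omega>)) \<partial>M) \<le> ln (\<integral>\<omega>. \<Psi> (\<lambda>i. if i < n then D i \<omega> else 0) \<partial>M) + (\<Sum>i<n. (c i)\<^sup>2 / (2 * (\<sigma> i)\<^sup>2))"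
    unfolding VS_def by (rule Suc.IH) (use Suc.prems \<Psi>m \<Psi>b in auto)
  also have "(\<integral>\<omega>. \<Psi> (\<lambda>i. if i < n then D i \<omega> else 0) \<partial>M) = (\<integral>\<omega>. \<Phi> (\<lambda>i. if i < Suc n then D i \<omega> else 0) \<partial>M)"
  proof -
    have "(\<integral>\<omega>. (\<lambda>x. \<Phi> ((fst x)(n := snd x))) (VS (\<lambda>_ _. 0) \<omega>, D n \<omega>) \<partial>M) = (\<integral>\<omega>. (\<integral>z. (\<lambda>x. \<Phi> ((fst x)(n := snd x))) (VS (\<lambda>_ _. 0) \<omega>, z) \<partial>gauss (\<sigma> n)) \<partial>M)"
      by (rule integral_indep_product[OF G VS0 Dn indn \<Phi>u, of C]) (use nb in simp_all)
    moreover have "VS (\<lambda>_ _. 0) \<omega> = (\<lambda>i. if i < n then D i \<omega> else 0)" for \<omega> by (auto simp: VS_def)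
    moreover have "(\<lambda>i. if i < n then D i \<omega> else 0)(n := D n \<omega>) = (\<lambda>i. if i < Suc n then D i \<omega> else 0)" for \<omega> by auto
    ultimately show ?thesis by (simp add: \<Psi>_def del: fun_upd_apply)
  qed
  finally show ?case by (simp add: algebra_simps)
qed

section \<open>Step functions and Wiener integrals\<close>

text \<open>
A grid that is fine and contains prescribed points: a sum of step functions with breakpoints in \<open>P\<close> is
constant on its cells.
\<close>

lemma fine_partition:
  fixes T \<delta> :: real
  assumes T: "0 < T" and \<delta>: "0 < \<delta>" and P: "finite P" "P \<subseteq> {0..T}"
  obtains n :: nat and t :: "nat \<Rightarrow> real" where "t 0 = 0" "t n = T"
    "\<And>i j. i < j \<Longrightarrow> j \<le> n \<Longrightarrow> t i < t j"
    "\<And>i. i < n \<Longrightarrow> t (Suc i) - t i \<le> \<delta>" "\<And>p. p \<in> P \<Longrightarrow> \<exists>k\<le>n. p = t k"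
proof -
  obtain m :: nat where m: "T / \<delta> < real m" using reals_Archimedean2 by blast
  then have m0: "0 < real m" using T \<delta> by (smt (verit) divide_pos_pos)
  have md: "T / m \<le> \<delta>" using m m0 T \<delta> by (simp add: field_simps)
  define Q where "Q = P \<union> {0, T} \<union> (\<lambda>k. k * (T / m)) ` {k :: nat. k \<le> m}"
  have Q: "finite Q" "Q \<subseteq> {0..T}" "0 \<in> Q" "T \<in> Q"
    using P T m0 by (auto simp: Q_def field_simps)
  define xs where "xs = sorted_list_of_set Q"
  have xs: "sorted_wrt (<) xs" "set xs = Q" using Q(1) by (auto simp: xs_def)
  then have len: "0 < length xs" using Q(3) by (cases xs) auto
  define n where "n = length xs - 1"
  define t where "t i = xs ! i" for i
  have inc: "t i < t j" if "i < j" "j \<le> n" for i j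
    unfolding t_def by (rule sorted_wrt_nth_less[OF xs(1)]) (use that len in \<open>auto simp: n_def\<close>)
  have tQ: "t i \<in> Q" if "i \<le> n" for i
  proof -
    have "i < length xs" using that len unfolding n_def by linarith
    then show ?thesis using xs(2) nth_mem[of i xs] by (simp add: t_def)
  qed
  have Qt: "\<exists>k\<le>n. p = t k" if "p \<in> Q" for p
  proof -
    from that xs(2) obtain k where "k < length xs" "xs ! k = p" by (auto simp: in_set_conv_nth)
    then show ?thesis by (intro exI[of _ k]) (auto simp: n_def t_def)
  qed
  have t0: "t 0 = 0"
  proof -
    obtain k where k: "k \<le> n" "0 = t k" using Qt[OF Q(3)] by blast
    have "0 \<le> t 0" using tQ[of 0] Q(2) by auto
    then show ?thesis using inc[of 0 k] k by (cases "k = 0") auto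
  qed
  have tn: "t n = T"
  proof -
    obtain k where k: "k \<le> n" "T = t k" using Qt[OF Q(4)] by blast
    have "t n \<le> T" using tQ[of n] Q(2) by auto
    then show ?thesis using inc[of k n] k by (cases "k = n") auto
  qed
  have mesh: "t (Suc i) - t i \<le> \<delta>" if i: "i < n" for i
  proof (rule ccontr)
    assume gap: "\<not> t (Suc i) - t i \<le> \<delta>"
    have ti: "0 \<le> t i" "t (Suc i) \<le> T" using tQ[of i] tQ[of "Suc i"] Q(2) i by auto
    define k where "k = nat \<lfloor>t i / (T / m)\<rfloor> + 1"
    have r: "0 \<le> t i / (T / m)" "0 < T / m" using ti T m0 by auto
    have "real k = real_of_int \<lfloor>t i / (T / m)\<rfloor> + 1" using r by (simp add: k_def)
    then have "t i / (T / m) < real k" "real k \<le> t i / (T / m) + 1" by linarith+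
    then have "t i < k * (T / m)" "real k * (T / m) \<le> (t i / (T / m) + 1) * (T / m)"
      using r(2) by (simp_all only: pos_divide_less_eq mult_right_mono less_imp_le)
    moreover have "(t i / (T / m) + 1) * (T / m) = t i + T / m" using r(2) T m0 by (simp add: field_simps)
    ultimately have "t i < k * (T / m)" "k * (T / m) \<le> t i + T / m" by simp_all
    moreover from this md gap ti have kT: "k * (T / m) < t (Suc i)" "k * (T / m) \<le> T" by linarith+
    moreover have "k \<le> m"
    proof -
      have "real k * T \<le> T * m" using kT(2) m0 by (simp add: field_simps)
      then show ?thesis using T by simp
    qed
    ultimately have "k * (T / m) \<in> Q" by (auto simp: Q_def)
    then obtain l where l: "l \<le> n" "k * (T / m) = t l" using Qt by blast
    have "l \<noteq> i" "\<not> l < i" using \<open>t i < k * (T / m)\<close> l inc[of l i] i by auto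
    moreover have "l \<noteq> Suc i" "\<not> Suc i < l" using kT(1) l inc[of "Suc i" l] by auto
    ultimately show False by linarith
  qed
  show ?thesis by (rule that[OF t0 tn inc mesh Qt]) (auto simp: Q_def)
qed

locale time_grid =
  fixes T :: real and n :: nat and t :: "nat \<Rightarrow> real"
  assumes t0: "t 0 = 0" and tn: "t n = T" and inc: "\<And>i j. i < j \<Longrightarrow> j \<le> n \<Longrightarrow> t i < t j"
begin

lemma less_iff: "i \<le> n \<Longrightarrow> j \<le> n \<Longrightarrow> t i < t j \<longleftrightarrow> i < j"
  using inc[of i j] inc[of j i] by (cases i j rule: linorder_cases) auto

lemma le_iff: "i \<le> n \<Longrightarrow> j \<le> n \<Longrightarrow> t i \<le> t j \<longleftrightarrow> i \<le> j"
  using less_iff[of j i] by (simp add: not_less[symmetric])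

lemma range: "i \<le> n \<Longrightarrow> 0 \<le> t i \<and> t i \<le> T"
  using le_iff[of 0 i] le_iff[of i n] by (simp add: t0 tn)

definition on_grid :: "(real \<times> real \<times> real) list \<Rightarrow> bool" where
  "on_grid S \<longleftrightarrow> (\<forall>(c, u, v)\<in>set S. u \<le> v \<and> u \<in> t ` {..n} \<and> v \<in> t ` {..n})"

lemma indicator_cell:
  assumes "k \<le> n" "l \<le> n" "i < n" "t i < s" "s \<le> t (Suc i)"
  shows "indicator {t k<..t l} s = (if k \<le> i \<and> i < l then 1 else (0::real))"
proof -
  have "t k < s \<longleftrightarrow> k \<le> i"
  proof
    assume "t k < s"
    then have "t k < t (Suc i)" using assms by simp
    then show "k \<le> i" using assms less_iff[of k "Suc i"] by simp
  next
    assume "k \<le> i" then show "t k < s" using le_iff[of k i] assms by simp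
  qed
  moreover have "s \<le> t l \<longleftrightarrow> i < l"
  proof
    assume "s \<le> t l"
    then have "t i < t l" using assms by simp
    then show "i < l" using assms less_iff[of i l] by simp
  next
    assume "i < l" then show "s \<le> t l" using le_iff[of "Suc i" l] assms by simp
  qed
  ultimately show ?thesis by (simp add: indicator_def)
qed

lemma step_function_cell:
  assumes S: "on_grid S" and i: "i < n" and s: "t i < s" "s \<le> t (Suc i)"
  shows "step_function S s = step_function S (t (Suc i))"
proof -
  have "indicator {u<..v} s = (indicator {u<..v} (t (Suc i)) :: real)" if "(c, u, v) \<in> set S" for c u v
  proof -
    obtain k l where "k \<le> n" "l \<le> n" "u = t k" "v = t l" using S \<open>(c, u, v) \<in> set S\<close> by (fastforce simp: on_grid_def)
    then show ?thesis using indicator_cell[of k l i s] indicator_cell[of k l i "t (Suc i)"] i s inc[of i "Suc i"] by simp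
  qed
  then show ?thesis unfolding step_function_def by (intro arg_cong[of _ _ sum_list] map_cong) auto
qed

lemma step_integral_grid:
  assumes S: "on_grid S"
  shows "step_integral W S \<omega> = (\<Sum>i<n. step_function S (t (Suc i)) * (W (t (Suc i)) \<omega> - W (t i) \<omega>))"
  using S
proof (induction S)
  case Nil
  then show ?case by (simp add: step_integral_def step_function_def)
next
  case (Cons a S)
  obtain c u v where a: "a = (c, u, v)" by (cases a)
  obtain k l where kl: "k \<le> n" "l \<le> n" "u = t k" "v = t l" using Cons.prems by (fastforce simp: on_grid_def a)
  have "u \<le> v" using Cons.prems by (simp add: on_grid_def a)
  then have "k \<le> l" using kl le_iff[of k l] by simp
  have "(\<Sum>i<n. indicator {u<..v} (t (Suc i)) * (W (t (Suc i)) \<omega> - W (t i) \<omega>)) = (\<Sum>i<n. if i \<in> {k..<l} then W (t (Suc i)) \<omega> - W (t i) \<omega> else 0)"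
  proof (rule sum.cong[OF refl])
    fix i assume "i \<in> {..<n}"
    then show "indicator {u<..v} (t (Suc i)) * (W (t (Suc i)) \<omega> - W (t i) \<omega>) = (if i \<in> {k..<l} then W (t (Suc i)) \<omega> - W (t i) \<omega> else 0)"
      using indicator_cell[of k l i "t (Suc i)"] kl inc[of i "Suc i"] by simp
  qed
  also have "\<dots> = (\<Sum>i\<in>{k..<l}. W (t (Suc i)) \<omega> - W (t i) \<omega>)"
  proof -
    have "{..<n} \<inter> {k..<l} = {k..<l}" using kl by auto
    then show ?thesis by (simp only: sum.inter_restrict[symmetric] finite_lessThan)
  qed
  also have "\<dots> = W v \<omega> - W u \<omega>" using sum_Suc_diff'[OF \<open>k \<le> l\<close>, of "\<lambda>i. W (t i) \<omega>"] kl by simp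
  finally have e: "W v \<omega> - W u \<omega> = (\<Sum>i<n. indicator {u<..v} (t (Suc i)) * (W (t (Suc i)) \<omega> - W (t i) \<omega>))" ..
  have "on_grid S" using Cons.prems by (simp add: on_grid_def)
  from Cons.IH[OF this]
  have "step_integral W (a # S) \<omega> = c * (W v \<omega> - W u \<omega>) + (\<Sum>i<n. step_function S (t (Suc i)) * (W (t (Suc i)) \<omega> - W (t i) \<omega>))"
    by (simp add: step_integral_def a)
  also have "\<dots> = (\<Sum>i<n. step_function (a # S) (t (Suc i)) * (W (t (Suc i)) \<omega> - W (t i) \<omega>))"
    unfolding e sum_distrib_left sum.distrib[symmetric] by (intro sum.cong refl) (simp add: step_function_def a algebra_simps)
  finally show ?case .
qed

lemma set_integral_cells:
  fixes f :: "real \<Rightarrow> real"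
  assumes f: "set_integrable lborel {0<..T} f"
  shows "(LBINT s:{0<..T}. f s) = (\<Sum>i<n. LBINT s:{t i<..t (Suc i)}. f s)"
proof -
  have "k \<le> n \<Longrightarrow> (LBINT s:{0<..t k}. f s) = (\<Sum>i<k. LBINT s:{t i<..t (Suc i)}. f s)" for k
  proof (induction k)
    case 0 then show ?case by (simp add: t0 set_lebesgue_integral_def)
  next
    case (Suc k)
    have "{0<..t (Suc k)} = {0<..t k} \<union> {t k<..t (Suc k)}" "{0<..t k} \<inter> {t k<..t (Suc k)} = {}"
      using range[of k] range[of "Suc k"] inc[of k "Suc k"] Suc.prems by auto
    moreover have "set_integrable lborel {0<..t k} f" "set_integrable lborel {t k<..t (Suc k)} f"
      using range[of k] range[of "Suc k"] Suc.prems by (auto intro!: set_integrable_subset[OF f])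
    ultimately show ?case using Suc by (simp add: set_integral_Un)
  qed
  from this[of n] show ?thesis by (simp add: tn)
qed

end

lemma step_function_measurable[measurable]: "step_function S \<in> borel_measurable borel"
  by (induction S) (auto simp: step_function_def[abs_def])

lemma step_function_bounded: "\<exists>C. \<forall>s. \<bar>step_function S s\<bar> \<le> C"
proof (induction S)
  case (Cons a S)
  then obtain C where C: "\<And>s. \<bar>step_function S s\<bar> \<le> C" by auto
  obtain c u v where a: "a = (c, u, v)" by (cases a)
  have "\<bar>step_function (a # S) s\<bar> \<le> \<bar>c\<bar> + C" for s
    using C[of s] by (auto simp: step_function_def a indicator_def)
  then show ?case by blast
qed (auto simp: step_function_def)

lemma set_integrable_bounded:
  fixes f :: "real \<Rightarrow> real"
  assumes m: "f \<in> borel_measurable borel" and bd: "\<And>s. s \<in> {u<..t} \<Longrightarrow> \<bar>f s\<bar> \<le> C"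
  shows "set_integrable lborel {u<..t} f"
  unfolding set_integrable_def
proof (rule Bochner_Integration.integrable_bound[of _ "\<lambda>s. indicator {u<..t} s *\<^sub>R C"])
  show "integrable lborel (\<lambda>s. indicator {u<..t} s *\<^sub>R C)" by (cases "u \<le> t") auto
  show "AE s in lborel. norm (indicator {u<..t} s *\<^sub>R f s) \<le> norm (indicator {u<..t} s *\<^sub>R C)"
    using bd by (intro AE_I2) (auto simp: indicator_def intro: order.trans[OF _ abs_ge_self])
qed (use m in measurable)

locale wiener_basis = prob_space M for M :: "'a measure" +
  fixes F :: "real \<Rightarrow> 'a measure" and T :: real and W :: "real \<Rightarrow> 'a \<Rightarrow> real"
  assumes T: "0 < T" and filt: "filtration (space M) F" and sub: "\<And>t. subalgebra M (F t)"
    and W: "wiener_process M F T W"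
begin

lemma F_mono: "s \<le> t \<Longrightarrow> sets (F s) \<subseteq> sets (F t)"
  using filtration.sets_F_mono[OF filt] .

lemma F_space: "space (F t) = space M"
  using filtration.space_F[OF filt] .

lemma F_subalg: "s \<le> t \<Longrightarrow> subalgebra (F t) (F s)"
  using F_mono by (simp add: subalgebra_def F_space)

lemma W_adapted: "0 \<le> t \<Longrightarrow> t \<le> T \<Longrightarrow> W t \<in> borel_measurable (F t)"
  using W by (auto simp: wiener_process_def adapted_on_def)

lemma W_measurable: "0 \<le> t \<Longrightarrow> t \<le> T \<Longrightarrow> W t \<in> borel_measurable M"
  using measurable_from_subalg[OF sub W_adapted] .

lemma W_increment:
  assumes "0 \<le> s" "s < t" "t \<le> T"
  shows "distributed M lborel (\<lambda>\<omega>. W t \<omega> - W s \<omega>) (\<lambda>z. ennreal (normal_density 0 (sqrt (t - s)) z))"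
    "indep_set (sets (F s)) {(\<lambda>\<omega>. W t \<omega> - W s \<omega>) -` A \<inter> space M | A. A \<in> sets borel}"
  using W assms by (auto simp: wiener_process_def)

end

text \<open>
A drift \<open>v\<close> of the Wiener process together with predictable substitutes: \<open>a \<sigma> \<tau>\<close> stands for the integral
of \<open>v\<close> over \<open>(\<sigma>, \<tau>]\<close> but is known at time \<open>\<sigma>\<close>, and the two differ by \<open>o(\<tau> - \<sigma>)\<close> uniformly in \<open>\<omega>\<close>. The
increments of \<open>Q\<close> bound the energy that \<open>a\<close> spends. These substitutes take the place of simple processes
in the construction of a stochastic integral.
\<close>

locale adapted_drift = wiener_basis +
  fixes v :: "real \<Rightarrow> 'a \<Rightarrow> real" and a :: "real \<Rightarrow> real \<Rightarrow> 'a \<Rightarrow> real" and Q :: "real \<Rightarrow> real" and E \<gamma> Cv :: real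
  assumes a_meas: "\<And>\<sigma> \<tau>. 0 \<le> \<sigma> \<Longrightarrow> \<sigma> < \<tau> \<Longrightarrow> \<tau> \<le> T \<Longrightarrow> a \<sigma> \<tau> \<in> borel_measurable (F \<sigma>)"
    and a_bd: "\<And>\<sigma> \<tau> \<omega>. 0 \<le> \<sigma> \<Longrightarrow> \<sigma> < \<tau> \<Longrightarrow> \<tau> \<le> T \<Longrightarrow> (a \<sigma> \<tau> \<omega>)\<^sup>2 \<le> (\<tau> - \<sigma>) * (Q \<tau> - Q \<sigma>)"
    and v_meas[measurable]: "\<And>\<omega>. (\<lambda>s. v s \<omega>) \<in> borel_measurable borel"
    and v_bd: "\<And>s \<omega>. \<bar>v s \<omega>\<bar> \<le> Cv"
    and a_close: "\<And>\<sigma> \<tau> \<omega>. 0 \<le> \<sigma> \<Longrightarrow> \<sigma> < \<tau> \<Longrightarrow> \<tau> \<le> T \<Longrightarrow>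
        \<bar>a \<sigma> \<tau> \<omega> - (LBINT s:{\<sigma><..\<tau>}. v s \<omega>)\<bar> \<le> (\<tau> - \<sigma>) * (E * (\<tau> - \<sigma>) powr \<gamma>)"
    and E: "0 \<le> E" and \<gamma>: "0 < \<gamma>"
begin

text \<open>
On a grid that contains all breakpoints, integrals of step functions are linear in the increments of \<open>W\<close>,
and shifting the increments by \<open>a\<close> shifts the integrals by the random variables \<open>R\<close>. A cell of length \<open>d\<close>
contributes at most \<open>d (Q \<tau> - Q \<sigma>) / (2 d)\<close> to the entropy, so that the bounds telescope.
\<close>

lemma step_shift_log:
  fixes S :: "nat \<Rightarrow> (real \<times> real \<times> real) list" and \<Gamma> :: "(nat \<Rightarrow> real) \<Rightarrow> real"
  assumes S: "\<And>j c u w. j < N \<Longrightarrow> (c, u, w) \<in> set (S j) \<Longrightarrow> 0 \<le> u \<and> u \<le> w \<and> w \<le> T" and \<delta>: "0 < \<delta>"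
    and \<Gamma>: "\<Gamma> \<in> borel_measurable seq_space" "\<And>z. 1 \<le> \<Gamma> z" "\<And>z. \<Gamma> z \<le> C"
  shows "\<exists>R. (\<forall>j<N. R j \<in> borel_measurable M \<and> (\<forall>\<omega>. \<bar>R j \<omega> - (LBINT s:{0<..T}. step_function (S j) s * v s \<omega>)\<bar>
          \<le> E * \<delta> powr \<gamma> * (LBINT s:{0<..T}. \<bar>step_function (S j) s\<bar>))) \<and>
       (\<integral>\<omega>. ln (\<Gamma> (\<lambda>j. if j < N then step_integral W (S j) \<omega> + R j \<omega> else 0)) \<partial>M)
          \<le> ln (\<integral>\<omega>. \<Gamma> (\<lambda>j. if j < N then step_integral W (S j) \<omega> else 0) \<partial>M) + (Q T - Q 0) / 2"
proof -
  define P where "P = (\<Union>j<N. \<Union>(c, u, w)\<in>set (S j). {u, w})"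
  have P1: "finite P" unfolding P_def by auto
  have P2: "P \<subseteq> {0..T}"
  proof
    fix p assume "p \<in> P"
    then obtain j c u w where "j < N" "(c, u, w) \<in> set (S j)" "p = u \<or> p = w" unfolding P_def by auto
    then show "p \<in> {0..T}" using S[of j c u w] by auto
  qed
  obtain n t where nt: "t 0 = 0" "t n = T" "\<And>i j. i < j \<Longrightarrow> j \<le> n \<Longrightarrow> t i < t j"
    "\<And>i. i < n \<Longrightarrow> t (Suc i) - t i \<le> \<delta>" "\<And>p. p \<in> P \<Longrightarrow> \<exists>k\<le>n. p = t k"
    by (rule fine_partition[OF T \<delta> P1 P2]) (rule that)
  interpret time_grid T n t by unfold_locales (use nt in auto)
  have grid: "on_grid (S j)" if j: "j < N" for j
    unfolding on_grid_def
  proof safe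
    fix c u w assume m: "(c, u, w) \<in> set (S j)"
    show "u \<le> w" using S[OF j m] by simp
    have "u \<in> P" "w \<in> P" using m j unfolding P_def by auto
    then show "u \<in> t ` {..n}" "w \<in> t ` {..n}" using nt(5) by (auto simp: image_iff)
  qed
  have cell: "0 \<le> t i" "t i < t (Suc i)" "t (Suc i) \<le> T" if "i < n" for i
    using that range[of i] range[of "Suc i"] inc[of i "Suc i"] by auto
  define D where "D i \<omega> = W (t (Suc i)) \<omega> - W (t i) \<omega>" for i \<omega>
  define ai where "ai i = a (t i) (t (Suc i))" for i
  define R where "R j \<omega> = (\<Sum>i<n. step_function (S j) (t (Suc i)) * ai i \<omega>)" for j \<omega>
  define \<Phi> where "\<Phi> d = \<Gamma> (\<lambda>j. if j < N then \<Sum>i<n. step_function (S j) (t (Suc i)) * d i else 0)" for d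
  have inner: "(\<lambda>d j. if j < N then \<Sum>i<n. step_function (S j) (t (Suc i)) * d i else 0) \<in> measurable seq_space seq_space"
    unfolding measurable_seq_space_iff
  proof
    fix j show "(\<lambda>d. if j < N then \<Sum>i<n. step_function (S j) (t (Suc i)) * d i else 0) \<in> borel_measurable seq_space"
      by (cases "j < N") simp_all
  qed
  have \<Phi>: "\<Phi> \<in> borel_measurable seq_space" "\<And>z. 1 \<le> \<Phi> z" "\<And>z. \<Phi> z \<le> C"
    unfolding \<Phi>_def using measurable_compose[OF inner \<Gamma>(1)] \<Gamma>(2,3) by auto
  have chain: "(\<integral>\<omega>. ln (\<Phi> (\<lambda>i. if i < n then D i \<omega> + ai i \<omega> else 0)) \<partial>M)
    \<le> ln (\<integral>\<omega>. \<Phi> (\<lambda>i. if i < n then D i \<omega> else 0) \<partial>M) + (\<Sum>i<n. (sqrt ((t (Suc i) - t i) * (Q (t (Suc i)) - Q (t i))))\<^sup>2 / (2 * (sqrt (t (Suc i) - t i))\<^sup>2))"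
  proof (rule gauss_chain_log[where G="\<lambda>i. F (t i)"])
    fix i assume i: "i < n"
    show "distributed M lborel (D i) (\<lambda>z. ennreal (normal_density 0 (sqrt (t (Suc i) - t i)) z))"
      "indep_set (sets (F (t i))) {D i -` A \<inter> space M |A. A \<in> sets borel}"
      using W_increment[OF cell[OF i]] by (simp_all add: D_def[abs_def])
    show "D i \<in> borel_measurable (F (t (Suc i)))"
      unfolding D_def[abs_def] using cell[OF i]
      by (intro borel_measurable_diff W_adapted measurable_from_subalg[OF F_subalg W_adapted]) auto
    show "ai i \<in> borel_measurable (F (t i))" unfolding ai_def by (rule a_meas[OF cell[OF i]])
    show "\<bar>ai i \<omega>\<bar> \<le> sqrt ((t (Suc i) - t i) * (Q (t (Suc i)) - Q (t i)))" for \<omega>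
      unfolding ai_def by (rule real_le_rsqrt) (simp add: a_bd[OF cell[OF i]])
    show "0 < sqrt (t (Suc i) - t i)" using cell[OF i] by simp
  next
    fix i j assume "i \<le> j" "j \<le> n"
    then show "sets (F (t i)) \<subseteq> sets (F (t j))" by (intro F_mono) (simp add: le_iff)
  qed (rule sub \<Phi>)+
  \<comment> \<open>The length of the cell cancels against the variance of the increment, and the increments of \<open>Q\<close> telescope.\<close>
  have "(\<Sum>i<n. (sqrt ((t (Suc i) - t i) * (Q (t (Suc i)) - Q (t i))))\<^sup>2 / (2 * (sqrt (t (Suc i) - t i))\<^sup>2)) = (\<Sum>i<n. (Q (t (Suc i)) - Q (t i)) / 2)"
  proof (rule sum.cong[OF refl])
    fix i assume "i \<in> {..<n}"
    then have c: "0 < t (Suc i) - t i" "0 \<le> (t (Suc i) - t i) * (Q (t (Suc i)) - Q (t i))"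
      using cell[of i] order.trans[OF zero_le_power2 a_bd[OF cell, of i]] by auto
    show "(sqrt ((t (Suc i) - t i) * (Q (t (Suc i)) - Q (t i))))\<^sup>2 / (2 * (sqrt (t (Suc i) - t i))\<^sup>2) = (Q (t (Suc i)) - Q (t i)) / 2"
      unfolding real_sqrt_pow2[OF c(2)] real_sqrt_pow2[OF less_imp_le[OF c(1)]] mult.commute[of 2]
      by (rule mult_divide_mult_cancel_left) (rule less_imp_neq[OF c(1), symmetric])
  qed
  also have "\<dots> = (Q T - Q 0) / 2"
    unfolding sum_divide_distrib[symmetric] sum_lessThan_telescope[of "\<lambda>i. Q (t i)" n] by (simp add: t0 tn)
  finally have q: "(\<Sum>i<n. (sqrt ((t (Suc i) - t i) * (Q (t (Suc i)) - Q (t i))))\<^sup>2 / (2 * (sqrt (t (Suc i) - t i))\<^sup>2)) = (Q T - Q 0) / 2" .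
  have I: "step_integral W (S j) \<omega> = (\<Sum>i<n. step_function (S j) (t (Suc i)) * D i \<omega>)" if "j < N" for j \<omega>
    unfolding step_integral_grid[OF grid[OF that]] D_def ..
  have e1: "\<Phi> (\<lambda>i. if i < n then D i \<omega> + ai i \<omega> else 0) = \<Gamma> (\<lambda>j. if j < N then step_integral W (S j) \<omega> + R j \<omega> else 0)" for \<omega>
    unfolding \<Phi>_def R_def by (rule arg_cong[of _ _ \<Gamma>]) (auto simp: I fun_eq_iff distrib_left sum.distrib)
  have e2: "\<Phi> (\<lambda>i. if i < n then D i \<omega> else 0) = \<Gamma> (\<lambda>j. if j < N then step_integral W (S j) \<omega> else 0)" for \<omega>
    unfolding \<Phi>_def by (rule arg_cong[of _ _ \<Gamma>]) (auto simp: I fun_eq_iff)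
  show ?thesis
  proof (intro exI[of _ R] conjI allI impI)
    show "(\<integral>\<omega>. ln (\<Gamma> (\<lambda>j. if j < N then step_integral W (S j) \<omega> + R j \<omega> else 0)) \<partial>M)
          \<le> ln (\<integral>\<omega>. \<Gamma> (\<lambda>j. if j < N then step_integral W (S j) \<omega> else 0) \<partial>M) + (Q T - Q 0) / 2"
      using chain unfolding e1 e2 q .
  next
    fix j assume j: "j < N"
    have "ai i \<in> borel_measurable M" if "i < n" for i
      unfolding ai_def by (rule measurable_from_subalg[OF sub a_meas[OF cell[OF that]]])
    then show "R j \<in> borel_measurable M" unfolding R_def[abs_def] by (intro borel_measurable_sum borel_measurable_times) auto
    fix \<omega>
    let ?S = "step_function (S j)"
    obtain B where B: "\<And>s. \<bar>?S s\<bar> \<le> B" using step_function_bounded by blast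
    have i1: "set_integrable lborel {0<..T} (\<lambda>s. ?S s * v s \<omega>)"
    proof (rule set_integrable_bounded[where C="B * Cv"])
      show "\<bar>?S s * v s \<omega>\<bar> \<le> B * Cv" for s
        unfolding abs_mult using B[of s] v_bd[of s \<omega>] by (intro mult_mono) auto
    qed measurable
    have i2: "set_integrable lborel {0<..T} (\<lambda>s. \<bar>?S s\<bar>)"
      by (rule set_integrable_bounded[where C=B]) (use B in auto)
    have const: "?S s = ?S (t (Suc i))" if "i < n" "t i < s \<and> s \<le> t (Suc i)" for i s
      using that by (intro step_function_cell grid j) auto
    have c1: "(LBINT s:{t i<..t (Suc i)}. ?S s * v s \<omega>) = ?S (t (Suc i)) * (LBINT s:{t i<..t (Suc i)}. v s \<omega>)" if "i < n" for i
    proof -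
      have "(LBINT s:{t i<..t (Suc i)}. ?S s * v s \<omega>) = (LBINT s:{t i<..t (Suc i)}. ?S (t (Suc i)) * v s \<omega>)"
        by (rule set_lebesgue_integral_cong, simp, intro allI impI)
           (use const[OF that] in \<open>unfold greaterThanAtMost_iff, metis\<close>)
      then show ?thesis by simp
    qed
    have c2: "(LBINT s:{t i<..t (Suc i)}. \<bar>?S s\<bar>) = \<bar>?S (t (Suc i))\<bar> * (t (Suc i) - t i)" if "i < n" for i
    proof -
      have "(LBINT s:{t i<..t (Suc i)}. \<bar>?S s\<bar>) = (LBINT s:{t i<..t (Suc i)}. \<bar>?S (t (Suc i))\<bar>)"
        by (rule set_lebesgue_integral_cong, simp, intro allI impI)
           (use const[OF that] in \<open>unfold greaterThanAtMost_iff, metis\<close>)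
      also have "\<dots> = \<bar>?S (t (Suc i))\<bar> * (t (Suc i) - t i)"
        using cell[OF that] by (simp add: set_lebesgue_integral_def)
      finally show ?thesis .
    qed
    have "R j \<omega> - (LBINT s:{0<..T}. ?S s * v s \<omega>) = (\<Sum>i<n. ?S (t (Suc i)) * (ai i \<omega> - (LBINT s:{t i<..t (Suc i)}. v s \<omega>)))"
      unfolding set_integral_cells[OF i1] R_def by (simp add: c1 sum_subtractf right_diff_distrib)
    also have "\<bar>\<dots>\<bar> \<le> (\<Sum>i<n. \<bar>?S (t (Suc i))\<bar> * ((t (Suc i) - t i) * (E * \<delta> powr \<gamma>)))"
    proof (rule order.trans[OF sum_abs sum_mono])
      fix i assume "i \<in> {..<n}"
      then have i: "i < n" by simp
      have "(t (Suc i) - t i) powr \<gamma> \<le> \<delta> powr \<gamma>" using cell[OF i] nt(4)[OF i] \<gamma> by (intro powr_mono2) auto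
      then have "(t (Suc i) - t i) * (E * (t (Suc i) - t i) powr \<gamma>) \<le> (t (Suc i) - t i) * (E * \<delta> powr \<gamma>)"
        using cell[OF i] E by (intro mult_left_mono) auto
      then have "\<bar>ai i \<omega> - (LBINT s:{t i<..t (Suc i)}. v s \<omega>)\<bar> \<le> (t (Suc i) - t i) * (E * \<delta> powr \<gamma>)"
        unfolding ai_def using a_close[OF cell[OF i], of \<omega>] by linarith
      then show "\<bar>?S (t (Suc i)) * (ai i \<omega> - (LBINT s:{t i<..t (Suc i)}. v s \<omega>))\<bar> \<le> \<bar>?S (t (Suc i))\<bar> * ((t (Suc i) - t i) * (E * \<delta> powr \<gamma>))"
        unfolding abs_mult by (rule mult_left_mono) simp
    qed
    also have "\<dots> = E * \<delta> powr \<gamma> * (LBINT s:{0<..T}. \<bar>?S s\<bar>)"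
      unfolding set_integral_cells[OF i2] sum_distrib_left by (intro sum.cong refl) (simp add: c2)
    finally show "\<bar>R j \<omega> - (LBINT s:{0<..T}. ?S s * v s \<omega>)\<bar> \<le> E * \<delta> powr \<gamma> * (LBINT s:{0<..T}. \<bar>?S s\<bar>)" .
  qed
qed

end

lemma nn_integral_L2_imp_L1:
  fixes f :: "nat \<Rightarrow> 'b \<Rightarrow> real"
  assumes [measurable]: "\<And>m. f m \<in> borel_measurable \<mu>" and fin: "emeasure \<mu> (space \<mu>) < \<infinity>"
    and L2: "(\<lambda>m. \<integral>\<^sup>+x. ennreal ((f m x)\<^sup>2) \<partial>\<mu>) \<longlonglongrightarrow> 0"
  shows "(\<lambda>m. \<integral>\<^sup>+x. ennreal \<bar>f m x\<bar> \<partial>\<mu>) \<longlonglongrightarrow> 0"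
proof -
  \<comment> \<open>The Cauchy-Schwarz inequality against the constant function one.\<close>
  have le: "(\<integral>\<^sup>+x. ennreal \<bar>f m x\<bar> \<partial>\<mu>)\<^sup>2 \<le> (\<integral>\<^sup>+x. ennreal ((f m x)\<^sup>2) \<partial>\<mu>) * emeasure \<mu> (space \<mu>)" for m
    using Cauchy_Schwarz_nn_integral[of "\<lambda>x. ennreal \<bar>f m x\<bar>" \<mu> "\<lambda>_. 1"] by (simp add: ennreal_power)
  have "(\<lambda>m. (\<integral>\<^sup>+x. ennreal ((f m x)\<^sup>2) \<partial>\<mu>) * emeasure \<mu> (space \<mu>)) \<longlonglongrightarrow> 0 * emeasure \<mu> (space \<mu>)"
    by (rule tendsto_mult_ennreal[OF L2 tendsto_const]) (use fin in auto)
  then have lim: "(\<lambda>m. (\<integral>\<^sup>+x. ennreal ((f m x)\<^sup>2) \<partial>\<mu>) * emeasure \<mu> (space \<mu>)) \<longlonglongrightarrow> 0" by simp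
  show ?thesis
  proof (rule order_tendstoI)
    fix e :: ennreal assume e: "0 < e"
    then have "0 < e * e" by (simp add: ennreal_zero_less_mult_iff)
    from order_tendstoD(2)[OF lim this]
    show "\<forall>\<^sub>F m in sequentially. (\<integral>\<^sup>+x. ennreal \<bar>f m x\<bar> \<partial>\<mu>) < e"
    proof eventually_elim
      case (elim m)
      show ?case
      proof (rule ccontr)
        assume "\<not> ?case"
        then have "e * e \<le> (\<integral>\<^sup>+x. ennreal \<bar>f m x\<bar> \<partial>\<mu>)\<^sup>2"
          unfolding power2_eq_square by (intro mult_mono) auto
        with le[of m] elim show False by (meson leD order.trans)
      qed
    qed
  qed simp
qed

text \<open>
For Lipschitz functionals, convergence in \<open>L\<^sup>1\<close> of the finitely many arguments suffices.
\<close>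

lemma (in prob_space) tendsto_integral_Lipschitz:
  fixes \<Gamma> :: "(nat \<Rightarrow> real) \<Rightarrow> real" and U :: "nat \<Rightarrow> 'a \<Rightarrow> real" and Um :: "nat \<Rightarrow> nat \<Rightarrow> 'a \<Rightarrow> real"
  assumes \<Gamma>m: "\<Gamma> \<in> borel_measurable seq_space" and bd: "\<And>z. \<bar>\<Gamma> z\<bar> \<le> C"
    and Lip: "\<And>z z'. \<bar>\<Gamma> z - \<Gamma> z'\<bar> \<le> L * (\<Sum>j<N. \<bar>z j - z' j\<bar>)" and L: "0 \<le> L"
    and U: "\<And>j. j < N \<Longrightarrow> U j \<in> borel_measurable M" and Um: "\<And>m j. j < N \<Longrightarrow> Um m j \<in> borel_measurable M"
    and conv: "\<And>j. j < N \<Longrightarrow> (\<lambda>m. \<integral>\<^sup>+\<omega>. ennreal \<bar>Um m j \<omega> - U j \<omega>\<bar> \<partial>M) \<longlonglongrightarrow> 0"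
  shows "(\<lambda>m. \<integral>\<omega>. \<Gamma> (\<lambda>j. if j < N then Um m j \<omega> else 0) \<partial>M) \<longlonglongrightarrow> (\<integral>\<omega>. \<Gamma> (\<lambda>j. if j < N then U j \<omega> else 0) \<partial>M)"
proof -
  have meas: "(\<lambda>\<omega>. \<Gamma> (\<lambda>j. if j < N then V j \<omega> else 0)) \<in> borel_measurable M" if "\<And>j. j < N \<Longrightarrow> V j \<in> borel_measurable M" for V
  proof (rule measurable_compose[OF _ \<Gamma>m])
    show "(\<lambda>\<omega> j. if j < N then V j \<omega> else 0) \<in> measurable M seq_space"
      unfolding measurable_seq_space_iff
    proof
      fix j show "(\<lambda>\<omega>. if j < N then V j \<omega> else 0) \<in> borel_measurable M" using that[of j] by (cases "j < N") auto
    qed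
  qed
  have int: "integrable M (\<lambda>\<omega>. \<Gamma> (\<lambda>j. if j < N then V j \<omega> else 0))" if "\<And>j. j < N \<Longrightarrow> V j \<in> borel_measurable M" for V
    by (rule integrable_const_bound[of _ C]) (use meas[OF that] bd in simp_all)
  let ?P = "\<lambda>m \<omega> j. if j < N then Um m j \<omega> else 0" and ?R = "\<lambda>\<omega> j. if j < N then U j \<omega> else 0"
  let ?x = "\<lambda>m. \<integral>\<omega>. \<Gamma> (?P m \<omega>) \<partial>M" and ?y = "\<integral>\<omega>. \<Gamma> (?R \<omega>) \<partial>M"
  have bound: "ennreal \<bar>?x m - ?y\<bar> \<le> (\<Sum>j<N. ennreal L * (\<integral>\<^sup>+\<omega>. ennreal \<bar>Um m j \<omega> - U j \<omega>\<bar> \<partial>M))" for m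
  proof -
    have "?x m - ?y = (\<integral>\<omega>. \<Gamma> (?P m \<omega>) - \<Gamma> (?R \<omega>) \<partial>M)"
      by (rule Bochner_Integration.integral_diff[symmetric]) (intro int Um U; assumption)+
    also have "ennreal \<bar>\<dots>\<bar> \<le> (\<integral>\<^sup>+\<omega>. ennreal \<bar>\<Gamma> (?P m \<omega>) - \<Gamma> (?R \<omega>)\<bar> \<partial>M)"
      using integral_norm_bound_ennreal[OF Bochner_Integration.integrable_diff[OF int[OF Um] int[OF U]]] by simp
    also have "\<dots> \<le> (\<integral>\<^sup>+\<omega>. (\<Sum>j<N. ennreal L * ennreal \<bar>Um m j \<omega> - U j \<omega>\<bar>) \<partial>M)"
    proof (rule nn_integral_mono)
      fix \<omega>
      have "\<bar>\<Gamma> (?P m \<omega>) - \<Gamma> (?R \<omega>)\<bar> \<le> L * (\<Sum>j<N. \<bar>Um m j \<omega> - U j \<omega>\<bar>)"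
      proof -
        have s: "(\<Sum>j<N. \<bar>(if j < N then Um m j \<omega> else 0) - (if j < N then U j \<omega> else 0)\<bar>) = (\<Sum>j<N. \<bar>Um m j \<omega> - U j \<omega>\<bar>)"
          by (rule sum.cong) auto
        show ?thesis using Lip[of "?P m \<omega>" "?R \<omega>"] unfolding s .
      qed
      then have "ennreal \<bar>\<Gamma> (?P m \<omega>) - \<Gamma> (?R \<omega>)\<bar> \<le> ennreal (\<Sum>j<N. L * \<bar>Um m j \<omega> - U j \<omega>\<bar>)"
        by (simp add: ennreal_leI sum_distrib_left)
      also have "\<dots> = (\<Sum>j<N. ennreal (L * \<bar>Um m j \<omega> - U j \<omega>\<bar>))" using L by (intro sum_ennreal[symmetric]) simp
      also have "\<dots> = (\<Sum>j<N. ennreal L * ennreal \<bar>Um m j \<omega> - U j \<omega>\<bar>)" using L by (intro sum.cong refl ennreal_mult) auto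
      finally show "ennreal \<bar>\<Gamma> (?P m \<omega>) - \<Gamma> (?R \<omega>)\<bar> \<le> (\<Sum>j<N. ennreal L * ennreal \<bar>Um m j \<omega> - U j \<omega>\<bar>)" .
    qed
    also have "\<dots> = (\<Sum>j<N. ennreal L * (\<integral>\<^sup>+\<omega>. ennreal \<bar>Um m j \<omega> - U j \<omega>\<bar> \<partial>M))"
    proof -
      have [measurable]: "Um m j \<in> borel_measurable M" "U j \<in> borel_measurable M" if "j \<in> {..<N}" for j using Um U that by auto
      show ?thesis by (subst nn_integral_sum) (auto intro!: sum.cong nn_integral_cmult)
    qed
    finally show ?thesis .
  qed
  have "(\<lambda>m. \<Sum>j<N. ennreal L * (\<integral>\<^sup>+\<omega>. ennreal \<bar>Um m j \<omega> - U j \<omega>\<bar> \<partial>M)) \<longlonglongrightarrow> (\<Sum>j<N. ennreal L * 0)"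
    by (intro tendsto_sum ennreal_tendsto_cmult conv) auto
  then have lim: "(\<lambda>m. \<Sum>j<N. ennreal L * (\<integral>\<^sup>+\<omega>. ennreal \<bar>Um m j \<omega> - U j \<omega>\<bar> \<partial>M)) \<longlonglongrightarrow> 0" by simp
  have "(\<lambda>m. ennreal \<bar>?x m - ?y\<bar>) \<longlonglongrightarrow> 0"
    by (rule tendsto_sandwich[OF _ _ tendsto_const lim]) (auto intro!: always_eventually bound)
  then have "(\<lambda>m. \<bar>?x m - ?y\<bar>) \<longlonglongrightarrow> 0" by (subst (asm) ennreal_tendsto_0_iff) auto
  then show ?thesis by (rule LIM_zero_cancel[OF tendsto_rabs_zero_cancel])
qed

lemma ln_Lipschitz:
  fixes x y :: real assumes "1 \<le> x" "1 \<le> y" shows "\<bar>ln x - ln y\<bar> \<le> \<bar>x - y\<bar>"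
proof -
  have *: "ln u - ln w \<le> u - w" if "1 \<le> w" "w \<le> u" for u w :: real
  proof -
    have "ln u - ln w = ln (u / w)" using that by (simp add: ln_div)
    also have "\<dots> \<le> u / w - 1" by (rule ln_le_minus_one) (use that in simp)
    also have "u / w - 1 = (u - w) / w" using that by (simp add: field_simps)
    also have "\<dots> \<le> (u - w) / 1" by (rule divide_left_mono) (use that in auto)
    finally show ?thesis by simp
  qed
  have "ln x \<le> ln y \<longleftrightarrow> x \<le> y" using assms by simp
  then show ?thesis using *[of x y] *[of y x] assms by (cases "x \<le> y") auto
qed

context adapted_drift begin

lemma step_integral_measurable:
  assumes "\<And>c u w. (c, u, w) \<in> set S \<Longrightarrow> 0 \<le> u \<and> u \<le> w \<and> w \<le> T"
  shows "step_integral W S \<in> borel_measurable M"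
  using assms
proof (induction S)
  case (Cons x S)
  obtain c u w where x: "x = (c, u, w)" by (cases x)
  have [measurable]: "W u \<in> borel_measurable M" "W w \<in> borel_measurable M"
    using Cons.prems[of c u w] by (auto simp: x intro!: W_measurable)
  have [measurable]: "step_integral W S \<in> borel_measurable M" by (rule Cons.IH) (use Cons.prems in auto)
  have "step_integral W (x # S) = (\<lambda>\<omega>. c * (W w \<omega> - W u \<omega>) + step_integral W S \<omega>)"
    by (simp add: step_integral_def[abs_def] x)
  then show ?case by simp
qed (simp add: step_integral_def[abs_def])

text \<open>
Step functions \<open>S\<close> whose integrals converge to \<open>Y\<close>, and whose shift by any \<open>r\<close> that meets the error bound
of \<open>step_shift_log\<close> for mesh \<open>1 / (m + 1)\<close> is within \<open>\<rho>\<close> of the shift \<open>A\<close> of \<open>Y\<close>.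
\<close>

definition approximates :: "('a \<Rightarrow> real) \<Rightarrow> ('a \<Rightarrow> real) \<Rightarrow> (nat \<Rightarrow> (real \<times> real \<times> real) list) \<Rightarrow> (nat \<Rightarrow> real) \<Rightarrow> bool" where
  "approximates Y A S \<rho> \<longleftrightarrow> (\<forall>m c u w. (c, u, w) \<in> set (S m) \<longrightarrow> 0 \<le> u \<and> u \<le> w \<and> w \<le> T)
     \<and> (\<lambda>m. \<integral>\<^sup>+\<omega>. ennreal \<bar>step_integral W (S m) \<omega> - Y \<omega>\<bar> \<partial>M) \<longlonglongrightarrow> 0
     \<and> \<rho> \<longlonglongrightarrow> 0
     \<and> (\<forall>m \<omega> r. \<bar>r - (LBINT s:{0<..T}. step_function (S m) s * v s \<omega>)\<bar>
          \<le> E * (1 / real (Suc m)) powr \<gamma> * (LBINT s:{0<..T}. \<bar>step_function (S m) s\<bar>) \<longrightarrow> \<bar>r - A \<omega>\<bar> \<le> \<rho> m)"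

text \<open>
The step functions that define a Wiener integral approximate its integrand in \<open>L\<^sup>2\<close> of a bounded
interval, hence in \<open>L\<^sup>1\<close>. Against a bounded \<open>v\<close> this controls the shift uniformly in \<open>\<omega>\<close>.
\<close>

lemma wiener_integral_approx:
  assumes \<tau>: "0 \<le> \<tau>" "\<tau> \<le> T" and Y: "has_wiener_integral M W \<tau> \<phi> Y"
    and A: "\<And>\<omega>. A \<omega> = (LBINT s:{0..\<tau>}. \<phi> s * v s \<omega>)"
  shows "\<exists>S \<rho>. approximates Y A S \<rho>"
proof -
  define \<mu> where "\<mu> = restrict_space lborel {0..\<tau>}"
  have \<phi>m[measurable]: "\<phi> \<in> borel_measurable \<mu>" and Ym[measurable]: "Y \<in> borel_measurable M"
    using Y by (auto simp: has_wiener_integral_def \<mu>_def)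
  obtain S where S0: "\<forall>n. \<forall>(c, u, w)\<in>set (S n). 0 \<le> u \<and> u \<le> w \<and> w \<le> \<tau>"
    and S\<phi>: "(\<lambda>n. \<integral>\<^sup>+ r. ennreal ((\<phi> r - step_function (S n) r)\<^sup>2) \<partial>\<mu>) \<longlonglongrightarrow> 0"
    and SY: "(\<lambda>n. \<integral>\<^sup>+ \<omega>. ennreal ((Y \<omega> - step_integral W (S n) \<omega>)\<^sup>2) \<partial>M) \<longlonglongrightarrow> 0"
    using Y unfolding has_wiener_integral_def by (elim exE conjE) (rule that[unfolded \<mu>_def])
  have S: "0 \<le> u \<and> u \<le> w \<and> w \<le> \<tau>" if m: "(c, u, w) \<in> set (S n)" for n c u w
    using bspec[OF spec[OF S0, of n] m] by simp
  have ST: "0 \<le> u \<and> u \<le> w \<and> w \<le> T" if "(c, u, w) \<in> set (S m)" for m c u w using S[OF that] \<tau> by simp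
  have Im[measurable]: "step_integral W (S m) \<in> borel_measurable M" for m by (rule step_integral_measurable[OF ST])
  have \<psi>m[measurable]: "step_function (S m) \<in> borel_measurable \<mu>" for m
    unfolding \<mu>_def by (rule measurable_restrict_space1) simp
  have vm[measurable]: "(\<lambda>s. v s \<omega>) \<in> borel_measurable \<mu>" for \<omega>
    unfolding \<mu>_def by (rule measurable_restrict_space1) (simp add: v_meas)
  have fin: "emeasure \<mu> (space \<mu>) < \<infinity>"
    using \<tau> by (simp add: \<mu>_def emeasure_restrict_space space_restrict_space)
  interpret \<mu>: finite_measure \<mu> by (rule finite_measureI) (use fin in auto)
  have Yconv: "(\<lambda>m. \<integral>\<^sup>+\<omega>. ennreal \<bar>step_integral W (S m) \<omega> - Y \<omega>\<bar> \<partial>M) \<longlonglongrightarrow> 0"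
  proof -
    have "(\<lambda>m. \<integral>\<^sup>+\<omega>. ennreal \<bar>Y \<omega> - step_integral W (S m) \<omega>\<bar> \<partial>M) \<longlonglongrightarrow> 0"
      by (rule nn_integral_L2_imp_L1[OF _ _ SY]) (auto simp: emeasure_space_1)
    then show ?thesis by (simp add: abs_minus_commute)
  qed
  have \<phi>conv: "(\<lambda>m. \<integral>\<^sup>+r. ennreal \<bar>\<phi> r - step_function (S m) r\<bar> \<partial>\<mu>) \<longlonglongrightarrow> 0"
    by (rule nn_integral_L2_imp_L1[OF _ fin S\<phi>]) measurable
  have \<psi>i: "integrable \<mu> (step_function (S m))" for m
  proof -
    obtain B where "\<And>s. \<bar>step_function (S m) s\<bar> \<le> B" using step_function_bounded by blast
    then show ?thesis by (intro \<mu>.integrable_const_bound[of _ B]) auto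
  qed
  have "\<forall>\<^sub>F m in sequentially. (\<integral>\<^sup>+r. ennreal \<bar>\<phi> r - step_function (S m) r\<bar> \<partial>\<mu>) < 1"
    by (rule order_tendstoD(2)[OF \<phi>conv]) simp
  then obtain m0 where "(\<integral>\<^sup>+r. ennreal \<bar>\<phi> r - step_function (S m0) r\<bar> \<partial>\<mu>) < 1" by (auto simp: eventually_sequentially)
  then have "integrable \<mu> (\<lambda>r. \<phi> r - step_function (S m0) r)"
    by (intro integrableI_bounded) (auto intro: order.strict_trans[OF _ ennreal_one_less_top])
  from Bochner_Integration.integrable_add[OF this \<psi>i[of m0]] have \<phi>i: "integrable \<mu> \<phi>" by simp
  have di: "integrable \<mu> (\<lambda>r. \<bar>\<phi> r - step_function (S m) r\<bar>)" for m
    by (intro integrable_abs Bochner_Integration.integrable_diff \<phi>i \<psi>i)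
  define d where "d m = (\<integral>r. \<bar>\<phi> r - step_function (S m) r\<bar> \<partial>\<mu>)" for m
  have d0: "0 \<le> d m" for m by (simp add: d_def)
  have dlim: "d \<longlonglongrightarrow> 0"
  proof -
    have "(\<lambda>m. ennreal (d m)) \<longlonglongrightarrow> 0"
      using \<phi>conv unfolding d_def by (subst (asm) nn_integral_eq_integral[OF di]) auto
    then show ?thesis using d0 by (subst (asm) ennreal_tendsto_0_iff) auto
  qed
  define n\<phi> where "n\<phi> = (\<integral>r. \<bar>\<phi> r\<bar> \<partial>\<mu>)"
  define \<rho> where "\<rho> m = E * (1 / real (Suc m)) powr \<gamma> * (n\<phi> + d m) + Cv * d m" for m
  have "\<rho> \<longlonglongrightarrow> E * 0 * (n\<phi> + 0) + Cv * 0"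
    unfolding \<rho>_def
  proof (intro tendsto_intros dlim)
    have "(\<lambda>m. (1 / real (Suc m)) powr \<gamma>) \<longlonglongrightarrow> 0 powr \<gamma>"
      by (rule tendsto_powr'[OF LIMSEQ_inverse_real_of_nat[unfolded inverse_eq_divide] tendsto_const]) (use \<gamma> in auto)
    then show "(\<lambda>m. (1 / real (Suc m)) powr \<gamma>) \<longlonglongrightarrow> 0" by simp
  qed
  then have \<rho>lim: "\<rho> \<longlonglongrightarrow> 0" by simp
  have \<psi>0: "step_function (S m) s = 0" if "s \<notin> {0<..\<tau>}" for m s
  proof -
    have "indicator {u<..w} s = (0::real)" if "(c, u, w) \<in> set (S m)" for c u w
      using S[OF that] \<open>s \<notin> {0<..\<tau>}\<close> by (auto simp: indicator_def)
    then have "map (\<lambda>(c, u, w). c * indicator {u<..w} s) (S m) = map (\<lambda>_. 0) (S m)" by (auto simp: case_prod_beta)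
    then show ?thesis unfolding step_function_def by (simp only: sum_list_0)
  qed
  have conv: "(LBINT s:{0<..T}. h s) = (\<integral>s. h s \<partial>\<mu>)" if "\<And>s. s \<notin> {0<..\<tau>} \<Longrightarrow> h s = 0" for h :: "real \<Rightarrow> real"
  proof -
    have "(LBINT s:{0<..T}. h s) = (LBINT s:{0..\<tau>}. h s)"
      unfolding set_lebesgue_integral_def using that \<tau>
      by (intro Bochner_Integration.integral_cong refl) (auto simp: indicator_def)
    also have "\<dots> = (\<integral>s. h s \<partial>\<mu>)" unfolding \<mu>_def set_lebesgue_integral_def by (subst integral_restrict_space) auto
    finally show ?thesis .
  qed
  have Aeq: "A \<omega> = (\<integral>s. \<phi> s * v s \<omega> \<partial>\<mu>)" for \<omega>
    unfolding A \<mu>_def set_lebesgue_integral_def by (subst integral_restrict_space) auto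
  have main: "\<bar>r - A \<omega>\<bar> \<le> \<rho> m" if r: "\<bar>r - (LBINT s:{0<..T}. step_function (S m) s * v s \<omega>)\<bar>
          \<le> E * (1 / real (Suc m)) powr \<gamma> * (LBINT s:{0<..T}. \<bar>step_function (S m) s\<bar>)" for r m \<omega>
  proof -
    have Cv: "0 \<le> Cv" using v_bd[of 0 \<omega>] by linarith
    have vi: "integrable \<mu> (\<lambda>s. h s * v s \<omega>)" if h: "integrable \<mu> h" for h :: "real \<Rightarrow> real"
    proof (rule Bochner_Integration.integrable_bound[OF integrable_mult_right[OF h, of Cv]])
      show "AE s in \<mu>. norm (h s * v s \<omega>) \<le> norm (Cv * h s)"
      proof (rule AE_I2)
        fix s show "norm (h s * v s \<omega>) \<le> norm (Cv * h s)"
          using mult_right_mono[OF v_bd[of s \<omega>] abs_ge_zero[of "h s"]] Cv by (simp add: abs_mult mult.commute)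
      qed
    qed (use h in measurable)
    have "(LBINT s:{0<..T}. step_function (S m) s * v s \<omega>) - A \<omega> = (\<integral>s. step_function (S m) s * v s \<omega> - \<phi> s * v s \<omega> \<partial>\<mu>)"
      by (subst conv) (use \<psi>0 in \<open>auto simp: Aeq Bochner_Integration.integral_diff[OF vi[OF \<psi>i] vi[OF \<phi>i]]\<close>)
    also have "\<bar>\<dots>\<bar> \<le> (\<integral>s. \<bar>step_function (S m) s * v s \<omega> - \<phi> s * v s \<omega>\<bar> \<partial>\<mu>)" by (rule integral_abs_bound)
    also have "\<dots> \<le> (\<integral>s. Cv * \<bar>\<phi> s - step_function (S m) s\<bar> \<partial>\<mu>)"
    proof (intro integral_mono integrable_abs Bochner_Integration.integrable_diff vi \<psi>i \<phi>i integrable_mult_right di)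
      fix s
      have "\<bar>step_function (S m) s * v s \<omega> - \<phi> s * v s \<omega>\<bar> = \<bar>v s \<omega>\<bar> * \<bar>\<phi> s - step_function (S m) s\<bar>"
      proof -
        have "step_function (S m) s * v s \<omega> - \<phi> s * v s \<omega> = - (v s \<omega> * (\<phi> s - step_function (S m) s))" by (simp add: algebra_simps)
        then show ?thesis by (simp only: abs_minus_cancel abs_mult)
      qed
      also have "\<dots> \<le> Cv * \<bar>\<phi> s - step_function (S m) s\<bar>" by (intro mult_right_mono v_bd) simp
      finally show "\<bar>step_function (S m) s * v s \<omega> - \<phi> s * v s \<omega>\<bar> \<le> Cv * \<bar>\<phi> s - step_function (S m) s\<bar>" .
    qed
    finally have 1: "\<bar>(LBINT s:{0<..T}. step_function (S m) s * v s \<omega>) - A \<omega>\<bar> \<le> Cv * d m" by (simp add: d_def)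
    have "(LBINT s:{0<..T}. \<bar>step_function (S m) s\<bar>) = (\<integral>s. \<bar>step_function (S m) s\<bar> \<partial>\<mu>)"
      by (rule conv) (use \<psi>0 in auto)
    also have "\<dots> \<le> (\<integral>s. \<bar>\<phi> s\<bar> + \<bar>\<phi> s - step_function (S m) s\<bar> \<partial>\<mu>)"
      by (intro integral_mono integrable_abs Bochner_Integration.integrable_add \<psi>i \<phi>i di) auto
    also have "\<dots> = n\<phi> + d m" unfolding n\<phi>_def d_def by (rule Bochner_Integration.integral_add[OF integrable_abs[OF \<phi>i] di])
    finally have "E * (1 / real (Suc m)) powr \<gamma> * (LBINT s:{0<..T}. \<bar>step_function (S m) s\<bar>) \<le> E * (1 / real (Suc m)) powr \<gamma> * (n\<phi> + d m)"
      using E by (intro mult_left_mono) auto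
    with r 1 show ?thesis unfolding \<rho>_def by linarith
  qed
  have "approximates Y A S \<rho>"
    unfolding approximates_def using ST Yconv \<rho>lim main by blast
  then show ?thesis by blast
qed

text \<open>
The entropy bound of \<open>step_shift_log\<close> does not depend on the step functions or on the grid, so it
survives the simultaneous limit.
\<close>

lemma wiener_shift_log:
  fixes \<Gamma> :: "(nat \<Rightarrow> real) \<Rightarrow> real" and A Y :: "nat \<Rightarrow> 'a \<Rightarrow> real"
  assumes \<tau>: "\<And>j. j < N \<Longrightarrow> 0 \<le> \<tau> j \<and> \<tau> j \<le> T" and Y: "\<And>j. j < N \<Longrightarrow> has_wiener_integral M W (\<tau> j) (\<phi> j) (Y j)"
    and A: "\<And>j \<omega>. j < N \<Longrightarrow> A j \<omega> = (LBINT s:{0..\<tau> j}. \<phi> j s * v s \<omega>)"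
    and Am: "\<And>j. j < N \<Longrightarrow> A j \<in> borel_measurable M"
    and \<Gamma>: "\<Gamma> \<in> borel_measurable seq_space" "\<And>z. 1 \<le> \<Gamma> z" "\<And>z. \<Gamma> z \<le> C"
    and Lip: "\<And>z z'. \<bar>\<Gamma> z - \<Gamma> z'\<bar> \<le> L * (\<Sum>j<N. \<bar>z j - z' j\<bar>)" and L: "0 \<le> L"
  shows "(\<integral>\<omega>. ln (\<Gamma> (\<lambda>j. if j < N then Y j \<omega> + A j \<omega> else 0)) \<partial>M)
     \<le> ln (\<integral>\<omega>. \<Gamma> (\<lambda>j. if j < N then Y j \<omega> else 0) \<partial>M) + (Q T - Q 0) / 2"
proof -
  have Ym: "Y j \<in> borel_measurable M" if "j < N" for j using Y[OF that] by (simp add: has_wiener_integral_def)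
  have "\<forall>j\<in>{..<N}. \<exists>p. approximates (Y j) (A j) (fst p) (snd p)"
  proof
    fix j assume "j \<in> {..<N}"
    then have j: "j < N" by simp
    obtain S \<rho> where "approximates (Y j) (A j) S \<rho>"
      using wiener_integral_approx[OF conjunct1[OF \<tau>[OF j]] conjunct2[OF \<tau>[OF j]] Y[OF j] A[OF j]] by (elim exE) (rule that)
    then show "\<exists>p. approximates (Y j) (A j) (fst p) (snd p)" by (intro exI[of _ "(S, \<rho>)"]) simp
  qed
  from bchoice[OF this] obtain p where p: "\<forall>j\<in>{..<N}. approximates (Y j) (A j) (fst (p j)) (snd (p j))" ..
  define S where "S m j = fst (p j) m" for m j
  define \<rho> where "\<rho> j = snd (p j)" for j
  have S1: "0 \<le> u \<and> u \<le> w \<and> w \<le> T" if "j < N" "(c, u, w) \<in> set (S m j)" for j m c u w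
    using bspec[OF p, of j] that unfolding approximates_def S_def lessThan_iff by blast
  have S2: "(\<lambda>m. \<integral>\<^sup>+\<omega>. ennreal \<bar>step_integral W (S m j) \<omega> - Y j \<omega>\<bar> \<partial>M) \<longlonglongrightarrow> 0" if "j < N" for j
    using bspec[OF p, of j] that unfolding approximates_def S_def lessThan_iff by blast
  have S3: "\<rho> j \<longlonglongrightarrow> 0" if "j < N" for j
    using bspec[OF p, of j] that unfolding approximates_def \<rho>_def lessThan_iff by blast
  have S4: "\<bar>r - A j \<omega>\<bar> \<le> \<rho> j m" if "j < N" "\<bar>r - (LBINT s:{0<..T}. step_function (S m j) s * v s \<omega>)\<bar>
          \<le> E * (1 / real (Suc m)) powr \<gamma> * (LBINT s:{0<..T}. \<bar>step_function (S m j) s\<bar>)" for j m r \<omega>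
    using bspec[OF p, of j] that unfolding approximates_def S_def \<rho>_def lessThan_iff by blast
  have Sm: "step_integral W (S m j) \<in> borel_measurable M" if "j < N" for m j
    by (rule step_integral_measurable[OF S1[OF that]])
  have "\<forall>m. \<exists>R. (\<forall>j<N. R j \<in> borel_measurable M \<and> (\<forall>\<omega>. \<bar>R j \<omega> - (LBINT s:{0<..T}. step_function (S m j) s * v s \<omega>)\<bar>
          \<le> E * (1 / real (Suc m)) powr \<gamma> * (LBINT s:{0<..T}. \<bar>step_function (S m j) s\<bar>))) \<and>
       (\<integral>\<omega>. ln (\<Gamma> (\<lambda>j. if j < N then step_integral W (S m j) \<omega> + R j \<omega> else 0)) \<partial>M)
          \<le> ln (\<integral>\<omega>. \<Gamma> (\<lambda>j. if j < N then step_integral W (S m j) \<omega> else 0) \<partial>M) + (Q T - Q 0) / 2"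
    by (intro allI step_shift_log[OF S1 _ \<Gamma>]) auto
  from choice[OF this] obtain R where R: "\<And>m j. j < N \<Longrightarrow> R m j \<in> borel_measurable M"
      "\<And>m j \<omega>. j < N \<Longrightarrow> \<bar>R m j \<omega> - (LBINT s:{0<..T}. step_function (S m j) s * v s \<omega>)\<bar>
          \<le> E * (1 / real (Suc m)) powr \<gamma> * (LBINT s:{0<..T}. \<bar>step_function (S m j) s\<bar>)"
      "\<And>m. (\<integral>\<omega>. ln (\<Gamma> (\<lambda>j. if j < N then step_integral W (S m j) \<omega> + R m j \<omega> else 0)) \<partial>M)
          \<le> ln (\<integral>\<omega>. \<Gamma> (\<lambda>j. if j < N then step_integral W (S m j) \<omega> else 0) \<partial>M) + (Q T - Q 0) / 2" by blast
  have nb: "\<bar>\<Gamma> z\<bar> \<le> C" for z using \<Gamma>(2,3)[of z] by simp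
  have lnb: "\<bar>ln (\<Gamma> z)\<bar> \<le> ln C" for z by (rule abs_ln_le[OF \<Gamma>(2,3)])
  have lim1: "(\<lambda>m. \<integral>\<omega>. \<Gamma> (\<lambda>j. if j < N then step_integral W (S m j) \<omega> else 0) \<partial>M) \<longlonglongrightarrow> (\<integral>\<omega>. \<Gamma> (\<lambda>j. if j < N then Y j \<omega> else 0) \<partial>M)"
    by (rule tendsto_integral_Lipschitz[OF \<Gamma>(1) nb Lip L Ym Sm S2])
  have lim2: "(\<lambda>m. \<integral>\<omega>. ln (\<Gamma> (\<lambda>j. if j < N then step_integral W (S m j) \<omega> + R m j \<omega> else 0)) \<partial>M) \<longlonglongrightarrow> (\<integral>\<omega>. ln (\<Gamma> (\<lambda>j. if j < N then Y j \<omega> + A j \<omega> else 0)) \<partial>M)"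
  proof (rule tendsto_integral_Lipschitz[where \<Gamma>="\<lambda>z. ln (\<Gamma> z)" and Um="\<lambda>m j \<omega>. step_integral W (S m j) \<omega> + R m j \<omega>" and U="\<lambda>j \<omega>. Y j \<omega> + A j \<omega>", OF _ lnb _ L])
    show "\<bar>ln (\<Gamma> z) - ln (\<Gamma> z')\<bar> \<le> L * (\<Sum>j<N. \<bar>z j - z' j\<bar>)" for z z'
      by (rule order.trans[OF ln_Lipschitz Lip]) (rule \<Gamma>(2))+
    fix j assume j: "j < N"
    note [measurable] = Ym[OF j] Am[OF j] Sm[OF j] R(1)[OF j]
    show "(\<lambda>m. \<integral>\<^sup>+\<omega>. ennreal \<bar>(step_integral W (S m j) \<omega> + R m j \<omega>) - (Y j \<omega> + A j \<omega>)\<bar> \<partial>M) \<longlonglongrightarrow> 0"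
    proof (rule tendsto_sandwich[OF _ _ tendsto_const])
      show "(\<lambda>m. (\<integral>\<^sup>+\<omega>. ennreal \<bar>step_integral W (S m j) \<omega> - Y j \<omega>\<bar> \<partial>M) + ennreal (\<rho> j m)) \<longlonglongrightarrow> 0"
        using tendsto_add[OF S2[OF j] tendsto_ennrealI[OF S3[OF j]]] by simp
      show "\<forall>\<^sub>F m in sequentially. (\<integral>\<^sup>+\<omega>. ennreal \<bar>(step_integral W (S m j) \<omega> + R m j \<omega>) - (Y j \<omega> + A j \<omega>)\<bar> \<partial>M)
         \<le> (\<integral>\<^sup>+\<omega>. ennreal \<bar>step_integral W (S m j) \<omega> - Y j \<omega>\<bar> \<partial>M) + ennreal (\<rho> j m)"
      proof (rule always_eventually, rule allI)
        fix m
        have "(\<integral>\<^sup>+\<omega>. ennreal \<bar>(step_integral W (S m j) \<omega> + R m j \<omega>) - (Y j \<omega> + A j \<omega>)\<bar> \<partial>M)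
          \<le> (\<integral>\<^sup>+\<omega>. ennreal \<bar>step_integral W (S m j) \<omega> - Y j \<omega>\<bar> + ennreal (\<rho> j m) \<partial>M)"
        proof (rule nn_integral_mono)
          fix \<omega>
          have a: "\<bar>R m j \<omega> - A j \<omega>\<bar> \<le> \<rho> j m" by (rule S4[OF j R(2)[OF j]])
          then have "0 \<le> \<rho> j m" by linarith
          have "\<bar>(step_integral W (S m j) \<omega> + R m j \<omega>) - (Y j \<omega> + A j \<omega>)\<bar> \<le> \<bar>step_integral W (S m j) \<omega> - Y j \<omega>\<bar> + \<rho> j m"
            using a by linarith
          then show "ennreal \<bar>(step_integral W (S m j) \<omega> + R m j \<omega>) - (Y j \<omega> + A j \<omega>)\<bar> \<le> ennreal \<bar>step_integral W (S m j) \<omega> - Y j \<omega>\<bar> + ennreal (\<rho> j m)"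
            using \<open>0 \<le> \<rho> j m\<close> by (simp add: ennreal_leI flip: ennreal_plus)
        qed
        also have "\<dots> = (\<integral>\<^sup>+\<omega>. ennreal \<bar>step_integral W (S m j) \<omega> - Y j \<omega>\<bar> \<partial>M) + ennreal (\<rho> j m)"
          by (subst nn_integral_add) (auto simp: emeasure_space_1)
        finally show "(\<integral>\<^sup>+\<omega>. ennreal \<bar>(step_integral W (S m j) \<omega> + R m j \<omega>) - (Y j \<omega> + A j \<omega>)\<bar> \<partial>M)
         \<le> (\<integral>\<^sup>+\<omega>. ennreal \<bar>step_integral W (S m j) \<omega> - Y j \<omega>\<bar> \<partial>M) + ennreal (\<rho> j m)" .
      qed
    qed simp
  qed (use \<Gamma>(1) Ym Am Sm R(1) in measurable)
  have "1 \<le> (\<integral>\<omega>. \<Gamma> (\<lambda>j. if j < N then Y j \<omega> else 0) \<partial>M)"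
  proof -
    have "(\<lambda>\<omega> j. if j < N then Y j \<omega> else 0) \<in> measurable M seq_space"
      unfolding measurable_seq_space_iff
    proof
      fix j show "(\<lambda>\<omega>. if j < N then Y j \<omega> else 0) \<in> borel_measurable M" using Ym[of j] by (cases "j < N") auto
    qed
    then have "integrable M (\<lambda>\<omega>. \<Gamma> (\<lambda>j. if j < N then Y j \<omega> else 0))"
      by (intro integrable_const_bound[of _ C] measurable_compose[OF _ \<Gamma>(1)]) (use nb in simp_all)
    from integral_mono[OF integrable_const[of 1] this \<Gamma>(2)] show ?thesis by (simp add: prob_space)
  qed
  then have "(\<lambda>m. ln (\<integral>\<omega>. \<Gamma> (\<lambda>j. if j < N then step_integral W (S m j) \<omega> else 0) \<partial>M) + (Q T - Q 0) / 2) \<longlonglongrightarrow> ln (\<integral>\<omega>. \<Gamma> (\<lambda>j. if j < N then Y j \<omega> else 0) \<partial>M) + (Q T - Q 0) / 2"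
    by (intro tendsto_add tendsto_ln lim1 tendsto_const) simp
  from LIMSEQ_le[OF lim2 this] show ?thesis using R(3) by blast
qed

end

section \<open>Lifting a drift of the fractional noise to the Wiener process\<close>

text \<open>
The kernel of the inverse of the operator with kernel \<^const>\<open>fbm_kernel\<close>, composed with integration: a
fractional integral of order \<open>1/2 - H\<close> between two power weights.
\<close>

definition frac_kernel :: "real \<Rightarrow> real \<Rightarrow> real \<Rightarrow> real" where
  "frac_kernel H s r = (if 0 < r \<and> r < s then
     s powr (H - 1/2) * (s - r) powr (- 1/2 - H) * r powr (1/2 - H) / Gamma (1/2 - H) else 0)"

definition frac_const :: "real \<Rightarrow> real" where
  "frac_const H = Beta (3/2 - H) (1/2 - H) / Gamma (1/2 - H)"

lemma Beta_one_right: "0 < p \<Longrightarrow> Beta p 1 = 1 / (p::real)"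
proof -
  assume p: "0 < p"
  then have "p \<notin> \<int>\<^sub>\<le>\<^sub>0" by (auto elim!: nonpos_Ints_cases)
  then have "Gamma (p + 1) = p * Gamma p" by (rule Gamma_plus1)
  moreover have "Gamma p \<noteq> 0" using Gamma_real_pos[OF p] by linarith
  ultimately show ?thesis using p unfolding Beta_def by (simp del: Gamma_eq_zero_iff)
qed

lemma frac_kernel_measurable[measurable]:
  "(\<lambda>x. frac_kernel H (fst x) (snd x)) \<in> borel_measurable (borel \<Otimes>\<^sub>M borel)"
  unfolding frac_kernel_def by measurable

lemma frac_kernel_measurable2[measurable]: "frac_kernel H s \<in> borel_measurable borel"
  unfolding frac_kernel_def[abs_def] by measurable

lemma measurable_pair_lborel: "borel_measurable (N \<Otimes>\<^sub>M lborel) = borel_measurable (N \<Otimes>\<^sub>M borel)"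
  by (rule measurable_cong_sets[OF sets_pair_measure_cong[OF refl sets_lborel] refl])

lemma set_integral_square_le:
  fixes f :: "real \<Rightarrow> real"
  assumes ab: "a < b" and f: "set_integrable lborel {a<..b} f" and f2: "set_integrable lborel {a<..b} (\<lambda>s. (f s)\<^sup>2)"
  shows "(LBINT s:{a<..b}. f s)\<^sup>2 \<le> (b - a) * (LBINT s:{a<..b}. (f s)\<^sup>2)"
proof -
  \<comment> \<open>The variance of \<open>f\<close> on the interval, \<open>m\<close> being its mean, is nonnegative.\<close>
  define I m where "I = (LBINT s:{a<..b}. f s)" and "m = I / (b - a)"
  have c: "set_integrable lborel {a<..b} (\<lambda>s. m\<^sup>2)" using ab by (simp add: set_integrable_def)
  have fm: "set_integrable lborel {a<..b} (\<lambda>s. (2 * m) * f s)" by (rule set_integrable_mult_right) (rule f)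
  have "0 \<le> (LBINT s:{a<..b}. (f s - m)\<^sup>2)"
    unfolding set_lebesgue_integral_def by (intro Bochner_Integration.integral_nonneg) (simp add: indicator_def)
  also have "\<dots> = (LBINT s:{a<..b}. ((f s)\<^sup>2 - (2 * m) * f s) + m\<^sup>2)"
    by (rule arg_cong[of _ _ "\<lambda>g. set_lebesgue_integral lborel {a<..b} g"]) (auto simp: power2_eq_square algebra_simps)
  also have "\<dots> = (LBINT s:{a<..b}. (f s)\<^sup>2) - (2 * m) * I + m\<^sup>2 * (b - a)"
    using ab by (simp add: set_integral_add(2)[OF set_integral_diff(1)[OF f2 fm] c] set_integral_diff(2)[OF f2 fm] I_def)
       (simp add: set_lebesgue_integral_def)
  also have "\<dots> = (LBINT s:{a<..b}. (f s)\<^sup>2) - I\<^sup>2 / (b - a)"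
  proof -
    have d: "b - a \<noteq> 0" using ab by simp
    have "(2 * m) * I = 2 * (I\<^sup>2 / (b - a))" unfolding m_def power2_eq_square by simp
    moreover have "m\<^sup>2 * (b - a) = I\<^sup>2 / (b - a)" unfolding m_def power2_eq_square using d by simp
    ultimately show ?thesis by linarith
  qed
  finally show ?thesis using ab by (simp add: I_def field_simps)
qed

context
  fixes H :: real
  assumes H: "0 < H" "H < 1/2"
begin

lemma frac_kernel_nonneg: "0 \<le> frac_kernel H s r"
  using H by (auto simp: frac_kernel_def intro!: mult_nonneg_nonneg divide_nonneg_nonneg less_imp_le[OF Gamma_real_pos])

lemma frac_const_nonneg: "0 \<le> frac_const H"
  using H by (auto simp: frac_const_def Beta_def intro!: divide_nonneg_nonneg mult_nonneg_nonneg less_imp_le[OF Gamma_real_pos])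

lemma nn_integral_frac_kernel:
  assumes s: "0 < s"
  shows "(\<integral>\<^sup>+r. ennreal (frac_kernel H s r) \<partial>lborel) = ennreal (frac_const H * s powr (1/2 - H))"
proof -
  have "(\<integral>\<^sup>+r. ennreal (frac_kernel H s r) \<partial>lborel)
     = (\<integral>\<^sup>+r. ennreal (s powr (H - 1/2) / Gamma (1/2 - H)) * (ennreal ((s - r) powr ((1/2 - H) - 1) * (r - 0) powr ((3/2 - H) - 1)) * indicator {0<..<s} r) \<partial>lborel)"
    using H by (intro nn_integral_cong) (auto simp: frac_kernel_def ennreal_mult[symmetric] indicator_def field_simps intro!: divide_nonneg_nonneg less_imp_le[OF Gamma_real_pos])
  also have "\<dots> = ennreal (s powr (H - 1/2) / Gamma (1/2 - H)) * ennreal ((s - 0) powr ((1/2 - H) + (3/2 - H) - 1) * Beta (1/2 - H) (3/2 - H))"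
    using H s by (subst nn_integral_cmult, measurable) (subst nn_integral_Beta, auto)
  also have "\<dots> = ennreal (frac_const H * s powr (1/2 - H))"
  proof -
    have "s powr (H - 1/2) * s powr ((1/2 - H) + (3/2 - H) - 1) = s powr (1/2 - H)"
      unfolding powr_add[symmetric] by (rule arg_cong) simp
    moreover have "0 < Gamma (1/2 - H)" "0 < Beta (1/2 - H) (3/2 - H)" using H by (auto simp: Beta_def intro!: Gamma_real_pos)
    ultimately show ?thesis
      by (simp add: ennreal_mult[symmetric] frac_const_def Beta_commute[of "3/2 - H"])
  qed
  finally show ?thesis .
qed

lemma frac_kernel_integrable: "integrable lborel (frac_kernel H s)"
proof (cases "0 < s")
  case True
  then show ?thesis using nn_integral_frac_kernel[OF True] frac_kernel_nonneg
    by (intro integrableI_nonneg) (auto simp: ennreal_less_top)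
next
  case False
  then have "frac_kernel H s = (\<lambda>_. 0)" by (auto simp: frac_kernel_def)
  then show ?thesis by simp
qed

lemma integral_frac_kernel: "0 < s \<Longrightarrow> (\<integral>r. frac_kernel H s r \<partial>lborel) = frac_const H * s powr (1/2 - H)"
  using nn_integral_frac_kernel frac_kernel_nonneg frac_const_nonneg
  by (subst integral_eq_nn_integral) auto

text \<open>
This bounds the cost of ignoring a drift after time \<open>\<sigma>\<close>. With \<open>b = 1/2 - H\<close> the weights satisfy
\<open>s\<^sup>-\<^sup>b r\<^sup>b \<le> 1\<close>, which leaves \<open>\<integral>\<^sub>\<sigma>\<^sup>s (s - r)\<^sup>b\<^sup>-\<^sup>1 dr\<close>.
\<close>

lemma frac_kernel_tail:
  assumes s: "0 \<le> \<sigma>" "\<sigma> < s"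
  shows "(\<integral>r. frac_kernel H s r * indicator {\<sigma>..} r \<partial>lborel) \<le> inverse (Gamma (1/2 - H) * (1/2 - H)) * (s - \<sigma>) powr (1/2 - H)"
proof -
  define b where "b = 1/2 - H"
  have b: "0 < b" "0 < Gamma b" using H by (auto simp: b_def intro!: Gamma_real_pos)
  have "(\<integral>\<^sup>+r. ennreal (frac_kernel H s r * indicator {\<sigma>..} r) \<partial>lborel)
    \<le> (\<integral>\<^sup>+r. ennreal (inverse (Gamma b)) * (ennreal ((s - r) powr (b - 1) * (r - \<sigma>) powr (1 - 1)) * indicator {\<sigma><..<s} r) \<partial>lborel)"
  proof (rule nn_integral_mono_AE)
    have "AE r in lborel. r \<noteq> \<sigma>" by (rule AE_lborel_singleton)
    then show "AE r in lborel. ennreal (frac_kernel H s r * indicator {\<sigma>..} r) \<le> ennreal (inverse (Gamma b)) * (ennreal ((s - r) powr (b - 1) * (r - \<sigma>) powr (1 - 1)) * indicator {\<sigma><..<s} r)"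
    proof eventually_elim
      case (elim r)
      show ?case
      proof (cases "\<sigma> < r \<and> r < s")
        case True
        then have r: "0 < r" "0 < s" using s by auto
        have "r powr b \<le> s powr b" using r True b by (intro powr_mono2) auto
        then have "s powr (- b) * r powr b \<le> 1" using r by (simp add: powr_minus field_simps)
        then have "s powr (- b) * r powr b * ((s - r) powr (b - 1) * inverse (Gamma b)) \<le> 1 * ((s - r) powr (b - 1) * inverse (Gamma b))"
          using b by (intro mult_right_mono) auto
        then have "frac_kernel H s r \<le> inverse (Gamma b) * (s - r) powr (b - 1)"
        proof -
          have e: "H - 1/2 = - b" "- 1/2 - H = b - 1" "1/2 - H = b" by (simp_all add: b_def)
          have "frac_kernel H s r = s powr (- b) * r powr b * ((s - r) powr (b - 1) * inverse (Gamma b))"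
            using r True unfolding frac_kernel_def e by (simp add: divide_inverse mult_ac)
          then show ?thesis using \<open>_ \<le> 1 * ((s - r) powr (b - 1) * inverse (Gamma b))\<close> by (simp add: mult.commute)
        qed
        then show ?thesis using True b by (simp add: ennreal_mult'[symmetric] ennreal_leI)
      next
        case False
        then show ?thesis using elim by (auto simp: frac_kernel_def indicator_def)
      qed
    qed
  qed
  also have "\<dots> = ennreal (inverse (Gamma b)) * ennreal ((s - \<sigma>) powr (b + 1 - 1) * Beta b 1)"
    using b s by (subst nn_integral_cmult, measurable) (subst nn_integral_Beta, auto)
  also have "\<dots> = ennreal (inverse (Gamma b * b) * (s - \<sigma>) powr b)"
  proof -
    show ?thesis unfolding Beta_one_right[OF b(1)] using b by (simp add: ennreal_mult[symmetric] field_simps)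
  qed
  finally have le: "(\<integral>\<^sup>+r. ennreal (frac_kernel H s r * indicator {\<sigma>..} r) \<partial>lborel) \<le> ennreal (inverse (Gamma b * b) * (s - \<sigma>) powr b)" .
  have "(\<integral>r. frac_kernel H s r * indicator {\<sigma>..} r \<partial>lborel) = enn2real (\<integral>\<^sup>+r. ennreal (frac_kernel H s r * indicator {\<sigma>..} r) \<partial>lborel)"
    using frac_kernel_nonneg by (intro integral_eq_nn_integral) auto
  also have "\<dots> \<le> inverse (Gamma b * b) * (s - \<sigma>) powr b"
    using le b by (intro enn2real_leI) auto
  finally show ?thesis by (simp add: b_def)
qed

end

text \<open>
A bounded drift \<open>g\<close> of the fractional noise that is progressively measurable; the pairs are ordered as
(outcome, time), so that sections and integrals in time are taken in the second component.
\<close>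

locale frac_drift = wiener_basis +
  fixes H :: real and g :: "real \<Rightarrow> 'a \<Rightarrow> real" and G :: real
  assumes H: "0 < H" "H < 1/2"
    and g_bd: "\<And>r \<omega>. \<bar>g r \<omega>\<bar> \<le> G"
    and g_outside: "\<And>r \<omega>. \<omega> \<notin> space M \<Longrightarrow> g r \<omega> = 0"
    and g_prog: "\<And>\<sigma>. 0 \<le> \<sigma> \<Longrightarrow> \<sigma> \<le> T \<Longrightarrow> (\<lambda>x. indicator {0..\<sigma>} (snd x) * g (snd x) (fst x)) \<in> borel_measurable (F \<sigma> \<Otimes>\<^sub>M borel)"
begin

text \<open>
The drift of \<open>W\<close> that lifts \<open>g\<close>, computed from the values of \<open>g\<close> up to time \<open>\<sigma>\<close> alone. It is measurable
with respect to \<open>F \<sigma>\<close> even when \<open>s\<close> is later than \<open>\<sigma>\<close>, and thus serves as the predictable substitute.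
\<close>

definition cut_lift :: "real \<Rightarrow> real \<Rightarrow> 'a \<Rightarrow> real" where
  "cut_lift \<sigma> s \<omega> = (\<integral>r. frac_kernel H s r * (indicator {0..\<sigma>} r * g r \<omega>) \<partial>lborel)"

definition lift :: "real \<Rightarrow> 'a \<Rightarrow> real" where
  "lift s \<omega> = indicator {0..T} s * cut_lift T s \<omega>"

definition cell_lift :: "real \<Rightarrow> real \<Rightarrow> 'a \<Rightarrow> real" where
  "cell_lift \<sigma> \<tau> \<omega> = (LBINT s:{\<sigma><..\<tau>}. cut_lift \<sigma> s \<omega>)"

definition lift_bound :: "real \<Rightarrow> real" where "lift_bound s = G * (frac_const H * s powr (1/2 - H))"

definition energy :: "real \<Rightarrow> real" where "energy \<tau> = (LBINT s:{0<..\<tau>}. (lift_bound s)\<^sup>2)"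

lemma G_nonneg: "0 \<le> G"
proof -
  have "0 \<le> \<bar>g 0 undefined\<bar>" by simp
  also have "\<dots> \<le> G" by (rule g_bd)
  finally show ?thesis .
qed

lemma g_section: "(\<lambda>r. indicator {0..T} r * g r \<omega>) \<in> borel_measurable borel"
proof (cases "\<omega> \<in> space M")
  case True
  have "(\<lambda>r. (\<omega>, r)) \<in> measurable borel (F T \<Otimes>\<^sub>M borel)"
    by (rule measurable_Pair1') (use True F_space in simp)
  from measurable_compose[OF this g_prog[of T]] show ?thesis using T by simp
qed (simp add: g_outside)

lemma g_section': "\<sigma> \<le> T \<Longrightarrow> (\<lambda>r. indicator {0..\<sigma>} r * g r \<omega>) \<in> borel_measurable borel"
proof -
  assume "\<sigma> \<le> T"
  then have "(\<lambda>r. indicator {0..\<sigma>} r * g r \<omega>) = (\<lambda>r. indicator {0..\<sigma>} r * (indicator {0..T} r * g r \<omega>))"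
    by (auto simp: indicator_def)
  also have "\<dots> \<in> borel_measurable borel" using g_section[of \<omega>] by simp
  finally show ?thesis .
qed

lemma cut_lift_integrable: "\<sigma> \<le> T \<Longrightarrow> integrable lborel (\<lambda>r. frac_kernel H s r * (indicator {0..\<sigma>} r * g r \<omega>))"
proof -
  assume \<sigma>: "\<sigma> \<le> T"
  show ?thesis
  proof (rule Bochner_Integration.integrable_bound[OF integrable_mult_right[OF frac_kernel_integrable[OF H], of G s]])
    show "(\<lambda>r. frac_kernel H s r * (indicator {0..\<sigma>} r * g r \<omega>)) \<in> borel_measurable lborel"
      using g_section'[OF \<sigma>] by simp
    show "AE r in lborel. norm (frac_kernel H s r * (indicator {0..\<sigma>} r * g r \<omega>)) \<le> norm (G * frac_kernel H s r)"
    proof (rule AE_I2)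
      fix r
      have "\<bar>indicator {0..\<sigma>} r * g r \<omega>\<bar> \<le> G" using g_bd[of r \<omega>] G_nonneg by (simp add: indicator_def)
      from mult_left_mono[OF this frac_kernel_nonneg[OF H, of s r]]
      show "norm (frac_kernel H s r * (indicator {0..\<sigma>} r * g r \<omega>)) \<le> norm (G * frac_kernel H s r)"
        using frac_kernel_nonneg[OF H, of s r] G_nonneg by (simp add: abs_mult mult.commute)
    qed
  qed
qed

lemma cut_lift_bound: "\<sigma> \<le> T \<Longrightarrow> 0 < s \<Longrightarrow> \<bar>cut_lift \<sigma> s \<omega>\<bar> \<le> lift_bound s"
proof -
  assume \<sigma>: "\<sigma> \<le> T" and s: "0 < s"
  have "\<bar>cut_lift \<sigma> s \<omega>\<bar> \<le> (\<integral>r. \<bar>frac_kernel H s r * (indicator {0..\<sigma>} r * g r \<omega>)\<bar> \<partial>lborel)"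
    unfolding cut_lift_def by (rule integral_abs_bound)
  also have "\<dots> \<le> (\<integral>r. G * frac_kernel H s r \<partial>lborel)"
  proof (intro integral_mono integrable_abs cut_lift_integrable \<sigma> integrable_mult_right frac_kernel_integrable H)
    fix r
    have "\<bar>indicator {0..\<sigma>} r * g r \<omega>\<bar> \<le> G" using g_bd[of r \<omega>] G_nonneg by (simp add: indicator_def)
    from mult_left_mono[OF this frac_kernel_nonneg[OF H, of s r]]
    show "\<bar>frac_kernel H s r * (indicator {0..\<sigma>} r * g r \<omega>)\<bar> \<le> G * frac_kernel H s r"
      using frac_kernel_nonneg[OF H, of s r] by (simp add: abs_mult mult.commute)
  qed
  also have "\<dots> = lift_bound s" using integral_frac_kernel[OF H s] by (simp add: lift_bound_def)
  finally show ?thesis .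
qed

lemma cut_lift_truncation:
  assumes "0 \<le> \<sigma>" "\<sigma> < s" "s \<le> T"
  shows "\<bar>cut_lift \<sigma> s \<omega> - cut_lift T s \<omega>\<bar> \<le> G * inverse (Gamma (1/2 - H) * (1/2 - H)) * (s - \<sigma>) powr (1/2 - H)"
proof -
  have \<sigma>: "\<sigma> \<le> T" using assms by simp
  have eq: "cut_lift \<sigma> s \<omega> - cut_lift T s \<omega> = (\<integral>r. frac_kernel H s r * (indicator {0..\<sigma>} r * g r \<omega>) - frac_kernel H s r * (indicator {0..T} r * g r \<omega>) \<partial>lborel)"
    unfolding cut_lift_def by (rule Bochner_Integration.integral_diff[OF cut_lift_integrable[OF \<sigma>] cut_lift_integrable[OF order.refl], symmetric])
  have "\<bar>cut_lift \<sigma> s \<omega> - cut_lift T s \<omega>\<bar> \<le> (\<integral>r. \<bar>frac_kernel H s r * (indicator {0..\<sigma>} r * g r \<omega>) - frac_kernel H s r * (indicator {0..T} r * g r \<omega>)\<bar> \<partial>lborel)"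
    unfolding eq by (rule integral_abs_bound)
  also have "\<dots> \<le> (\<integral>r. G * (frac_kernel H s r * indicator {\<sigma>..} r) \<partial>lborel)"
  proof (rule integral_mono)
    show "integrable lborel (\<lambda>r. \<bar>frac_kernel H s r * (indicator {0..\<sigma>} r * g r \<omega>) - frac_kernel H s r * (indicator {0..T} r * g r \<omega>)\<bar>)"
      by (rule integrable_abs[OF Bochner_Integration.integrable_diff[OF cut_lift_integrable[OF \<sigma>] cut_lift_integrable[OF order.refl]]])
    have "integrable lborel (\<lambda>r. frac_kernel H s r * indicator {\<sigma>..} r)"
      by (rule integrable_real_mult_indicator[OF _ frac_kernel_integrable[OF H]]) simp
    then show "integrable lborel (\<lambda>r. G * (frac_kernel H s r * indicator {\<sigma>..} r))" by (rule integrable_mult_right)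
    fix r
    have "\<bar>frac_kernel H s r * (indicator {0..\<sigma>} r * g r \<omega>) - frac_kernel H s r * (indicator {0..T} r * g r \<omega>)\<bar>
      = frac_kernel H s r * (\<bar>indicator {0..\<sigma>} r - indicator {0..T} r\<bar> * \<bar>g r \<omega>\<bar>)"
      using frac_kernel_nonneg[OF H, of s r] by (simp add: abs_mult flip: right_diff_distrib left_diff_distrib)
    also have "\<dots> \<le> frac_kernel H s r * (indicator {\<sigma>..} r * G)"
      using \<sigma> by (intro mult_left_mono mult_mono g_bd frac_kernel_nonneg[OF H]) (auto simp: indicator_def)
    finally show "\<bar>frac_kernel H s r * (indicator {0..\<sigma>} r * g r \<omega>) - frac_kernel H s r * (indicator {0..T} r * g r \<omega>)\<bar> \<le> G * (frac_kernel H s r * indicator {\<sigma>..} r)"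
      by (simp add: mult_ac)
  qed
  also have "\<dots> \<le> G * (inverse (Gamma (1/2 - H) * (1/2 - H)) * (s - \<sigma>) powr (1/2 - H))"
    using mult_left_mono[OF frac_kernel_tail[OF H assms(1,2)] G_nonneg] by simp
  finally show ?thesis by (simp add: mult.assoc)
qed

lemma cut_lift_measurable_pair:
  assumes "0 \<le> \<sigma>" "\<sigma> \<le> T" shows "(\<lambda>x. cut_lift \<sigma> (snd x) (fst x)) \<in> borel_measurable (F \<sigma> \<Otimes>\<^sub>M borel)"
proof -
  have 1: "(\<lambda>y. frac_kernel H (snd (fst y)) (snd y)) \<in> borel_measurable ((F \<sigma> \<Otimes>\<^sub>M borel) \<Otimes>\<^sub>M lborel)"
    by (rule measurable_compose[of "\<lambda>y. (snd (fst y), snd y)" _ "borel \<Otimes>\<^sub>M borel" "\<lambda>x. frac_kernel H (fst x) (snd x)", simplified]) measurable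
  have 2: "(\<lambda>y. indicator {0..\<sigma>} (snd y) * g (snd y) (fst (fst y))) \<in> borel_measurable ((F \<sigma> \<Otimes>\<^sub>M borel) \<Otimes>\<^sub>M lborel)"
  proof -
    have "(\<lambda>y. (fst (fst y), snd y)) \<in> measurable ((F \<sigma> \<Otimes>\<^sub>M borel) \<Otimes>\<^sub>M lborel) (F \<sigma> \<Otimes>\<^sub>M (borel :: real measure))" by measurable
    from measurable_compose[OF this g_prog[OF assms]] show ?thesis by simp
  qed
  show ?thesis unfolding cut_lift_def
    by (rule lborel.borel_measurable_lebesgue_integral) (use borel_measurable_times[OF 1 2] in \<open>simp add: case_prod_beta\<close>)
qed

lemma cut_lift_section: "0 \<le> \<sigma> \<Longrightarrow> \<sigma> \<le> T \<Longrightarrow> (\<lambda>s. cut_lift \<sigma> s \<omega>) \<in> borel_measurable borel"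
proof -
  assume \<sigma>: "0 \<le> \<sigma>" "\<sigma> \<le> T"
  show ?thesis
  proof (cases "\<omega> \<in> space M")
    case True
    have "(\<lambda>r. (\<omega>, r)) \<in> measurable borel (F \<sigma> \<Otimes>\<^sub>M borel)"
      by (rule measurable_Pair1') (use True F_space in simp)
    from measurable_compose[OF this cut_lift_measurable_pair[OF \<sigma>]] show ?thesis by simp
  qed (simp add: cut_lift_def g_outside)
qed

lemma lift_bound_mono: "0 \<le> s \<Longrightarrow> s \<le> t \<Longrightarrow> lift_bound s \<le> lift_bound t"
  unfolding lift_bound_def using G_nonneg frac_const_nonneg[OF H] H by (intro mult_left_mono powr_mono2) auto

lemma lift_bound_nonneg: "0 \<le> lift_bound s"
  unfolding lift_bound_def using G_nonneg frac_const_nonneg[OF H] by simp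

lemma lift_bound_measurable[measurable]: "lift_bound \<in> borel_measurable borel" unfolding lift_bound_def[abs_def] by measurable

lemma lift_bound_integrable: "0 \<le> u \<Longrightarrow> set_integrable lborel {u<..t} lift_bound" "0 \<le> u \<Longrightarrow> set_integrable lborel {u<..t} (\<lambda>s. (lift_bound s)\<^sup>2)"
proof -
  assume u: "0 \<le> u"
  have b: "\<bar>lift_bound s\<bar> \<le> lift_bound t" if "s \<in> {u<..t}" for s using that u lift_bound_nonneg[of s] lift_bound_mono[of s t] by simp
  then show "set_integrable lborel {u<..t} lift_bound" by (rule set_integrable_bounded[OF lift_bound_measurable])
  have "\<bar>(lift_bound s)\<^sup>2\<bar> \<le> (lift_bound t)\<^sup>2" if "s \<in> {u<..t}" for s using b[OF that] lift_bound_nonneg[of s] by (simp add: power_mono)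
  then show "set_integrable lborel {u<..t} (\<lambda>s. (lift_bound s)\<^sup>2)" by (rule set_integrable_bounded[rotated]) measurable
qed

lemma adapted_drift: "adapted_drift M F T W lift cell_lift energy (G * inverse (Gamma (1/2 - H) * (1/2 - H))) (1/2 - H) (lift_bound T)"
proof unfold_locales
  fix \<sigma> \<tau> \<omega> assume st: "0 \<le> \<sigma>" "\<sigma> < \<tau>" "\<tau> \<le> T"
  then have \<sigma>: "\<sigma> \<le> T" by simp
  show "cell_lift \<sigma> \<tau> \<in> borel_measurable (F \<sigma>)"
  proof -
    have "(\<lambda>x. indicator {\<sigma><..\<tau>} (snd x) *\<^sub>R cut_lift \<sigma> (snd x) (fst x)) \<in> borel_measurable (F \<sigma> \<Otimes>\<^sub>M lborel)"
      unfolding measurable_pair_lborel using cut_lift_measurable_pair[OF st(1) \<sigma>] by measurable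
    then show ?thesis unfolding cell_lift_def[abs_def] set_lebesgue_integral_def
      by (intro lborel.borel_measurable_lebesgue_integral) (simp add: case_prod_beta)
  qed
  have wi: "set_integrable lborel {\<sigma><..\<tau>} (\<lambda>s. cut_lift \<sigma> s \<omega>)"
  proof (rule set_integrable_bounded[OF cut_lift_section[OF st(1) \<sigma>]])
    fix s assume "s \<in> {\<sigma><..\<tau>}"
    then show "\<bar>cut_lift \<sigma> s \<omega>\<bar> \<le> lift_bound T" using cut_lift_bound[OF \<sigma>, of s \<omega>] lift_bound_mono[of s T] st by simp
  qed
  have "\<bar>cell_lift \<sigma> \<tau> \<omega>\<bar> \<le> (LBINT s:{\<sigma><..\<tau>}. \<bar>cut_lift \<sigma> s \<omega>\<bar>)"
    unfolding cell_lift_def using set_integral_norm_bound[OF wi] by simp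
  also have "\<dots> \<le> (LBINT s:{\<sigma><..\<tau>}. lift_bound s)"
    by (rule set_integral_mono[OF set_integrable_abs[OF wi] lift_bound_integrable(1)[OF st(1)]]) (use cut_lift_bound[OF \<sigma>] st in auto)
  finally have "(cell_lift \<sigma> \<tau> \<omega>)\<^sup>2 \<le> (LBINT s:{\<sigma><..\<tau>}. lift_bound s)\<^sup>2" by (intro abs_le_square_iff[THEN iffD1]) simp
  also have "\<dots> \<le> (\<tau> - \<sigma>) * (LBINT s:{\<sigma><..\<tau>}. (lift_bound s)\<^sup>2)"
    by (rule set_integral_square_le[OF st(2) lift_bound_integrable[OF st(1)]])
  also have "(LBINT s:{\<sigma><..\<tau>}. (lift_bound s)\<^sup>2) = energy \<tau> - energy \<sigma>"
  proof -
    have u: "{0<..\<sigma>} \<union> {\<sigma><..\<tau>} = {0<..\<tau>}" "{0<..\<sigma>} \<inter> {\<sigma><..\<tau>} = {}" using st by auto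
    show ?thesis using set_integral_Un[OF u(2) lift_bound_integrable(2)[OF order.refl] lift_bound_integrable(2)[OF st(1)]] unfolding energy_def u(1) by simp
  qed
  finally show "(cell_lift \<sigma> \<tau> \<omega>)\<^sup>2 \<le> (\<tau> - \<sigma>) * (energy \<tau> - energy \<sigma>)" .
  define E where "E = G * inverse (Gamma (1/2 - H) * (1/2 - H))"
  have E: "0 \<le> E" unfolding E_def using G_nonneg H by (intro mult_nonneg_nonneg) (auto intro!: mult_nonneg_nonneg less_imp_le[OF Gamma_real_pos])
  have Ti: "set_integrable lborel {\<sigma><..\<tau>} (\<lambda>s. cut_lift T s \<omega>)"
  proof (rule set_integrable_bounded[OF cut_lift_section[OF less_imp_le[OF T] order.refl]])
    fix s assume "s \<in> {\<sigma><..\<tau>}"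
    then show "\<bar>cut_lift T s \<omega>\<bar> \<le> lift_bound T" using cut_lift_bound[OF order.refl, of s \<omega>] lift_bound_mono[of s T] st by simp
  qed
  have "(LBINT s:{\<sigma><..\<tau>}. lift s \<omega>) = (LBINT s:{\<sigma><..\<tau>}. cut_lift T s \<omega>)"
    by (rule set_lebesgue_integral_cong) (use st in \<open>auto simp: lift_def\<close>)
  then have eq: "cell_lift \<sigma> \<tau> \<omega> - (LBINT s:{\<sigma><..\<tau>}. lift s \<omega>) = (LBINT s:{\<sigma><..\<tau>}. cut_lift \<sigma> s \<omega> - cut_lift T s \<omega>)"
    unfolding cell_lift_def by (simp add: set_integral_diff(2)[OF wi Ti])
  have "\<bar>cell_lift \<sigma> \<tau> \<omega> - (LBINT s:{\<sigma><..\<tau>}. lift s \<omega>)\<bar> \<le> (LBINT s:{\<sigma><..\<tau>}. \<bar>cut_lift \<sigma> s \<omega> - cut_lift T s \<omega>\<bar>)"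
    unfolding eq using set_integral_norm_bound[OF set_integral_diff(1)[OF wi Ti]] by simp
  also have "\<dots> \<le> (LBINT s:{\<sigma><..\<tau>}. E * (\<tau> - \<sigma>) powr (1/2 - H))"
  proof (rule set_integral_mono[OF set_integrable_abs[OF set_integral_diff(1)[OF wi Ti]]])
    show "set_integrable lborel {\<sigma><..\<tau>} (\<lambda>s. E * (\<tau> - \<sigma>) powr (1/2 - H))" using st by (simp add: set_integrable_def)
    fix s assume s: "s \<in> {\<sigma><..\<tau>}"
    have "E * (s - \<sigma>) powr (1/2 - H) \<le> E * (\<tau> - \<sigma>) powr (1/2 - H)"
      using s H E by (intro mult_left_mono powr_mono2) auto
    moreover have "\<bar>cut_lift \<sigma> s \<omega> - cut_lift T s \<omega>\<bar> \<le> E * (s - \<sigma>) powr (1/2 - H)"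
      unfolding E_def by (rule cut_lift_truncation) (use s st in auto)
    ultimately show "\<bar>cut_lift \<sigma> s \<omega> - cut_lift T s \<omega>\<bar> \<le> E * (\<tau> - \<sigma>) powr (1/2 - H)" by simp
  qed
  also have "\<dots> = (\<tau> - \<sigma>) * (E * (\<tau> - \<sigma>) powr (1/2 - H))" using st by (simp add: set_lebesgue_integral_def)
  finally show "\<bar>cell_lift \<sigma> \<tau> \<omega> - (LBINT s:{\<sigma><..\<tau>}. lift s \<omega>)\<bar> \<le> (\<tau> - \<sigma>) * (G * inverse (Gamma (1/2 - H) * (1/2 - H)) * (\<tau> - \<sigma>) powr (1/2 - H))"
    unfolding E_def .
next
  fix \<omega> show "(\<lambda>s. lift s \<omega>) \<in> borel_measurable borel"
    unfolding lift_def using cut_lift_section[OF less_imp_le[OF T] order.refl, of \<omega>] by simp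
next
  fix s \<omega>
  have "frac_kernel H 0 r = 0" for r by (simp add: frac_kernel_def)
  then have w0: "cut_lift T 0 \<omega> = 0" by (simp add: cut_lift_def)
  show "\<bar>lift s \<omega>\<bar> \<le> lift_bound T"
  proof (cases "0 < s \<and> s \<le> T")
    case True
    then show ?thesis using cut_lift_bound[OF order.refl, of s \<omega>] lift_bound_mono[of s T] by (simp add: lift_def)
  next
    case False
    then show ?thesis using lift_bound_nonneg[of T] w0 by (cases "s = 0") (auto simp: lift_def indicator_def)
  qed
next
  show "0 \<le> G * inverse (Gamma (1/2 - H) * (1/2 - H))" using G_nonneg H by (intro mult_nonneg_nonneg) (auto intro!: mult_nonneg_nonneg less_imp_le[OF Gamma_real_pos])
  show "0 < 1/2 - H" using H by simp
qed

text \<open>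
Again a Beta integral, \<open>\<integral>\<^sub>0\<^sup>T s\<^sup>1\<^sup>-\<^sup>2\<^sup>H ds\<close>. This is where the power of \<open>T\<close> and the factor \<open>1 - H\<close> of the
final constant arise.
\<close>

lemma energy_T: "energy T - energy 0 = G\<^sup>2 * (frac_const H)\<^sup>2 * T powr (2 - 2 * H) / (2 - 2 * H)"
proof -
  have "energy 0 = 0" by (simp add: energy_def set_lebesgue_integral_def)
  define C where "C = G\<^sup>2 * (frac_const H)\<^sup>2"
  have C: "0 \<le> C" by (simp add: C_def)
  have "(\<integral>\<^sup>+s. ennreal (indicator {0<..T} s *\<^sub>R (lift_bound s)\<^sup>2) \<partial>lborel) = (\<integral>\<^sup>+s. ennreal C * (ennreal ((T - s) powr (1 - 1) * (s - 0) powr ((2 - 2 * H) - 1)) * indicator {0<..<T} s) \<partial>lborel)"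
  proof (rule nn_integral_cong_AE)
    have "AE s in lborel. s \<noteq> T" by (rule AE_lborel_singleton)
    then show "AE s in lborel. ennreal (indicator {0<..T} s *\<^sub>R (lift_bound s)\<^sup>2) = ennreal C * (ennreal ((T - s) powr (1 - 1) * (s - 0) powr ((2 - 2 * H) - 1)) * indicator {0<..<T} s)"
    proof eventually_elim
      case (elim s)
      show ?case
      proof (cases "0 < s \<and> s < T")
        case True
        have "(s powr (1/2 - H))\<^sup>2 = s powr (2 * (1/2 - H))" using True by (simp add: powr_power)
        also have "2 * (1/2 - H) = (2 - 2 * H) - 1" by simp
        finally have "(lift_bound s)\<^sup>2 = C * s powr ((2 - 2 * H) - 1)" by (simp add: lift_bound_def C_def power_mult_distrib)
        then show ?thesis using True C by (simp add: ennreal_mult)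
      qed (use elim in \<open>auto simp: indicator_def\<close>)
    qed
  qed
  also have "\<dots> = ennreal C * ennreal ((T - 0) powr (1 + (2 - 2 * H) - 1) * Beta 1 (2 - 2 * H))"
    using H T by (subst nn_integral_cmult, measurable) (subst nn_integral_Beta, auto)
  also have "\<dots> = ennreal (C * T powr (2 - 2 * H) / (2 - 2 * H))"
  proof -
    have "Beta 1 (2 - 2 * H) = 1 / (2 - 2 * H)"
      unfolding Beta_commute[of 1] by (rule Beta_one_right) (use H in simp)
    then show ?thesis using C H by (simp add: ennreal_mult[symmetric])
  qed
  finally have "energy T = C * T powr (2 - 2 * H) / (2 - 2 * H)"
    unfolding energy_def set_lebesgue_integral_def using C H
    by (subst integral_eq_nn_integral) (auto intro!: AE_I2 divide_nonneg_nonneg mult_nonneg_nonneg)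
  with \<open>energy 0 = 0\<close> show ?thesis by (simp add: C_def)
qed

text \<open>
Fubini's theorem for \<open>k(s) \<kappa>(s,r) g(r)\<close>, with \<open>\<kappa>\<close> the kernel \<^const>\<open>frac_kernel\<close>; the integral over \<open>s\<close> is
\<open>g(r)\<close> by \<open>fbm_kernel_inversion\<close>. That lemma also yields absolute integrability, both kernels being
nonnegative.
\<close>

lemma kernel_integral:
  assumes t: "0 \<le> t" "t \<le> T" and Km: "fbm_kernel H t \<in> borel_measurable (restrict_space lborel {0..t})"
  shows "(LBINT s:{0..t}. fbm_kernel H t s * lift s \<omega>) = (LBINT r:{0..t}. g r \<omega>)"
proof -
  define k where "k s = indicator {0..t} s * fbm_kernel H t s" for s
  have km[measurable]: "k \<in> borel_measurable borel"
    using Km borel_measurable_restrict_space_iff[of "{0..t}" lborel "fbm_kernel H t"] by (simp add: k_def[abs_def] mult.commute)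
  have k0: "0 \<le> k s" for s unfolding k_def using fbm_kernel_nonneg[OF H] by simp
  define gt where "gt r = indicator {0..t} r * g r \<omega>" for r
  have gtm[measurable]: "gt \<in> borel_measurable borel" unfolding gt_def[abs_def] by (rule g_section'[OF t(2)])
  have gtb: "\<bar>gt r\<bar> \<le> G" for r unfolding gt_def using g_bd[of r \<omega>] G_nonneg by (simp add: indicator_def)
  have inner: "(\<integral>\<^sup>+s. ennreal (k s * frac_kernel H s r) \<partial>lborel) = indicator {0<..<t} r" for r
  proof (cases "0 < r \<and> r < t")
    case True
    have Gp: "0 < Gamma (1/2 - H)" using H by (intro Gamma_real_pos) simp
    have "(\<integral>\<^sup>+s. ennreal (k s * frac_kernel H s r) \<partial>lborel) = (\<integral>\<^sup>+s. ennreal (r powr (1/2 - H) / Gamma (1/2 - H)) * (ennreal (fbm_kernel H t s * (s powr (H - 1/2) * (s - r) powr (- 1/2 - H))) * indicator {r<..<t} s) \<partial>lborel)"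
    proof (rule nn_integral_cong)
      fix s
      show "ennreal (k s * frac_kernel H s r) = ennreal (r powr (1/2 - H) / Gamma (1/2 - H)) * (ennreal (fbm_kernel H t s * (s powr (H - 1/2) * (s - r) powr (- 1/2 - H))) * indicator {r<..<t} s)"
      proof (cases "r < s \<and> s < t")
        case True
        then show ?thesis using \<open>0 < r \<and> r < t\<close> Gp fbm_kernel_nonneg[OF H, of t s]
          by (simp add: k_def frac_kernel_def ennreal_mult[symmetric] mult_ac)
      next
        case False
        then have z: "k s * frac_kernel H s r = 0" by (auto simp: k_def frac_kernel_def fbm_kernel_def indicator_def)
        show ?thesis unfolding z using False by simp
      qed
    qed
    also have "\<dots> = ennreal (r powr (1/2 - H) / Gamma (1/2 - H)) * ennreal (Gamma (1/2 - H) * r powr (H - 1/2))"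
    proof (subst nn_integral_cmult)
      have "(\<lambda>s. ennreal (fbm_kernel H t s * (s powr (H - 1/2) * (s - r) powr (- 1/2 - H))) * indicator {r<..<t} s)
        = (\<lambda>s. ennreal (k s * (s powr (H - 1/2) * (s - r) powr (- 1/2 - H))) * indicator {r<..<t} s)"
        using True by (auto simp: k_def indicator_def fun_eq_iff)
      also have "\<dots> \<in> borel_measurable lborel" by measurable
      finally show "(\<lambda>s. ennreal (fbm_kernel H t s * (s powr (H - 1/2) * (s - r) powr (- 1/2 - H))) * indicator {r<..<t} s) \<in> borel_measurable lborel" .
    qed (use fbm_kernel_inversion[OF H, of r t] True in simp)
    also have "\<dots> = ennreal (r powr (1/2 - H) * r powr (H - 1/2))"
      using Gp by (simp add: ennreal_mult[symmetric] del: powr_add[symmetric])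
    also have "r powr (1/2 - H) * r powr (H - 1/2) = 1" using True unfolding powr_add[symmetric] by simp
    finally show ?thesis using True by simp
  next
    case False
    then have z: "k s * frac_kernel H s r = 0" for s by (auto simp: k_def frac_kernel_def fbm_kernel_def indicator_def)
    show ?thesis unfolding z using False by simp
  qed
  define \<Theta> where "\<Theta> s r = k s * frac_kernel H s r * gt r" for s r
  have \<Theta>m: "(\<lambda>x. \<Theta> (fst x) (snd x)) \<in> borel_measurable (lborel \<Otimes>\<^sub>M lborel)"
    unfolding \<Theta>_def using frac_kernel_measurable by measurable
  have int: "integrable (lborel \<Otimes>\<^sub>M lborel) (\<lambda>(s, r). \<Theta> s r)"
  proof (rule integrableI_bounded)
    show "(\<lambda>(s, r). \<Theta> s r) \<in> borel_measurable (lborel \<Otimes>\<^sub>M lborel)" using \<Theta>m by (simp add: case_prod_beta)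
    have "(\<integral>\<^sup>+x. ennreal (norm (case x of (s, r) \<Rightarrow> \<Theta> s r)) \<partial>(lborel \<Otimes>\<^sub>M lborel)) = (\<integral>\<^sup>+r. (\<integral>\<^sup>+s. ennreal \<bar>\<Theta> s r\<bar> \<partial>lborel) \<partial>lborel)"
      using lborel_pair.nn_integral_snd[of "\<lambda>x. ennreal (norm (case x of (s, r) \<Rightarrow> \<Theta> s r))"] \<Theta>m by (simp add: case_prod_beta)
    also have "\<dots> \<le> (\<integral>\<^sup>+r. ennreal G * indicator {0<..<t} r \<partial>lborel)"
    proof (rule nn_integral_mono)
      fix r
      have "(\<integral>\<^sup>+s. ennreal \<bar>\<Theta> s r\<bar> \<partial>lborel) = (\<integral>\<^sup>+s. ennreal \<bar>gt r\<bar> * ennreal (k s * frac_kernel H s r) \<partial>lborel)"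
        using k0 frac_kernel_nonneg[OF H] by (intro nn_integral_cong) (simp add: \<Theta>_def abs_mult ennreal_mult[symmetric] mult_ac)
      also have "\<dots> = ennreal \<bar>gt r\<bar> * indicator {0<..<t} r"
      proof -
        have [measurable]: "(\<lambda>s. frac_kernel H s r) \<in> borel_measurable borel" unfolding frac_kernel_def by measurable
        show ?thesis by (subst nn_integral_cmult) (auto simp: inner)
      qed
      also have "\<dots> \<le> ennreal G * indicator {0<..<t} r" using gtb[of r] by (intro mult_right_mono ennreal_leI) auto
      finally show "(\<integral>\<^sup>+s. ennreal \<bar>\<Theta> s r\<bar> \<partial>lborel) \<le> ennreal G * indicator {0<..<t} r" .
    qed
    also have "\<dots> < \<infinity>" using t by (simp add: nn_integral_cmult ennreal_mult_less_top)
    finally show "(\<integral>\<^sup>+x. ennreal (norm (case x of (s, r) \<Rightarrow> \<Theta> s r)) \<partial>(lborel \<Otimes>\<^sub>M lborel)) < \<infinity>" .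
  qed
  have in1: "(\<integral>r. \<Theta> s r \<partial>lborel) = indicator {0..t} s * (fbm_kernel H t s * lift s \<omega>)" for s
  proof (cases "s \<in> {0..t}")
    case True
    have "cut_lift T s \<omega> = (\<integral>r. frac_kernel H s r * gt r \<partial>lborel)"
      unfolding cut_lift_def gt_def using True t by (intro Bochner_Integration.integral_cong refl) (auto simp: frac_kernel_def indicator_def)
    then show ?thesis using True t by (simp add: \<Theta>_def lift_def k_def mult.assoc)
  qed (simp add: \<Theta>_def k_def)
  have in2: "(\<integral>s. \<Theta> s r \<partial>lborel) = indicator {0<..<t} r * gt r" for r
  proof -
    have [measurable]: "(\<lambda>s. frac_kernel H s r) \<in> borel_measurable borel" unfolding frac_kernel_def by measurable
    have "(\<integral>s. k s * frac_kernel H s r \<partial>lborel) = indicator {0<..<t} r"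
      using k0 frac_kernel_nonneg[OF H] by (subst integral_eq_nn_integral) (auto simp: inner indicator_def)
    then show ?thesis by (simp add: \<Theta>_def)
  qed
  have "(LBINT s:{0..t}. fbm_kernel H t s * lift s \<omega>) = (\<integral>s. (\<integral>r. \<Theta> s r \<partial>lborel) \<partial>lborel)"
    unfolding in1 set_lebesgue_integral_def by simp
  also have "\<dots> = (\<integral>r. (\<integral>s. \<Theta> s r \<partial>lborel) \<partial>lborel)" by (rule lborel_pair.Fubini_integral[OF int, symmetric])
  also have "\<dots> = (\<integral>r. indicator {0..t} r *\<^sub>R g r \<omega> \<partial>lborel)"
    unfolding in2
  proof (rule integral_cong_AE)
    have "AE r in lborel. r \<noteq> 0 \<and> r \<noteq> t" using AE_lborel_singleton[of 0] AE_lborel_singleton[of t] by eventually_elim simp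
    then show "AE r in lborel. indicator {0<..<t} r * gt r = indicator {0..t} r *\<^sub>R g r \<omega>"
      by eventually_elim (auto simp: gt_def indicator_def)
  qed (use g_section'[OF t(2), of \<omega>] in simp_all)
  finally show ?thesis by (simp add: set_lebesgue_integral_def)
qed

lemma g_integral_measurable:
  assumes t: "0 \<le> t" "t \<le> T" shows "(\<lambda>\<omega>. LBINT r:{0..t}. g r \<omega>) \<in> borel_measurable M"
proof -
  have "(\<lambda>x. indicator {0..t} (snd x) * g (snd x) (fst x)) \<in> borel_measurable (F t \<Otimes>\<^sub>M lborel)"
    unfolding measurable_pair_lborel by (rule g_prog[OF t])
  then have "(\<lambda>\<omega>. LBINT r:{0..t}. g r \<omega>) \<in> borel_measurable (F t)"
    unfolding set_lebesgue_integral_def by (intro lborel.borel_measurable_lebesgue_integral) (simp add: case_prod_beta)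
  then show ?thesis by (rule measurable_from_subalg[OF sub])
qed

end

section \<open>The Euler scheme for additive noise\<close>

locale lipschitz_drift =
  fixes T K B0 :: real and b :: "real \<Rightarrow> real \<Rightarrow> real"
  assumes T: "0 < T" and K: "0 < K"
    and b_meas: "(\<lambda>x. b (fst x) (snd x)) \<in> borel_measurable (borel \<Otimes>\<^sub>M borel)"
    and b_lip: "\<And>t u v. \<bar>b t u - b t v\<bar> \<le> K * \<bar>u - v\<bar>"
    and b_zero: "\<And>t. \<bar>b t 0\<bar> \<le> B0"
begin

lemma b_comp_measurable: "Z \<in> borel_measurable borel \<Longrightarrow> (\<lambda>s. b s (Z s)) \<in> borel_measurable borel"
  using measurable_compose[OF measurable_Pair[OF measurable_ident, of Z borel] b_meas] by simp

lemma b_growth: "\<bar>b t u\<bar> \<le> B0 + K * \<bar>u\<bar>"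
  using b_lip[of t u 0] b_zero[of t] by simp

lemma b_comp_integrable:
  assumes Z: "Z \<in> borel_measurable borel" "\<And>s. s \<in> S \<Longrightarrow> \<bar>Z s\<bar> \<le> C" and S: "S \<in> sets borel" "S \<subseteq> {u..w}"
  shows "set_integrable lborel S (\<lambda>s. b s (Z s))"
proof (rule set_integrable_subset[of _ "{u..w} \<inter> S"])
  have "integrable lborel (indicator {u..w} :: real \<Rightarrow> real)"
    by (rule integrable_real_indicator) (auto simp: emeasure_lborel_Icc_eq)
  then have "integrable lborel (\<lambda>s. indicator {u..w} s *\<^sub>R (B0 + K * C))" by simp
  then have "set_integrable lborel ({u..w} \<inter> S) (\<lambda>s. B0 + K * C)"
    using S(1) set_integrable_subset[of lborel "{u..w}" "\<lambda>_. B0 + K * C" "{u..w} \<inter> S"] by (simp add: set_integrable_def)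
  then show "set_integrable lborel ({u..w} \<inter> S) (\<lambda>s. b s (Z s))"
    unfolding set_integrable_def
  proof (rule Bochner_Integration.integrable_bound)
    show "(\<lambda>s. indicator ({u..w} \<inter> S) s *\<^sub>R b s (Z s)) \<in> borel_measurable lborel"
      using S(1) b_comp_measurable[OF Z(1)] by simp
    show "AE s in lborel. norm (indicator ({u..w} \<inter> S) s *\<^sub>R b s (Z s)) \<le> norm (indicator ({u..w} \<inter> S) s *\<^sub>R (B0 + K * C))"
    proof (rule AE_I2)
      fix s
      have "\<bar>b s (Z s)\<bar> \<le> B0 + K * C" if "s \<in> S"
        using b_growth[of s "Z s"] mult_left_mono[OF Z(2)[OF that], of K] K by linarith
      then show "norm (indicator ({u..w} \<inter> S) s *\<^sub>R b s (Z s)) \<le> norm (indicator ({u..w} \<inter> S) s *\<^sub>R (B0 + K * C))"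
        by (auto simp: indicator_def intro: order.trans[OF _ abs_ge_self])
    qed
  qed
qed (use S in auto)

definition drift_step :: "real \<Rightarrow> real \<Rightarrow> real \<Rightarrow> real" where
  "drift_step u w x = (LBINT s:{u<..w}. b s x)"

lemma drift_step_diff:
  assumes uw: "u \<le> w" and Z: "Z \<in> borel_measurable borel" "\<And>s. s \<in> {u<..w} \<Longrightarrow> \<bar>Z s - x\<bar> \<le> c"
  shows "\<bar>(LBINT s:{u<..w}. b s (Z s)) - drift_step u w x\<bar> \<le> K * c * (w - u)"
proof -
  have "\<bar>Z s\<bar> \<le> c + \<bar>x\<bar>" if "s \<in> {u<..w}" for s using Z(2)[OF that] by linarith
  then have i1: "set_integrable lborel {u<..w} (\<lambda>s. b s (Z s))"
    by (rule b_comp_integrable[OF Z(1), of _ _ u w]) auto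
  have i2: "set_integrable lborel {u<..w} (\<lambda>s. b s x)"
    by (rule b_comp_integrable[of "\<lambda>_. x" _ "\<bar>x\<bar>" u w]) auto
  have i3: "set_integrable lborel {u<..w} (\<lambda>s. K * c)" using uw by (simp add: set_integrable_def)
  have "\<bar>(LBINT s:{u<..w}. b s (Z s)) - drift_step u w x\<bar> = \<bar>LBINT s:{u<..w}. b s (Z s) - b s x\<bar>"
    unfolding drift_step_def by (simp add: set_integral_diff(2)[OF i1 i2])
  also have "\<dots> \<le> (LBINT s:{u<..w}. \<bar>b s (Z s) - b s x\<bar>)"
    using set_integral_norm_bound[OF set_integral_diff(1)[OF i1 i2]] by simp
  also have "\<dots> \<le> (LBINT s:{u<..w}. K * c)"
  proof (rule set_integral_mono[OF set_integrable_abs[OF set_integral_diff(1)[OF i1 i2]] i3])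
    fix s assume "s \<in> {u<..w}"
    then show "\<bar>b s (Z s) - b s x\<bar> \<le> K * c"
      using b_lip[of s "Z s" x] mult_left_mono[OF Z(2), of s K] K by linarith
  qed
  also have "\<dots> = K * c * (w - u)" using uw by (simp add: set_lebesgue_integral_def)
  finally show ?thesis .
qed

lemma drift_step_lip: "u \<le> w \<Longrightarrow> \<bar>drift_step u w x - drift_step u w x'\<bar> \<le> K * (w - u) * \<bar>x - x'\<bar>"
  using drift_step_diff[of u w "\<lambda>_. x" x' "\<bar>x - x'\<bar>"] by (simp add: drift_step_def mult_ac)

lemma drift_step_measurable: "u \<le> w \<Longrightarrow> drift_step u w \<in> borel_measurable borel"
proof (rule borel_measurable_continuous_onI)
  assume uw: "u \<le> w"
  have "(K * (w - u))-lipschitz_on UNIV (drift_step u w)"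
    by (rule lipschitz_onI) (use drift_step_lip[OF uw] K uw in \<open>simp_all add: dist_real_def\<close>)
  then show "continuous_on UNIV (drift_step u w)" by (rule lipschitz_on_continuous_on)
qed

text \<open>
The scheme integrates \<open>b\<close> in time exactly, with the state frozen on each cell, because \<open>b\<close> is merely
measurable in time. The argument \<open>z\<close> lists the values of the noise at the grid points.
\<close>

primrec euler :: "nat \<Rightarrow> real \<Rightarrow> (nat \<Rightarrow> real) \<Rightarrow> nat \<Rightarrow> real" where
  "euler N y z 0 = y + z 0"
| "euler N y z (Suc i) = euler N y z i + drift_step (real i * (T / real N)) (real (Suc i) * (T / real N)) (euler N y z i) + (z (Suc i) - z i)"

lemma grid_le: "real i * (T / real N) \<le> real (Suc i) * (T / real N)"
  using T by (intro mult_right_mono) auto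

lemma euler_measurable: "(\<lambda>z. euler N y z i) \<in> borel_measurable (Pi\<^sub>M UNIV (\<lambda>_. borel))"
proof (induction i)
  case (Suc i)
  note [measurable] = Suc
  have [measurable]: "(\<lambda>z. drift_step (real i * (T / real N)) (real (Suc i) * (T / real N)) (euler N y z i)) \<in> borel_measurable (Pi\<^sub>M UNIV (\<lambda>_. borel))"
    by (rule measurable_compose[OF Suc drift_step_measurable[OF grid_le]])
  show ?case unfolding euler.simps by measurable
qed simp

lemma euler_lip: "\<exists>L\<ge>0. \<forall>z z'. \<bar>euler N y z i - euler N y z' i\<bar> \<le> L * (\<Sum>j\<le>i. \<bar>z j - z' j\<bar>)"
proof (induction i)
  case 0 show ?case by (rule exI[of _ 1]) simp
next
  case (Suc i)
  then obtain L where L: "0 \<le> L" "\<And>z z'. \<bar>euler N y z i - euler N y z' i\<bar> \<le> L * (\<Sum>j\<le>i. \<bar>z j - z' j\<bar>)" by blast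
  define k where "k = K * (real (Suc i) * (T / real N) - real i * (T / real N))"
  have k: "0 \<le> k" unfolding k_def using K grid_le[of i N] by simp
  have "\<bar>euler N y z (Suc i) - euler N y z' (Suc i)\<bar> \<le> ((1 + k) * L + 2) * (\<Sum>j\<le>Suc i. \<bar>z j - z' j\<bar>)" for z z'
  proof -
    let ?S = "\<Sum>j\<le>i. \<bar>z j - z' j\<bar>" and ?S' = "\<Sum>j\<le>Suc i. \<bar>z j - z' j\<bar>"
    let ?e = "euler N y z i" and ?e' = "euler N y z' i"
    have SS: "?S' = ?S + \<bar>z (Suc i) - z' (Suc i)\<bar>" by simp
    have "0 \<le> ?S" by (intro sum_nonneg) simp
    have zi: "\<bar>z i - z' i\<bar> \<le> ?S" by (rule member_le_sum) auto
    have "\<bar>euler N y z (Suc i) - euler N y z' (Suc i)\<bar> \<le> \<bar>?e - ?e'\<bar> + k * \<bar>?e - ?e'\<bar> + \<bar>z (Suc i) - z' (Suc i)\<bar> + \<bar>z i - z' i\<bar>"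
      using drift_step_lip[OF grid_le[of i N], of ?e ?e'] unfolding k_def[symmetric] euler.simps by linarith
    also have "\<bar>?e - ?e'\<bar> + k * \<bar>?e - ?e'\<bar> = (1 + k) * \<bar>?e - ?e'\<bar>" by (simp add: algebra_simps)
    also have "\<dots> \<le> (1 + k) * (L * ?S)" using k L(2) by (intro mult_left_mono) auto
    also have "\<dots> \<le> (1 + k) * (L * ?S')" using k L(1) SS by (intro mult_left_mono) auto
    finally have "\<bar>euler N y z (Suc i) - euler N y z' (Suc i)\<bar> \<le> (1 + k) * (L * ?S') + ?S' + ?S'"
      using zi SS \<open>0 \<le> ?S\<close> by linarith
    then show ?thesis by (simp add: distrib_right mult.assoc)
  qed
  moreover have "0 \<le> (1 + k) * L + 2" using k L(1) by simp
  ultimately show ?case by blast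
qed

text \<open>
For additive noise the error is driven by the oscillation of the solution over one cell only, and the
discrete Gronwall inequality applies along a single path.
\<close>

lemma euler_converges:
  assumes X: "continuous_on UNIV X" and eq: "\<And>t. t \<in> {0..T} \<Longrightarrow> X t = y + (LBINT s:{0..t}. b s (X s)) + \<beta> t"
  shows "(\<lambda>n. euler (Suc n) y (\<lambda>j. \<beta> (real j * (T / real (Suc n)))) (Suc n)) \<longlonglongrightarrow> X T"
proof (rule LIMSEQ_I)
  fix r :: real assume r: "0 < r"
  define \<epsilon> where "\<epsilon> = r / (2 * exp (K * T))"
  have \<epsilon>: "0 < \<epsilon>" using r by (simp add: \<epsilon>_def)
  have Xm: "X \<in> borel_measurable borel" by (rule borel_measurable_continuous_onI[OF X])
  have "uniformly_continuous_on {0..T} X"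
    by (rule compact_uniformly_continuous[OF continuous_on_subset[OF X]]) auto
  then obtain \<delta> where \<delta>: "0 < \<delta>" "\<And>s t. s \<in> {0..T} \<Longrightarrow> t \<in> {0..T} \<Longrightarrow> dist t s < \<delta> \<Longrightarrow> dist (X t) (X s) < \<epsilon>"
    unfolding uniformly_continuous_on_def using \<epsilon> by meson
  have "bounded (X ` {0..T})"
    by (intro compact_imp_bounded compact_continuous_image continuous_on_subset[OF X]) auto
  then obtain C where "\<forall>x\<in>X ` {0..T}. norm x \<le> C" unfolding bounded_iff by blast
  then have C: "\<bar>X s\<bar> \<le> C" if "s \<in> {0..T}" for s using that by simp
  obtain n0 :: nat where n0: "T / \<delta> < real n0" using reals_Archimedean2 by blast
  show "\<exists>n0. \<forall>n\<ge>n0. norm (euler (Suc n) y (\<lambda>j. \<beta> (real j * (T / real (Suc n)))) (Suc n) - X T) < r"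
  proof (intro exI[of _ n0] allI impI)
    fix n assume n: "n0 \<le> n"
    define h where "h = T / real (Suc n)"
    have h: "0 < h" "h < \<delta>"
    proof -
      show "0 < h" using T by (simp add: h_def)
      have "T / \<delta> < real (Suc n)" using n0 n by linarith
      then show "h < \<delta>" using \<delta>(1) by (simp add: h_def field_simps)
    qed
    define \<xi> where "\<xi> = euler (Suc n) y (\<lambda>j. \<beta> (real j * h))"
    have hn: "real (Suc n) * h = T" by (simp add: h_def)
    have gr: "0 \<le> real i * h" "real i * h \<le> T" if "i \<le> Suc n" for i
    proof -
      show "0 \<le> real i * h" using h by simp
      have "real i * h \<le> real (Suc n) * h" using that h by (intro mult_right_mono) auto
      then show "real i * h \<le> T" using hn by simp
    qed
    \<comment> \<open>Solving the recursion \<open>e\<^sub>i\<^sub>+\<^sub>1 \<le> (1 + K h) e\<^sub>i + K h \<epsilon>\<close> with \<open>e\<^sub>0 = 0\<close>.\<close>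
    have err: "i \<le> Suc n \<Longrightarrow> \<bar>X (real i * h) - \<xi> i\<bar> \<le> \<epsilon> * ((1 + K * h) ^ i - 1)" for i
    proof (induction i)
      case 0
      have "AE s in lborel. s \<noteq> (0::real)" by (rule AE_lborel_singleton)
      then have "(LBINT s:{0..0}. b s (X s)) = 0"
        unfolding set_lebesgue_integral_def by (intro integral_eq_zero_AE) (auto elim!: eventually_mono)
      then show ?case using eq[of 0] T by (simp add: \<xi>_def)
    next
      case (Suc i)
      define u where "u = real i * h"
      define w where "w = real (Suc i) * h"
      have uw: "0 \<le> u" "u < w" "w \<le> T" "w - u = h" using gr[of i] gr[of "Suc i"] Suc.prems h unfolding u_def w_def by (auto simp: algebra_simps)
      have split: "{0..w} = {0..u} \<union> {u<..w}" using uw by auto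
      have i1: "set_integrable lborel {0..u} (\<lambda>s. b s (X s))" "set_integrable lborel {u<..w} (\<lambda>s. b s (X s))"
        using uw by (auto intro!: b_comp_integrable[OF Xm, of _ C 0 T] C)
      have "X w - X u = (LBINT s:{u<..w}. b s (X s)) + (\<beta> w - \<beta> u)"
        using eq[of w] eq[of u] uw set_integral_Un[OF _ i1] unfolding split[symmetric] by (simp add: ivl_disj_int)
      moreover have "\<xi> (Suc i) = \<xi> i + drift_step u w (\<xi> i) + (\<beta> w - \<beta> u)"
        unfolding \<xi>_def euler.simps h_def[symmetric] u_def w_def ..
      moreover have "\<bar>(LBINT s:{u<..w}. b s (X s)) - drift_step u w (\<xi> i)\<bar> \<le> K * (\<epsilon> + \<bar>X u - \<xi> i\<bar>) * (w - u)"
      proof (rule drift_step_diff[OF less_imp_le[OF uw(2)] Xm])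
        fix s assume s: "s \<in> {u<..w}"
        then have "dist s u < \<delta>" using uw(4) h(2) unfolding dist_real_def greaterThanAtMost_iff by linarith
        then have "dist (X s) (X u) < \<epsilon>" using s uw by (intro \<delta>(2)) auto
        then show "\<bar>X s - \<xi> i\<bar> \<le> \<epsilon> + \<bar>X u - \<xi> i\<bar>" unfolding dist_real_def by linarith
      qed
      ultimately have "\<bar>X w - \<xi> (Suc i)\<bar> \<le> \<bar>X u - \<xi> i\<bar> + K * (\<epsilon> + \<bar>X u - \<xi> i\<bar>) * h" unfolding uw(4) by linarith
      also have "\<dots> = (1 + K * h) * \<bar>X u - \<xi> i\<bar> + K * h * \<epsilon>" by (simp add: algebra_simps)
      also have "\<dots> \<le> (1 + K * h) * (\<epsilon> * ((1 + K * h) ^ i - 1)) + K * h * \<epsilon>"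
        using Suc K h unfolding u_def by (intro add_right_mono mult_left_mono) auto
      also have "\<dots> = \<epsilon> * ((1 + K * h) ^ Suc i - 1)" by (simp add: algebra_simps)
      finally show ?case unfolding w_def .
    qed
    have "(1 + K * h) ^ Suc n \<le> exp (K * h) ^ Suc n"
      using K h by (intro power_mono exp_ge_add_one_self) auto
    also have "\<dots> = exp (K * T)" unfolding exp_of_nat_mult[symmetric] hn[symmetric] by (simp add: mult_ac)
    finally have "\<epsilon> * ((1 + K * h) ^ Suc n - 1) \<le> \<epsilon> * exp (K * T)" using \<epsilon> by (intro mult_left_mono) auto
    also have "\<dots> = r / 2" by (simp add: \<epsilon>_def)
    finally have "\<bar>X T - \<xi> (Suc n)\<bar> \<le> r / 2" using err[of "Suc n"] hn by simp
    then show "norm (euler (Suc n) y (\<lambda>j. \<beta> (real j * (T / real (Suc n)))) (Suc n) - X T) < r"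
      using r unfolding \<xi>_def h_def[symmetric] real_norm_def by linarith
  qed
qed

end

section \<open>Approximation by Lipschitz functions\<close>

lemma abs_diff_indicator_le_1: "0 \<le> a \<Longrightarrow> a \<le> 1 \<Longrightarrow> \<bar>a - indicator A u\<bar> \<le> (1::real)"
  by (cases "u \<in> A") auto

text \<open>
Inner regularity replaces the set by a compact one, whose indicator is the limit of
\<open>max 0 (1 - n dist(u, C))\<close>.
\<close>

lemma indicator_Lipschitz_approx:
  fixes \<rho> :: "real measure"
  assumes \<rho>: "finite_measure \<rho>" "sets \<rho> = sets borel" and A: "A \<in> sets borel" and \<epsilon>: "0 < \<epsilon>"
  shows "\<exists>g L. 0 \<le> L \<and> (\<forall>u v. \<bar>g u - g v\<bar> \<le> L * \<bar>u - v\<bar>) \<and> (\<forall>u. 0 \<le> g u \<and> g u \<le> (1::real))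
     \<and> (\<integral>u. \<bar>g u - indicator A u\<bar> \<partial>\<rho>) < \<epsilon>"
proof -
  interpret finite_measure \<rho> by fact
  note [measurable_cong] = \<rho>(2)
  note [measurable] = A
  obtain C where C: "C \<subseteq> A" "compact C" "measure \<rho> A - \<epsilon> / 2 < measure \<rho> C"
  proof (cases "measure \<rho> A - \<epsilon> / 2 < 0")
    case True
    show ?thesis by (rule that[of "{}"]) (use True in auto)
  next
    case False
    have "ennreal (measure \<rho> A - \<epsilon> / 2) < emeasure \<rho> A"
      unfolding emeasure_eq_measure using \<epsilon> False by (intro ennreal_lessI) (auto simp: zero_less_measure_iff not_less intro: less_le_trans[of 0 "\<epsilon>/2"])
    also have "emeasure \<rho> A = (SUP K \<in> {K. K \<subseteq> A \<and> compact K}. emeasure \<rho> K)"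
      by (rule inner_regular[OF \<rho>(2) _ A]) (simp add: emeasure_eq_measure)
    finally obtain K where K: "K \<subseteq> A" "compact K" "ennreal (measure \<rho> A - \<epsilon> / 2) < emeasure \<rho> K"
      unfolding less_SUP_iff by blast
    then have "measure \<rho> A - \<epsilon> / 2 < measure \<rho> K"
      unfolding emeasure_eq_measure using False by (simp add: ennreal_less_iff)
    with K that show ?thesis by blast
  qed
  have Cb[measurable]: "C \<in> sets borel" using C(2) by (simp add: compact_imp_closed)
  have cA: "(\<integral>u. \<bar>indicator C u - indicator A u\<bar> \<partial>\<rho>) < \<epsilon> / 2"
  proof -
    have "(\<integral>u. \<bar>indicator C u - indicator A u :: real\<bar> \<partial>\<rho>) = (\<integral>u. indicator A u - indicator C u \<partial>\<rho>)"
      using C(1) by (intro Bochner_Integration.integral_cong refl) (auto simp: indicator_def)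
    also have "\<dots> = measure \<rho> A - measure \<rho> C"
      using sets_eq_imp_space_eq[OF \<rho>(2)] by (subst Bochner_Integration.integral_diff) (auto simp: emeasure_eq_measure)
    finally show ?thesis using C(3) by simp
  qed
  show ?thesis
  proof (cases "C = {}")
    case True
    then show ?thesis using cA \<epsilon> by (intro exI[of _ "\<lambda>_. 0"] exI[of _ 0]) auto
  next
    case False
    define g where "g n u = max 0 (1 - real n * infdist u C)" for n u
    have lip: "\<bar>g n u - g n v\<bar> \<le> real n * \<bar>u - v\<bar>" for n u v
    proof -
      have "\<bar>infdist u C - infdist v C\<bar> \<le> \<bar>u - v\<bar>"
        using infdist_triangle[of u C v] infdist_triangle[of v C u] by (simp add: dist_real_def abs_minus_commute)
      then have "real n * \<bar>infdist u C - infdist v C\<bar> \<le> real n * \<bar>u - v\<bar>" by (intro mult_left_mono) auto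
      then have "\<bar>real n * infdist u C - real n * infdist v C\<bar> \<le> real n * \<bar>u - v\<bar>"
        by (simp add: right_diff_distrib[symmetric] abs_mult)
      then show ?thesis unfolding g_def by linarith
    qed
    have g01: "0 \<le> g n u" "g n u \<le> 1" for n u
    proof -
      have "0 \<le> real n * infdist u C" by (simp add: infdist_nonneg)
      then show "0 \<le> g n u" "g n u \<le> 1" by (simp_all add: g_def)
    qed
    have gm[measurable]: "g n \<in> borel_measurable borel" for n
      unfolding g_def[abs_def] by (intro borel_measurable_continuous_onI continuous_intros)
    have "(\<lambda>n. \<integral>u. \<bar>g n u - indicator C u\<bar> \<partial>\<rho>) \<longlonglongrightarrow> (\<integral>u. 0 \<partial>\<rho>)"
    proof (rule integral_dominated_convergence[where w="\<lambda>_. 1"])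
      show "AE u in \<rho>. (\<lambda>n. \<bar>g n u - indicator C u\<bar>) \<longlonglongrightarrow> 0"
      proof (rule AE_I2)
        fix u
        show "(\<lambda>n. \<bar>g n u - indicator C u\<bar>) \<longlonglongrightarrow> 0"
        proof (cases "u \<in> C")
          case True
          then show ?thesis by (simp add: g_def)
        next
          case nC: False
          then have "0 < infdist u C"
            using in_closed_iff_infdist_zero[OF compact_imp_closed[OF C(2)] False, of u] infdist_nonneg[of u C] by auto
          then obtain n0 :: nat where n0: "1 < real n0 * infdist u C" using ex_less_of_nat_mult by blast
          have "\<bar>g n u - indicator C u\<bar> = 0" if "n0 \<le> n" for n
          proof -
            have "real n0 * infdist u C \<le> real n * infdist u C" using that by (intro mult_right_mono) (auto simp: infdist_nonneg)
            then show ?thesis using n0 nC by (simp add: g_def)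
          qed
          then have "\<forall>\<^sub>F n in sequentially. \<bar>g n u - indicator C u\<bar> = 0" by (auto simp: eventually_sequentially)
          then show ?thesis by (rule tendsto_eventually)
        qed
      qed
      show "AE u in \<rho>. norm \<bar>g n u - indicator C u\<bar> \<le> 1" for n
        using abs_diff_indicator_le_1[OF g01] by (intro AE_I2) simp
    qed (auto simp: emeasure_eq_measure)
    then have "(\<lambda>n. \<integral>u. \<bar>g n u - indicator C u\<bar> \<partial>\<rho>) \<longlonglongrightarrow> 0" by simp
    from order_tendstoD(2)[OF this, of "\<epsilon> / 2"] \<epsilon> obtain n where n: "(\<integral>u. \<bar>g n u - indicator C u\<bar> \<partial>\<rho>) < \<epsilon> / 2"
      by (auto simp: eventually_sequentially)
    have b1: "integrable \<rho> (\<lambda>u. \<bar>g n u - indicator B u\<bar>)" if [measurable]: "B \<in> sets borel" for B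
      by (rule integrable_const_bound[of _ 1]) (simp_all add: abs_diff_indicator_le_1[OF g01])
    have b2: "integrable \<rho> (\<lambda>u. \<bar>indicator C u - indicator A u :: real\<bar>)"
      by (rule integrable_const_bound[of _ 1]) (auto simp: indicator_def)
    have "(\<integral>u. \<bar>g n u - indicator A u\<bar> \<partial>\<rho>) \<le> (\<integral>u. \<bar>g n u - indicator C u\<bar> + \<bar>indicator C u - indicator A u\<bar> \<partial>\<rho>)"
      by (intro integral_mono b1 b2 A Cb Bochner_Integration.integrable_add) linarith
    also have "\<dots> < \<epsilon>" using n cA by (simp add: Bochner_Integration.integral_add[OF b1[OF Cb] b2])
    finally show ?thesis using lip[of n] g01[of n] by (intro exI[of _ "g n"] exI[of _ "real n"]) auto
  qed
qed

text \<open>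
Up to a uniform error \<open>C / n\<close>, \<open>f\<close> is \<open>C / n\<close> times the number of \<open>k \<in> {1..n}\<close> with \<open>k C / n \<le> f\<close>, that is, a
sum of indicators of superlevel sets. Clamping to \<open>[1, C]\<close> does not increase the distance to \<open>f\<close>.
\<close>

lemma Lipschitz_approx:
  fixes \<rho> :: "real measure" and f :: "real \<Rightarrow> real"
  assumes \<rho>: "finite_measure \<rho>" "sets \<rho> = sets borel" and f: "f \<in> borel_measurable borel"
    and bd: "\<And>u. 1 \<le> f u" "\<And>u. f u \<le> C" and \<epsilon>: "0 < \<epsilon>"
  shows "\<exists>g L. 0 \<le> L \<and> (\<forall>u v. \<bar>g u - g v\<bar> \<le> L * \<bar>u - v\<bar>) \<and> (\<forall>u. 1 \<le> g u \<and> g u \<le> C) \<and> (\<integral>u. \<bar>g u - f u\<bar> \<partial>\<rho>) < \<epsilon>"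
proof -
  interpret finite_measure \<rho> by fact
  note [measurable_cong] = \<rho>(2)
  note [measurable] = f
  have C: "1 \<le> C" using bd[of 0] by simp
  define m where "m = measure \<rho> UNIV"
  have m: "0 \<le> m" by (simp add: m_def)
  obtain n :: nat where n: "2 * C * (m + 1) / \<epsilon> < real n" using reals_Archimedean2 by blast
  have n0: "0 < real n" using n C m \<epsilon> by (smt (verit) divide_nonneg_pos mult_nonneg_nonneg)
  define c where "c = C / real n"
  have c: "0 < c" using C n0 by (simp add: c_def)
  have cm: "c * m < \<epsilon> / 2"
  proof -
    have "2 * C * (m + 1) < \<epsilon> * real n" using n \<epsilon> by (simp add: pos_divide_less_eq mult.commute)
    then have "c * (m + 1) < \<epsilon> / 2" using n0 by (simp add: c_def field_simps)
    then show ?thesis using c by (simp add: distrib_left)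
  qed
  define A where "A k = {u. real k * c \<le> f u}" for k
  have A[measurable]: "A k \<in> sets borel" for k unfolding A_def by measurable
  have near: "\<bar>f u - c * (\<Sum>k=1..n. indicator (A k) u)\<bar> \<le> c" for u
  proof -
    define x where "x = f u / c"
    have x: "0 \<le> x" "x \<le> real n" using bd[of u] c n0 C by (auto simp: x_def c_def field_simps)
    have "(\<Sum>k=1..n. indicator (A k) u) = real (card {k\<in>{1..n}. real k \<le> x})"
      using c by (simp add: indicator_def A_def x_def pos_le_divide_eq sum.If_cases Int_def)
    also have "{k\<in>{1..n}. real k \<le> x} = {1..nat \<lfloor>x\<rfloor>}" using x by (auto simp: le_nat_floor nat_le_iff le_floor_iff) linarith+
    finally have s: "(\<Sum>k=1..n. indicator (A k) u) = real_of_int \<lfloor>x\<rfloor>" using x by simp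
    have "f u = c * x" using c by (simp add: x_def)
    then have "f u - c * (\<Sum>k=1..n. indicator (A k) u) = c * (x - \<lfloor>x\<rfloor>)" unfolding s by (simp add: algebra_simps)
    moreover have "\<bar>x - \<lfloor>x\<rfloor>\<bar> \<le> 1" by linarith
    ultimately show ?thesis using c mult_left_mono[of "\<bar>x - \<lfloor>x\<rfloor>\<bar>" 1 c] by (simp add: abs_mult)
  qed
  have "\<forall>k. \<exists>g. (\<exists>L. 0 \<le> L \<and> (\<forall>u v. \<bar>g u - g v\<bar> \<le> L * \<bar>u - v\<bar>)) \<and> (\<forall>u. 0 \<le> g u \<and> g u \<le> (1::real))
     \<and> (\<integral>u. \<bar>g u - indicator (A k) u\<bar> \<partial>\<rho>) < \<epsilon> / (2 * C)"
  proof
    fix k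
    have "0 < \<epsilon> / (2 * C)" using \<epsilon> C by simp
    from indicator_Lipschitz_approx[OF \<rho> A[of k] this]
    show "\<exists>g. (\<exists>L. 0 \<le> L \<and> (\<forall>u v. \<bar>g u - g v\<bar> \<le> L * \<bar>u - v\<bar>)) \<and> (\<forall>u. 0 \<le> g u \<and> g u \<le> (1::real))
     \<and> (\<integral>u. \<bar>g u - indicator (A k) u\<bar> \<partial>\<rho>) < \<epsilon> / (2 * C)" by (elim exE conjE) (intro exI conjI; assumption)
  qed
  from choice[OF this] obtain g where g0: "\<forall>k. (\<exists>L. 0 \<le> L \<and> (\<forall>u v. \<bar>g k u - g k v\<bar> \<le> L * \<bar>u - v\<bar>)) \<and> (\<forall>u. 0 \<le> g k u \<and> g k u \<le> (1::real))
     \<and> (\<integral>u. \<bar>g k u - indicator (A k) u\<bar> \<partial>\<rho>) < \<epsilon> / (2 * C)" ..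
  then have "\<forall>k. \<exists>L. 0 \<le> L \<and> (\<forall>u v. \<bar>g k u - g k v\<bar> \<le> L * \<bar>u - v\<bar>)" by simp
  from choice[OF this] obtain L where L: "\<And>k. 0 \<le> L k" "\<And>k u v. \<bar>g k u - g k v\<bar> \<le> L k * \<bar>u - v\<bar>" by auto
  have g01: "0 \<le> g k u" "g k u \<le> 1" for k u using g0 by auto
  have gi: "(\<integral>u. \<bar>g k u - indicator (A k) u\<bar> \<partial>\<rho>) < \<epsilon> / (2 * C)" for k using g0 by simp
  define G where "G u = c * (\<Sum>k=1..n. g k u)" for u
  define G' where "G' u = max 1 (min C (G u))" for u
  define LL where "LL = c * (\<Sum>k=1..n. L k)"
  have LL: "0 \<le> LL" unfolding LL_def using c L(1) by (intro mult_nonneg_nonneg sum_nonneg) auto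
  have Glip: "\<bar>G u - G v\<bar> \<le> LL * \<bar>u - v\<bar>" for u v
  proof -
    have "\<bar>G u - G v\<bar> = c * \<bar>\<Sum>k=1..n. g k u - g k v\<bar>" using c by (simp add: G_def sum_subtractf abs_mult flip: right_diff_distrib)
    also have "\<dots> \<le> c * (\<Sum>k=1..n. L k * \<bar>u - v\<bar>)"
      using c by (intro mult_left_mono order.trans[OF sum_abs sum_mono] L(2)) auto
    finally show ?thesis by (simp add: LL_def sum_distrib_right mult.assoc)
  qed
  have G'lip: "\<bar>G' u - G' v\<bar> \<le> LL * \<bar>u - v\<bar>" for u v
    using Glip[of u v] unfolding G'_def by linarith
  have gc: "continuous_on UNIV (g k)" for k
    by (rule lipschitz_on_continuous_on[of "L k"], rule lipschitz_onI) (use L in \<open>auto simp: dist_real_def\<close>)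
  have gm[measurable]: "g k \<in> borel_measurable borel" for k by (rule borel_measurable_continuous_onI[OF gc])
  have ig: "integrable \<rho> (\<lambda>u. \<bar>g k u - indicator (A k) u\<bar>)" for k
    by (rule integrable_const_bound[of _ 1]) (simp_all add: abs_diff_indicator_le_1[OF g01])
  have pt: "\<bar>G' u - f u\<bar> \<le> c + c * (\<Sum>k=1..n. \<bar>g k u - indicator (A k) u\<bar>)" for u
  proof -
    have "\<bar>G' u - f u\<bar> \<le> \<bar>G u - f u\<bar>" using bd[of u] C unfolding G'_def by linarith
    also have "\<dots> \<le> \<bar>G u - c * (\<Sum>k=1..n. indicator (A k) u)\<bar> + c" using near[of u] by linarith
    also have "\<bar>G u - c * (\<Sum>k=1..n. indicator (A k) u)\<bar> = c * \<bar>\<Sum>k=1..n. g k u - indicator (A k) u\<bar>"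
      using c by (simp add: G_def sum_subtractf abs_mult flip: right_diff_distrib)
    also have "\<dots> \<le> c * (\<Sum>k=1..n. \<bar>g k u - indicator (A k) u\<bar>)" using c by (intro mult_left_mono sum_abs) auto
    finally show ?thesis by simp
  qed
  have iG: "integrable \<rho> (\<lambda>u. \<bar>G' u - f u\<bar>)"
  proof (rule integrable_const_bound[of _ C])
    show "AE u in \<rho>. norm \<bar>G' u - f u\<bar> \<le> C" using bd C by (intro AE_I2) (simp add: G'_def abs_le_iff, smt (verit))
    show "(\<lambda>u. \<bar>G' u - f u\<bar>) \<in> borel_measurable \<rho>" unfolding G'_def G_def by measurable
  qed
  have "(\<integral>u. \<bar>G' u - f u\<bar> \<partial>\<rho>) \<le> (\<integral>u. c + c * (\<Sum>k=1..n. \<bar>g k u - indicator (A k) u\<bar>) \<partial>\<rho>)"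
    by (intro integral_mono iG pt Bochner_Integration.integrable_add integrable_mult_right Bochner_Integration.integrable_sum ig) (simp add: emeasure_eq_measure)
  also have "\<dots> = c * m + c * (\<Sum>k=1..n. \<integral>u. \<bar>g k u - indicator (A k) u\<bar> \<partial>\<rho>)"
    using sets_eq_imp_space_eq[OF \<rho>(2)]
    by (subst Bochner_Integration.integral_add) (auto intro!: integrable_mult_right Bochner_Integration.integrable_sum ig simp: m_def Bochner_Integration.integral_sum[OF ig] emeasure_eq_measure)
  also have "(\<Sum>k=1..n. \<integral>u. \<bar>g k u - indicator (A k) u\<bar> \<partial>\<rho>) \<le> (\<Sum>k=1..n. \<epsilon> / (2 * C))"
    by (intro sum_mono less_imp_le gi)
  also have "c * m + c * (\<Sum>k=1..n. \<epsilon> / (2 * C)) = c * m + \<epsilon> / 2" using n0 C by (simp add: c_def)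
  finally have "(\<integral>u. \<bar>G' u - f u\<bar> \<partial>\<rho>) < \<epsilon>" using c cm by (simp add: mult_left_mono)
  then show ?thesis using LL G'lip C by (intro exI[of _ G'] exI[of _ LL]) (auto simp: G'_def)
qed

section \<open>Coupling by a deterministic shift\<close>

definition dyadic_below :: "nat \<Rightarrow> real \<Rightarrow> real" where
  "dyadic_below n r = real_of_int \<lfloor>r * 2 ^ n\<rfloor> / 2 ^ n"

lemma dyadic_below_bounds: "0 \<le> r \<Longrightarrow> 0 \<le> dyadic_below n r" "dyadic_below n r \<le> r"
  by (auto simp: dyadic_below_def pos_divide_le_eq)

lemma dyadic_below_tendsto: "(\<lambda>n. dyadic_below n r) \<longlonglongrightarrow> r"
proof (rule real_tendsto_sandwich[OF _ _ _ tendsto_const])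
  have "r - (1/2) ^ n \<le> dyadic_below n r" for n
  proof -
    have "r * 2 ^ n - 1 \<le> real_of_int \<lfloor>r * 2 ^ n\<rfloor>" by linarith
    then have "(r * 2 ^ n - 1) / 2 ^ n \<le> dyadic_below n r" unfolding dyadic_below_def by (rule divide_right_mono) simp
    then show ?thesis by (simp add: diff_divide_distrib power_one_over)
  qed
  then show "\<forall>\<^sub>F n in sequentially. r - (1/2) ^ n \<le> dyadic_below n r" by simp
  show "\<forall>\<^sub>F n in sequentially. dyadic_below n r \<le> r" by (simp add: dyadic_below_bounds)
  have "(\<lambda>n. r - (1/2) ^ n) \<longlonglongrightarrow> r - 0" by (intro tendsto_diff tendsto_const LIMSEQ_power_zero) simp
  then show "(\<lambda>n. r - (1/2) ^ n) \<longlonglongrightarrow> r" by simp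
qed

text \<open>
Paths are continuous only outside a null set, which need not belong to the filtration. Taking limits
along the dyadic times before \<open>r\<close> gives a process that is defined everywhere, is progressively measurable,
and agrees with \<open>Z\<close> on the continuous paths.
\<close>

definition prog_version :: "(real \<Rightarrow> 'a \<Rightarrow> real) \<Rightarrow> real \<Rightarrow> 'a \<Rightarrow> real" where
  "prog_version Z r \<omega> = lim (\<lambda>n. Z (dyadic_below n r) \<omega>)"

lemma prog_version_eq:
  assumes Z: "continuous_on {0..T} (\<lambda>t. Z t \<omega>)" and r: "0 \<le> r" "r \<le> T"
  shows "prog_version Z r \<omega> = Z r \<omega>"
proof -
  have "dyadic_below n r \<in> {0..T}" for n using dyadic_below_bounds(1)[OF r(1), of n] dyadic_below_bounds(2)[of n r] r by simp
  then have "(\<lambda>n. Z (dyadic_below n r) \<omega>) \<longlonglongrightarrow> Z r \<omega>"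
    using r by (intro continuous_on_tendsto_compose[OF Z dyadic_below_tendsto]) auto
  then show ?thesis unfolding prog_version_def by (rule limI)
qed

text \<open>
On \<open>[0, \<sigma>]\<close> the approximations look at dyadic times before \<open>\<sigma>\<close> only, and there are countably many of them.
\<close>

lemma (in wiener_basis) prog_version_measurable:
  assumes Z: "\<And>t. 0 \<le> t \<Longrightarrow> t \<le> T \<Longrightarrow> Z t \<in> borel_measurable (F t)" and \<sigma>: "0 \<le> \<sigma>" "\<sigma> \<le> T"
  shows "\<exists>P \<in> borel_measurable (F \<sigma> \<Otimes>\<^sub>M borel). \<forall>r\<in>{0..\<sigma>}. \<forall>\<omega>. P (\<omega>, r) = prog_version Z r \<omega>"
proof
  define Zn where "Zn n x = (if 0 \<le> dyadic_below n (snd x) \<and> dyadic_below n (snd x) \<le> \<sigma> then Z (dyadic_below n (snd x)) (fst x) else 0)"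
    for n :: nat and x :: "'a \<times> real"
  have "Zn n \<in> borel_measurable (F \<sigma> \<Otimes>\<^sub>M borel)" for n
  proof -
    define f where "f k x = (if 0 \<le> real_of_int k / 2 ^ n \<and> real_of_int k / 2 ^ n \<le> \<sigma> then Z (real_of_int k / 2 ^ n) (fst x) else 0)"
      for k :: int and x :: "'a \<times> real"
    have f: "f k \<in> borel_measurable (F \<sigma> \<Otimes>\<^sub>M borel)" for k
    proof (cases "0 \<le> real_of_int k / 2 ^ n \<and> real_of_int k / 2 ^ n \<le> \<sigma>")
      case True
      have "Z (real_of_int k / 2 ^ n) \<in> borel_measurable (F \<sigma>)"
        by (rule measurable_from_subalg[OF F_subalg Z]) (use True \<sigma> in auto)
      then have "(\<lambda>x. Z (real_of_int k / 2 ^ n) (fst x)) \<in> borel_measurable (F \<sigma> \<Otimes>\<^sub>M (borel :: real measure))" by measurable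
      then show ?thesis unfolding f_def[abs_def] using True by simp
    next
      case False
      then have "f k = (\<lambda>_. 0)" by (auto simp: f_def)
      then show ?thesis by simp
    qed
    have "(\<lambda>x. f \<lfloor>snd x * 2 ^ n\<rfloor> x) \<in> borel_measurable (F \<sigma> \<Otimes>\<^sub>M borel)"
      by (rule measurable_compose_countable[OF f]) measurable
    then show ?thesis unfolding f_def Zn_def[abs_def] dyadic_below_def .
  qed
  then show "(\<lambda>x. lim (\<lambda>n. Zn n x)) \<in> borel_measurable (F \<sigma> \<Otimes>\<^sub>M borel)" by (rule borel_measurable_lim_metric)
  show "\<forall>r\<in>{0..\<sigma>}. \<forall>\<omega>. lim (\<lambda>n. Zn n (\<omega>, r)) = prog_version Z r \<omega>"
  proof (intro ballI allI)
    fix r \<omega> assume "r \<in> {0..\<sigma>}"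
    then have "0 \<le> dyadic_below n r \<and> dyadic_below n r \<le> \<sigma>" for n
      using dyadic_below_bounds(1)[of r n] dyadic_below_bounds(2)[of n r] by simp
    then have "Zn n (\<omega>, r) = Z (dyadic_below n r) \<omega>" for n by (simp add: Zn_def)
    then show "lim (\<lambda>n. Zn n (\<omega>, r)) = prog_version Z r \<omega>" by (simp add: prog_version_def)
  qed
qed

lemma (in lipschitz_drift) euler_cong:
  "(\<And>j. j \<le> i \<Longrightarrow> z j = z' j) \<Longrightarrow> euler N y z i = euler N y z' i"
  by (induction i) auto

text \<open>
Two solutions of the same equation. The first is shifted to the starting point of the second, and the
drift that this creates has to be adapted; of the second only the value at time \<open>T\<close> is compared.
\<close>

locale fbm_sde = wiener_basis M F T W + lipschitz_drift T K B0 b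
  for M :: "'a measure" and F T W K B0 b +
  fixes H x y :: real and B X Y :: "real \<Rightarrow> 'a \<Rightarrow> real"
  assumes H: "0 < H" "H < 1/2"
    and B: "\<And>t. 0 \<le> t \<Longrightarrow> t \<le> T \<Longrightarrow> has_wiener_integral M W t (fbm_kernel H t) (B t)"
    and X_adapted: "\<And>t. 0 \<le> t \<Longrightarrow> t \<le> T \<Longrightarrow> X t \<in> borel_measurable (F t)"
    and X_cont: "AE \<omega> in M. continuous_on {0..T} (\<lambda>t. X t \<omega>)"
    and X_eq: "AE \<omega> in M. \<forall>t\<in>{0..T}. X t \<omega> = x + (LBINT s:{0..t}. b s (X s \<omega>)) + B t \<omega>"
    and Y_meas: "Y T \<in> borel_measurable M"
    and Y_cont: "AE \<omega> in M. continuous_on {0..T} (\<lambda>t. Y t \<omega>)"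
    and Y_eq: "AE \<omega> in M. \<forall>t\<in>{0..T}. Y t \<omega> = y + (LBINT s:{0..t}. b s (Y s \<omega>)) + B t \<omega>"
begin

definition D :: real where "D = exp (K * T) - 1"

lemma D_pos: "0 < D" using K T by (simp add: D_def)

text \<open>
The function \<open>h\<close> with \<open>h(0) = x - y\<close>, \<open>h(T) = 0\<close> and \<open>K h - h'\<close> constant. Subtracting it from \<open>X\<close> changes the
drift by at most \<open>K \<bar>h\<bar> + \<bar>h'\<bar>\<close>, which is the constant \<open>\<eta>\<close> below.
\<close>

definition shift :: "real \<Rightarrow> real" where
  "shift r = (x - y) * ((exp (K * T) - exp (K * r)) / D)"

definition shift' :: "real \<Rightarrow> real" where
  "shift' r = - ((x - y) * (K * exp (K * r) / D))"

definition \<eta> :: real where "\<eta> = \<bar>x - y\<bar> * (K * exp (K * T) / D)"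

definition g :: "real \<Rightarrow> 'a \<Rightarrow> real" where
  "g r \<omega> = (if \<omega> \<in> space M \<and> 0 \<le> r \<and> r \<le> T
     then b r (prog_version X r \<omega>) - b r (prog_version X r \<omega> - shift r) - shift' r else 0)"

lemma shift_0: "shift 0 = x - y"
proof -
  have "exp (K * T) - exp (K * 0) = D" by (simp add: D_def)
  then show ?thesis using D_pos unfolding shift_def by simp
qed

lemma shift_T: "shift T = 0" by (simp add: shift_def)

lemma shift_deriv: "(shift has_real_derivative shift' r) (at r)"
  unfolding shift_def[abs_def] shift'_def using D_pos by (auto intro!: derivative_eq_intros)

lemma shift_continuous: "continuous_on S shift"
  unfolding shift_def[abs_def] by (intro continuous_intros) (use D_pos in auto)

lemma shift'_continuous: "continuous_on S shift'"
  unfolding shift'_def[abs_def] by (intro continuous_intros) (use D_pos in auto)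

lemma shift_measurable[measurable]: "shift \<in> borel_measurable borel" "shift' \<in> borel_measurable borel"
  by (auto intro: borel_measurable_continuous_onI shift_continuous shift'_continuous)

lemma \<eta>_nonneg: "0 \<le> \<eta>" using K D_pos by (simp add: \<eta>_def)

lemma g_bound: "\<bar>g r \<omega>\<bar> \<le> \<eta>"
proof (cases "\<omega> \<in> space M \<and> 0 \<le> r \<and> r \<le> T")
  case True
  have e: "0 \<le> exp (K * T) - exp (K * r)" using True K by simp
  have "\<bar>g r \<omega>\<bar> \<le> \<bar>b r (prog_version X r \<omega>) - b r (prog_version X r \<omega> - shift r)\<bar> + \<bar>shift' r\<bar>"
    using True by (simp add: g_def)
  also have "\<dots> \<le> K * \<bar>shift r\<bar> + \<bar>shift' r\<bar>" using b_lip[of r "prog_version X r \<omega>" "prog_version X r \<omega> - shift r"] by simp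
  also have "\<bar>shift r\<bar> = \<bar>x - y\<bar> * ((exp (K * T) - exp (K * r)) / D)" using e D_pos by (simp add: shift_def abs_mult)
  also have "\<bar>shift' r\<bar> = \<bar>x - y\<bar> * (K * exp (K * r) / D)" using K D_pos by (simp add: shift'_def abs_mult)
  also have "K * (\<bar>x - y\<bar> * ((exp (K * T) - exp (K * r)) / D)) + \<bar>x - y\<bar> * (K * exp (K * r) / D) = \<eta>"
    using D_pos by (simp add: \<eta>_def field_simps)
  finally show ?thesis .
qed (auto simp: g_def \<eta>_nonneg)

lemma frac_drift: "frac_drift M F T W H g \<eta>"
proof unfold_locales
  show "0 < H" "H < 1/2" by (fact H)+
  show "\<bar>g r \<omega>\<bar> \<le> \<eta>" for r \<omega> by (rule g_bound)
  show "g r \<omega> = 0" if "\<omega> \<notin> space M" for r \<omega> using that by (simp add: g_def)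
  fix \<sigma> assume \<sigma>: "0 \<le> \<sigma>" "\<sigma> \<le> T"
  obtain P where P[measurable]: "P \<in> borel_measurable (F \<sigma> \<Otimes>\<^sub>M borel)" and PX: "\<And>r \<omega>. r \<in> {0..\<sigma>} \<Longrightarrow> P (\<omega>, r) = prog_version X r \<omega>"
    using prog_version_measurable[OF X_adapted \<sigma>] by blast
  have [measurable]: "(\<lambda>z. b (snd z) (P z)) \<in> borel_measurable (F \<sigma> \<Otimes>\<^sub>M borel)"
    using measurable_compose[OF measurable_Pair[OF measurable_snd P] b_meas] by simp
  have [measurable]: "(\<lambda>z. b (snd z) (P z - shift (snd z))) \<in> borel_measurable (F \<sigma> \<Otimes>\<^sub>M borel)"
  proof -
    have "(\<lambda>z. P z - shift (snd z)) \<in> borel_measurable (F \<sigma> \<Otimes>\<^sub>M borel)" by measurable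
    from measurable_compose[OF measurable_Pair[OF measurable_snd this] b_meas] show ?thesis by simp
  qed
  have "(\<lambda>z. indicator {0..\<sigma>} (snd z) * (b (snd z) (P z) - b (snd z) (P z - shift (snd z)) - shift' (snd z))) \<in> borel_measurable (F \<sigma> \<Otimes>\<^sub>M borel)"
    by measurable
  moreover have "indicator {0..\<sigma>} (snd z) * g (snd z) (fst z) = indicator {0..\<sigma>} (snd z) * (b (snd z) (P z) - b (snd z) (P z - shift (snd z)) - shift' (snd z))"
    if "z \<in> space (F \<sigma> \<Otimes>\<^sub>M borel)" for z
  proof (cases "snd z \<in> {0..\<sigma>}")
    case True
    have "fst z \<in> space M" using that by (auto simp: space_pair_measure F_space)
    then show ?thesis using True \<sigma> PX[OF True, of "fst z"] by (simp add: g_def)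
  qed simp
  ultimately show "(\<lambda>z. indicator {0..\<sigma>} (snd z) * g (snd z) (fst z)) \<in> borel_measurable (F \<sigma> \<Otimes>\<^sub>M borel)"
    by (subst measurable_cong)
qed

lemma path_extension:
  assumes "continuous_on {0..T} Z"
  obtains Z' where "continuous_on UNIV Z'" "\<And>t. t \<in> {0..T} \<Longrightarrow> Z' t = (Z t :: real)"
proof (rule that[of "\<lambda>t. Z (max 0 (min T t))"])
  show "continuous_on UNIV (\<lambda>t. Z (max 0 (min T t)))"
    by (rule continuous_on_compose2[OF assms]) (use T in \<open>auto intro!: continuous_intros\<close>)
qed auto

lemma path_integrable:
  assumes Z: "continuous_on UNIV Z" and t: "t \<in> {0..T}"
  shows "set_integrable lborel {0..t} (\<lambda>s. b s (Z s))"
proof -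
  have "bounded (Z ` {0..T})"
    by (intro compact_imp_bounded compact_continuous_image continuous_on_subset[OF Z]) auto
  then obtain C where "\<forall>z\<in>Z ` {0..T}. norm z \<le> C" unfolding bounded_iff by blast
  then have "\<bar>Z s\<bar> \<le> C" if "s \<in> {0..t}" for s using that t by simp
  then show ?thesis by (intro b_comp_integrable[OF borel_measurable_continuous_onI[OF Z], of _ C 0 T]) (use t in auto)
qed

lemma unshifted_euler_limit:
  "AE \<omega> in M. (\<lambda>n. euler (Suc n) y (\<lambda>j. B (real j * (T / real (Suc n))) \<omega>) (Suc n)) \<longlonglongrightarrow> Y T \<omega>"
  using Y_cont Y_eq
proof eventually_elim
  case (elim \<omega>)
  obtain Z where Z: "continuous_on UNIV Z" "\<And>t. t \<in> {0..T} \<Longrightarrow> Z t = Y t \<omega>"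
    by (rule path_extension[OF elim(1)]) (rule that)
  have "Z t = y + (LBINT s:{0..t}. b s (Z s)) + B t \<omega>" if t: "t \<in> {0..T}" for t
  proof -
    have "(LBINT s:{0..t}. b s (Z s)) = (LBINT s:{0..t}. b s (Y s \<omega>))"
      by (rule set_lebesgue_integral_cong) (use Z(2) t in auto)
    then show ?thesis using Z(2)[OF t] bspec[OF elim(2) t] by simp
  qed
  from euler_converges[OF Z(1) this] show ?case using Z(2)[of T] T by simp
qed

text \<open>
The process \<open>X - shift\<close> solves the equation from \<open>y\<close> with noise \<open>B + \<integral>g\<close>. As the shift vanishes at time \<open>T\<close>,
the Euler scheme from \<open>y\<close>, fed with this noise, converges to \<open>X T\<close>.
\<close>

lemma shifted_euler_limit:
  "AE \<omega> in M. (\<lambda>n. euler (Suc n) y (\<lambda>j. B (real j * (T / real (Suc n))) \<omega> + (LBINT r:{0..real j * (T / real (Suc n))}. g r \<omega>)) (Suc n)) \<longlonglongrightarrow> X T \<omega>"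
  using X_cont X_eq AE_space
proof eventually_elim
  case (elim \<omega>)
  obtain Z where Z: "continuous_on UNIV Z" "\<And>t. t \<in> {0..T} \<Longrightarrow> Z t = X t \<omega>"
    by (rule path_extension[OF elim(1)]) (rule that)
  define V where "V s = Z s - shift s" for s
  have V: "continuous_on UNIV V" unfolding V_def by (intro continuous_on_diff Z shift_continuous)
  have "V t = y + (LBINT s:{0..t}. b s (V s)) + (B t \<omega> + (LBINT r:{0..t}. g r \<omega>))" if t: "t \<in> {0..T}" for t
  proof -
    \<comment> \<open>By the fundamental theorem of calculus, \<open>\<integral>g\<close> is the difference of the two integrated drifts minus the increment of the shift.\<close>
    have s': "set_integrable lborel {0..t} shift'"
      by (rule borel_integrable_compact[OF compact_Icc shift'_continuous, folded set_integrable_def])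
    have "(LBINT r:{0..t}. g r \<omega>) = (LBINT r:{0..t}. (b r (Z r) - b r (V r)) - shift' r)"
    proof (rule set_lebesgue_integral_cong)
      show "\<forall>r. r \<in> {0..t} \<longrightarrow> g r \<omega> = (b r (Z r) - b r (V r)) - shift' r"
      proof (intro allI impI)
        fix r assume "r \<in> {0..t}"
        then have r: "r \<in> {0..T}" using t by simp
        then show "g r \<omega> = (b r (Z r) - b r (V r)) - shift' r"
          using elim(3) Z(2)[OF r] prog_version_eq[where T=T and Z=X and \<omega>=\<omega> and r=r, OF elim(1)] by (simp add: g_def V_def)
      qed
    qed simp
    also have "\<dots> = ((LBINT r:{0..t}. b r (Z r)) - (LBINT r:{0..t}. b r (V r))) - (LBINT r:{0..t}. shift' r)"
      by (simp only: set_integral_diff(2)[OF set_integral_diff(1)[OF path_integrable[OF Z(1) t] path_integrable[OF V t]] s']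
          set_integral_diff(2)[OF path_integrable[OF Z(1) t] path_integrable[OF V t]])
    also have "(LBINT r:{0..t}. b r (Z r)) = (LBINT r:{0..t}. b r (X r \<omega>))"
      by (rule set_lebesgue_integral_cong) (use Z(2) t in auto)
    also have "(LBINT r:{0..t}. shift' r) = shift t - shift 0"
    proof -
      have "(\<integral>r. shift' r * indicator {0..t} r \<partial>lborel) = shift t - shift 0"
        by (rule integral_FTC_Icc_real) (use t shift_deriv shift'_continuous[of UNIV] in \<open>auto simp: continuous_on_eq_continuous_at\<close>)
      then show ?thesis by (simp add: set_lebesgue_integral_def mult.commute)
    qed
    finally show ?thesis using bspec[OF elim(2) t] Z(2)[OF t] shift_0 V_def[of t] by linarith
  qed
  from euler_converges[OF V this] show ?case using Z(2)[of T] T shift_T by (simp add: V_def)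
qed

text \<open>
The scheme with \<open>n + 1\<close> cells depends on \<open>n + 2\<close> values of the noise, which are Wiener integrals;
\<open>wiener_shift_log\<close> compares it with its shifted version at a cost that is independent of \<open>n\<close>.
\<close>

lemma log_harnack_Lipschitz:
  fixes f :: "real \<Rightarrow> real"
  assumes f: "\<And>u. 1 \<le> f u" "\<And>u. f u \<le> C" and Lip: "\<And>u v. \<bar>f u - f v\<bar> \<le> L * \<bar>u - v\<bar>" and L: "0 \<le> L"
  shows "(\<integral>\<omega>. ln (f (X T \<omega>)) \<partial>M) \<le> ln (\<integral>\<omega>. f (Y T \<omega>) \<partial>M) + \<eta>\<^sup>2 * (frac_const H)\<^sup>2 * T powr (2 - 2 * H) / (2 - 2 * H) / 2"
proof -
  interpret FD: frac_drift M F T W H g \<eta> by (rule frac_drift)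
  have fc: "continuous_on UNIV f"
    by (rule lipschitz_on_continuous_on[of L], rule lipschitz_onI) (use Lip L in \<open>auto simp: dist_real_def\<close>)
  have fm[measurable]: "f \<in> borel_measurable borel" by (rule borel_measurable_continuous_onI[OF fc])
  have C: "1 \<le> C" using f[of 0] by simp
  define \<tau> where "\<tau> n j = real j * (T / real (Suc n))" for n j
  have \<tau>: "0 \<le> \<tau> n j \<and> \<tau> n j \<le> T" if "j < Suc (Suc n)" for n j
  proof -
    have "real j * (T / real (Suc n)) \<le> real (Suc n) * (T / real (Suc n))" using that T by (intro mult_right_mono) auto
    then show ?thesis using T by (simp add: \<tau>_def)
  qed
  define \<Gamma> where "\<Gamma> n z = f (euler (Suc n) y z (Suc n))" for n z
  define A where "A n j \<omega> = (LBINT r:{0..\<tau> n j}. g r \<omega>)" for n j \<omega>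
  define V1 where "V1 n \<omega> = (\<lambda>j. if j < Suc (Suc n) then B (\<tau> n j) \<omega> + A n j \<omega> else 0)" for n \<omega>
  define V0 where "V0 n \<omega> = (\<lambda>j. if j < Suc (Suc n) then B (\<tau> n j) \<omega> else 0)" for n \<omega>
  have \<Gamma>m: "\<Gamma> n \<in> borel_measurable seq_space" for n
    unfolding \<Gamma>_def by (rule measurable_compose[OF euler_measurable fm])
  have Bm: "B (\<tau> n j) \<in> borel_measurable M" if "j < Suc (Suc n)" for n j
    using B[of "\<tau> n j"] \<tau>[OF that] by (simp add: has_wiener_integral_def)
  have Km: "fbm_kernel H (\<tau> n j) \<in> borel_measurable (restrict_space lborel {0..\<tau> n j})" if "j < Suc (Suc n)" for n j
    using B[of "\<tau> n j"] \<tau>[OF that] by (simp add: has_wiener_integral_def)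
  have Am: "A n j \<in> borel_measurable M" if "j < Suc (Suc n)" for n j
    unfolding A_def[abs_def] using FD.g_integral_measurable[of "\<tau> n j"] \<tau>[OF that] by simp
  have step: "(\<integral>\<omega>. ln (\<Gamma> n (V1 n \<omega>)) \<partial>M) \<le> ln (\<integral>\<omega>. \<Gamma> n (V0 n \<omega>) \<partial>M) + (FD.energy T - FD.energy 0) / 2" for n
  proof -
    obtain L' where L': "0 \<le> L'" "\<And>z z'. \<bar>euler (Suc n) y z (Suc n) - euler (Suc n) y z' (Suc n)\<bar> \<le> L' * (\<Sum>j\<le>Suc n. \<bar>z j - z' j\<bar>)"
      using euler_lip[of "Suc n" y "Suc n"] by blast
    show ?thesis unfolding V1_def V0_def
    proof (rule adapted_drift.wiener_shift_log[OF FD.adapted_drift, where L="L * L'" and C=C and \<tau>="\<tau> n" and \<phi>="\<lambda>j. fbm_kernel H (\<tau> n j)"])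
      fix j \<omega> assume j: "j < Suc (Suc n)"
      show "A n j \<omega> = (LBINT s:{0..\<tau> n j}. fbm_kernel H (\<tau> n j) s * FD.lift s \<omega>)"
        unfolding A_def by (rule FD.kernel_integral[OF _ _ Km[OF j], symmetric]) (use \<tau>[OF j] in auto)
    next
      fix z z'
      have "\<bar>\<Gamma> n z - \<Gamma> n z'\<bar> \<le> L * \<bar>euler (Suc n) y z (Suc n) - euler (Suc n) y z' (Suc n)\<bar>"
        unfolding \<Gamma>_def by (rule Lip)
      also have "\<dots> \<le> L * (L' * (\<Sum>j\<le>Suc n. \<bar>z j - z' j\<bar>))" using L'(2) L by (rule mult_left_mono)
      also have "\<dots> = L * L' * (\<Sum>j<Suc (Suc n). \<bar>z j - z' j\<bar>)" unfolding lessThan_Suc_atMost by (simp only: mult.assoc)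
      finally show "\<bar>\<Gamma> n z - \<Gamma> n z'\<bar> \<le> L * L' * (\<Sum>j<Suc (Suc n). \<bar>z j - z' j\<bar>)" .
    next
      show "0 \<le> \<tau> n j \<and> \<tau> n j \<le> T" if "j < Suc (Suc n)" for j by (rule \<tau>[OF that])
      show "has_wiener_integral M W (\<tau> n j) (fbm_kernel H (\<tau> n j)) (B (\<tau> n j))" if "j < Suc (Suc n)" for j
        using \<tau>[OF that] by (intro B) auto
      show "A n j \<in> borel_measurable M" if "j < Suc (Suc n)" for j by (rule Am[OF that])
      show "\<Gamma> n \<in> borel_measurable seq_space" by (rule \<Gamma>m)
      show "1 \<le> \<Gamma> n z" "\<Gamma> n z \<le> C" for z unfolding \<Gamma>_def by (rule f)+
      show "0 \<le> L * L'" using L L'(1) by simp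
    qed
  qed
  have seqm: "(\<lambda>\<omega> j. if j < Suc (Suc n) then U j \<omega> else 0) \<in> measurable M seq_space"
    if "\<And>j. j < Suc (Suc n) \<Longrightarrow> U j \<in> borel_measurable M" for n and U :: "nat \<Rightarrow> 'a \<Rightarrow> real"
    unfolding measurable_seq_space_iff
  proof
    fix j show "(\<lambda>\<omega>. if j < Suc (Suc n) then U j \<omega> else 0) \<in> borel_measurable M" using that[of j] by (cases "j < Suc (Suc n)") auto
  qed
  have m1: "(\<lambda>\<omega>. \<Gamma> n (V1 n \<omega>)) \<in> borel_measurable M" for n
    unfolding V1_def by (rule measurable_compose[OF seqm \<Gamma>m]) (intro borel_measurable_add Bm Am)
  have m0: "(\<lambda>\<omega>. \<Gamma> n (V0 n \<omega>)) \<in> borel_measurable M" for n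
    unfolding V0_def by (rule measurable_compose[OF seqm \<Gamma>m]) (rule Bm)
  have XT: "X T \<in> borel_measurable M" using measurable_from_subalg[OF sub X_adapted[of T]] T by simp
  note [measurable] = XT Y_meas m0 m1
  have eu1: "\<Gamma> n (V1 n \<omega>) = f (euler (Suc n) y (\<lambda>j. B (real j * (T / real (Suc n))) \<omega> + (LBINT r:{0..real j * (T / real (Suc n))}. g r \<omega>)) (Suc n))" for n \<omega>
    unfolding \<Gamma>_def by (rule arg_cong[of _ _ f], rule euler_cong) (simp add: V1_def A_def \<tau>_def)
  have eu0: "\<Gamma> n (V0 n \<omega>) = f (euler (Suc n) y (\<lambda>j. B (real j * (T / real (Suc n))) \<omega>) (Suc n))" for n \<omega>
    unfolding \<Gamma>_def by (rule arg_cong[of _ _ f], rule euler_cong) (simp add: V0_def \<tau>_def)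
  have fcont: "isCont f u" for u using fc by (simp add: continuous_on_eq_continuous_at)
  have fb: "\<bar>f u\<bar> \<le> C" "\<bar>ln (f u)\<bar> \<le> ln C" for u
  proof -
    show "\<bar>f u\<bar> \<le> C" using f[of u] by simp
    show "\<bar>ln (f u)\<bar> \<le> ln C" by (rule abs_ln_le[OF f])
  qed
  have lim1: "(\<lambda>n. \<integral>\<omega>. ln (\<Gamma> n (V1 n \<omega>)) \<partial>M) \<longlonglongrightarrow> (\<integral>\<omega>. ln (f (X T \<omega>)) \<partial>M)"
  proof (rule integral_dominated_convergence[where w="\<lambda>_. ln C"])
    show "AE \<omega> in M. (\<lambda>n. ln (\<Gamma> n (V1 n \<omega>))) \<longlonglongrightarrow> ln (f (X T \<omega>))"
      using shifted_euler_limit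
    proof eventually_elim
      case (elim \<omega>)
      show ?case unfolding eu1
        by (intro tendsto_ln isCont_tendsto_compose[OF fcont elim]) (use f(1)[of "X T \<omega>"] in linarith)
    qed
    show "(\<lambda>\<omega>. ln (\<Gamma> n (V1 n \<omega>))) \<in> borel_measurable M" for n by measurable
    show "AE \<omega> in M. norm (ln (\<Gamma> n (V1 n \<omega>))) \<le> ln C" for n unfolding \<Gamma>_def real_norm_def by (rule AE_I2) (rule fb)
  qed simp_all
  have lim0: "(\<lambda>n. \<integral>\<omega>. \<Gamma> n (V0 n \<omega>) \<partial>M) \<longlonglongrightarrow> (\<integral>\<omega>. f (Y T \<omega>) \<partial>M)"
  proof (rule integral_dominated_convergence[where w="\<lambda>_. C"])
    show "AE \<omega> in M. (\<lambda>n. \<Gamma> n (V0 n \<omega>)) \<longlonglongrightarrow> f (Y T \<omega>)"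
      using unshifted_euler_limit
    proof eventually_elim
      case (elim \<omega>)
      show ?case unfolding eu0 by (rule isCont_tendsto_compose[OF fcont elim])
    qed
    show "AE \<omega> in M. norm (\<Gamma> n (V0 n \<omega>)) \<le> C" for n unfolding \<Gamma>_def real_norm_def by (rule AE_I2) (rule fb)
  qed simp_all
  have "1 \<le> (\<integral>\<omega>. f (Y T \<omega>) \<partial>M)"
  proof -
    have "integrable M (\<lambda>\<omega>. f (Y T \<omega>))" by (rule integrable_const_bound[of _ C]) (auto simp: fb)
    from integral_mono[OF integrable_const[of 1] this f(1)] show ?thesis by (simp add: prob_space)
  qed
  then have "(\<lambda>n. ln (\<integral>\<omega>. \<Gamma> n (V0 n \<omega>) \<partial>M) + (FD.energy T - FD.energy 0) / 2) \<longlonglongrightarrow> ln (\<integral>\<omega>. f (Y T \<omega>) \<partial>M) + (FD.energy T - FD.energy 0) / 2"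
    by (intro tendsto_add tendsto_ln lim0 tendsto_const) simp
  from LIMSEQ_le[OF lim1 this] step show ?thesis unfolding FD.energy_T by blast
qed

text \<open>
The approximation has to be good under the laws of \<open>X T\<close> and \<open>Y T\<close> simultaneously. Twice their mean is the
image of the product of \<open>M\<close> with the counting measure on \<^typ>\<open>bool\<close>.
\<close>

lemma log_harnack_measurable:
  fixes f :: "real \<Rightarrow> real"
  assumes fm: "f \<in> borel_measurable borel" and f: "\<And>u. 1 \<le> f u" "\<And>u. f u \<le> C"
  shows "(\<integral>\<omega>. ln (f (X T \<omega>)) \<partial>M) \<le> ln (\<integral>\<omega>. f (Y T \<omega>) \<partial>M) + \<eta>\<^sup>2 * (frac_const H)\<^sup>2 * T powr (2 - 2 * H) / (2 - 2 * H) / 2"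
    (is "?I \<le> ln ?J + ?q")
proof (rule field_le_epsilon)
  fix e :: real assume e: "0 < e"
  have XT: "X T \<in> borel_measurable M" using measurable_from_subalg[OF sub X_adapted[of T]] T by simp
  note [measurable] = XT Y_meas fm
  define P where "P = (count_space UNIV :: bool measure) \<Otimes>\<^sub>M M"
  define Z where "Z p = (if fst p then X T (snd p) else Y T (snd p))" for p :: "bool \<times> 'a"
  have Zm[measurable]: "Z \<in> borel_measurable P" unfolding P_def Z_def by measurable
  have finP: "finite_measure P" unfolding P_def
    by (rule finite_measure_pair_measure) (unfold_locales, auto intro: finite_measure_count_space)
  interpret P: finite_measure P by fact
  interpret CM: pair_sigma_finite "count_space UNIV :: bool measure" M
    by unfold_locales (auto intro: sigma_finite_measure_count_space)
  define \<rho> where "\<rho> = distr P borel Z"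
  have \<rho>: "finite_measure \<rho>" "sets \<rho> = sets borel" unfolding \<rho>_def by (auto intro: P.finite_measure_distr)
  have "0 < e / 2" using e by simp
  from Lipschitz_approx[OF \<rho> fm f this]
  obtain h L where hL: "0 \<le> L \<and> (\<forall>u v. \<bar>h u - h v\<bar> \<le> L * \<bar>u - v\<bar>) \<and> (\<forall>u. 1 \<le> h u \<and> h u \<le> C) \<and> (\<integral>u. \<bar>h u - f u\<bar> \<partial>\<rho>) < e / 2"
    by (elim exE) (rule that)
  have L: "0 \<le> L" and Lip: "\<And>u v. \<bar>h u - h v\<bar> \<le> L * \<bar>u - v\<bar>" and h: "\<And>u. 1 \<le> h u" "\<And>u. h u \<le> C"
    and close: "(\<integral>u. \<bar>h u - f u\<bar> \<partial>\<rho>) < e / 2"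
    using hL by simp_all
  have hc: "continuous_on UNIV h"
    by (rule lipschitz_on_continuous_on[of L], rule lipschitz_onI) (use Lip L in \<open>auto simp: dist_real_def\<close>)
  have hm[measurable]: "h \<in> borel_measurable borel" by (rule borel_measurable_continuous_onI[OF hc])
  have C: "0 \<le> C" using f[of 0] by simp
  have db: "norm \<bar>h u - f u\<bar> \<le> C" for u using h[of u] f[of u] by simp
  have iP: "integrable P (\<lambda>p. \<bar>h (Z p) - f (Z p)\<bar>)" by (rule P.integrable_const_bound[of _ C]) (use db in auto)
  have "(\<integral>u. \<bar>h u - f u\<bar> \<partial>\<rho>) = (\<integral>p. \<bar>h (Z p) - f (Z p)\<bar> \<partial>P)"
    unfolding \<rho>_def by (subst integral_distr) auto
  also have "\<dots> = (\<integral>i. (\<integral>\<omega>. \<bar>h (Z (i, \<omega>)) - f (Z (i, \<omega>))\<bar> \<partial>M) \<partial>count_space UNIV)"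
    using CM.integral_fst'[OF iP[unfolded P_def]] by (simp add: P_def)
  also have "\<dots> = (\<integral>\<omega>. \<bar>h (X T \<omega>) - f (X T \<omega>)\<bar> \<partial>M) + (\<integral>\<omega>. \<bar>h (Y T \<omega>) - f (Y T \<omega>)\<bar> \<partial>M)"
    by (subst lebesgue_integral_count_space_finite) (auto simp: UNIV_bool Z_def)
  finally have sum: "(\<integral>\<omega>. \<bar>h (X T \<omega>) - f (X T \<omega>)\<bar> \<partial>M) + (\<integral>\<omega>. \<bar>h (Y T \<omega>) - f (Y T \<omega>)\<bar> \<partial>M) < e / 2"
    using close by simp
  have nn: "0 \<le> (\<integral>\<omega>. \<bar>h (X T \<omega>) - f (X T \<omega>)\<bar> \<partial>M)" "0 \<le> (\<integral>\<omega>. \<bar>h (Y T \<omega>) - f (Y T \<omega>)\<bar> \<partial>M)" by auto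
  have i1: "integrable M (\<lambda>\<omega>. ln (f (X T \<omega>)))" by (rule integrable_const_bound[of _ "ln C"]) (simp_all add: abs_ln_le[OF f(1) f(2)])
  have i2: "integrable M (\<lambda>\<omega>. ln (h (X T \<omega>)))" by (rule integrable_const_bound[of _ "ln C"]) (simp_all add: abs_ln_le[OF h(1) h(2)])
  have i3: "integrable M (\<lambda>\<omega>. \<bar>h (X T \<omega>) - f (X T \<omega>)\<bar>)" by (rule integrable_const_bound[of _ C]) (use db in auto)
  have i4: "integrable M (\<lambda>\<omega>. \<bar>h (Y T \<omega>) - f (Y T \<omega>)\<bar>)" by (rule integrable_const_bound[of _ C]) (use db in auto)
  have fn: "norm (f u) \<le> C" "norm (h u) \<le> C" for u using f[of u] h[of u] by auto
  have i5: "integrable M (\<lambda>\<omega>. f (Y T \<omega>))" by (rule integrable_const_bound[of _ C]) (use fn in auto)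
  have i6: "integrable M (\<lambda>\<omega>. h (Y T \<omega>))" by (rule integrable_const_bound[of _ C]) (use fn in auto)
  have J1: "1 \<le> ?J" using integral_mono[OF integrable_const[of 1] i5 f(1)] by (simp add: prob_space)
  have J2: "1 \<le> (\<integral>\<omega>. h (Y T \<omega>) \<partial>M)" using integral_mono[OF integrable_const[of 1] i6 h(1)] by (simp add: prob_space)
  have "?I \<le> (\<integral>\<omega>. ln (h (X T \<omega>)) + \<bar>h (X T \<omega>) - f (X T \<omega>)\<bar> \<partial>M)"
  proof (intro integral_mono i1 Bochner_Integration.integrable_add i2 i3)
    fix \<omega>
    show "ln (f (X T \<omega>)) \<le> ln (h (X T \<omega>)) + \<bar>h (X T \<omega>) - f (X T \<omega>)\<bar>"
      using ln_Lipschitz[OF h(1) f(1), of "X T \<omega>" "X T \<omega>"] by linarith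
  qed
  also have "\<dots> = (\<integral>\<omega>. ln (h (X T \<omega>)) \<partial>M) + (\<integral>\<omega>. \<bar>h (X T \<omega>) - f (X T \<omega>)\<bar> \<partial>M)"
    by (rule Bochner_Integration.integral_add[OF i2 i3])
  also have "(\<integral>\<omega>. ln (h (X T \<omega>)) \<partial>M) \<le> ln (\<integral>\<omega>. h (Y T \<omega>) \<partial>M) + ?q"
    by (rule log_harnack_Lipschitz[OF h Lip L])
  also have "ln (\<integral>\<omega>. h (Y T \<omega>) \<partial>M) \<le> ln ?J + (\<integral>\<omega>. \<bar>h (Y T \<omega>) - f (Y T \<omega>)\<bar> \<partial>M)"
  proof -
    have "\<bar>(\<integral>\<omega>. h (Y T \<omega>) \<partial>M) - ?J\<bar> = \<bar>\<integral>\<omega>. h (Y T \<omega>) - f (Y T \<omega>) \<partial>M\<bar>"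
      by (simp add: Bochner_Integration.integral_diff[OF i6 i5])
    also have "\<dots> \<le> (\<integral>\<omega>. \<bar>h (Y T \<omega>) - f (Y T \<omega>)\<bar> \<partial>M)" by (rule integral_abs_bound)
    finally show ?thesis using ln_Lipschitz[OF J2 J1] by linarith
  qed
  finally show "?I \<le> ln ?J + ?q + e" using sum nn e by linarith
qed

end

text \<open>
With \<open>q = exp (- K T)\<close> the deterministic shift costs \<open>1 / (1 - q)\<^sup>2\<close> where the constant of the theorem has
\<open>4 / (1 - q\<^sup>2)\<^sup>2\<close>, which is larger because \<open>1 + q \<le> 2\<close>.
\<close>

lemma harnack_constant_le:
  fixes H T K d :: real
  assumes H: "0 < H" "H < 1/2" and T: "0 < T" and K: "0 < K"
  shows "(\<bar>d\<bar> * (K * exp (K * T) / (exp (K * T) - 1)))\<^sup>2 * (frac_const H)\<^sup>2 * T powr (2 - 2 * H) / (2 - 2 * H) / 2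
    \<le> harnack_const T K H * \<bar>d\<bar>\<^sup>2"
proof -
  define q where "q = exp (- (K * T))"
  have q: "0 < q" "q < 1" using K T by (auto simp: q_def)
  have e1: "exp (K * T) / (exp (K * T) - 1) = 1 / (1 - q)"
  proof -
    have "exp (K * T) * q = 1" by (simp add: q_def flip: exp_add)
    moreover have "0 < exp (K * T) - 1" using K T by simp
    then have ne: "exp (K * T) - 1 \<noteq> 0" "1 - q \<noteq> 0" using q by linarith+
    ultimately show ?thesis unfolding frac_eq_eq[OF ne] by (simp add: right_diff_distrib)
  qed
  have e2: "1 - exp (- 2 * K * T) = (1 - q) * (1 + q)"
  proof -
    have "exp (- 2 * K * T) = q * q" by (simp add: q_def flip: exp_add)
    then show ?thesis by (simp add: algebra_simps)
  qed
  have "1 \<le> 2 / (1 + q)" using q by simp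
  from mult_left_mono[OF this, of "1 / (1 - q)"] have "1 / (1 - q) \<le> 2 / ((1 - q) * (1 + q))" using q by simp
  then have le: "(1 / (1 - q))\<^sup>2 \<le> (2 / ((1 - q) * (1 + q)))\<^sup>2" using q by (intro power_mono) auto
  define R where "R = K\<^sup>2 * (frac_const H)\<^sup>2 * T powr (2 - 2 * H) / (2 - 2 * H) / 2 * \<bar>d\<bar>\<^sup>2"
  have R: "0 \<le> R" unfolding R_def using H by (intro mult_nonneg_nonneg divide_nonneg_nonneg) auto
  have "(\<bar>d\<bar> * (K * exp (K * T) / (exp (K * T) - 1)))\<^sup>2 * (frac_const H)\<^sup>2 * T powr (2 - 2 * H) / (2 - 2 * H) / 2 = R * (1 / (1 - q))\<^sup>2"
  proof -
    have *: "(\<bar>d\<bar> * (K * p))\<^sup>2 * A * B / c / 2 = (K\<^sup>2 * A * B / c / 2 * \<bar>d\<bar>\<^sup>2) * p\<^sup>2" for p A B c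
      by (simp add: power_mult_distrib)
    have k: "K * exp (K * T) / (exp (K * T) - 1) = K * (1 / (1 - q))" unfolding e1[symmetric] by simp
    show ?thesis unfolding k R_def by (rule *)
  qed
  also have "\<dots> \<le> R * (2 / ((1 - q) * (1 + q)))\<^sup>2" by (rule mult_left_mono[OF le R])
  also have "\<dots> = harnack_const T K H * \<bar>d\<bar>\<^sup>2"
  proof -
    define u where "u = ((1 - q) * (1 + q))\<^sup>2"
    have u: "u \<noteq> 0" using q by (simp add: u_def)
    have "R * (2 / ((1 - q) * (1 + q)))\<^sup>2 = R * (4 / u)" by (simp add: u_def power_divide)
    also have "\<dots> = (frac_const H)\<^sup>2 * (T powr (2 - 2 * H) / (inverse (K\<^sup>2) * u * (1 - H))) * \<bar>d\<bar>\<^sup>2"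
      unfolding R_def using u K H by (simp add: field_simps)
    finally show ?thesis unfolding harnack_const_def frac_const_def[symmetric] e2 u_def
      by (simp add: power_int_minus)
  qed
  finally show ?thesis .
qed

text \<open>
Setting \<open>b\<close> to zero outside \<open>[0, T]\<close> makes its measurability and the Lipschitz bound global and leaves the
equation unchanged.
\<close>

theorem corollary3p4:
  fixes H T K :: real
    and b :: "real \<Rightarrow> real \<Rightarrow> real"
    and M :: "'a measure"
    and F :: "real \<Rightarrow> 'a measure"
    and W B :: "real \<Rightarrow> 'a \<Rightarrow> real"
    and X :: "real \<Rightarrow> real \<Rightarrow> 'a \<Rightarrow> real"
    and f :: "real \<Rightarrow> real"
    and x y :: real
  assumes H: "0 < H" "H < 1/2"
    and T: "0 < T"
    and b_measurable: "(\<lambda>(t, z). b t z) \<in> borel_measurable (restrict_space borel ({0..T} \<times> UNIV))"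
    and K: "0 < K"
    and b_lipschitz: "\<And>t u v. t \<in> {0..T} \<Longrightarrow> \<bar>b t u - b t v\<bar> \<le> K * \<bar>u - v\<bar>"
    and b_bounded: "bounded ((\<lambda>t. b t 0) ` {0..T})"
    and M: "prob_space M"
    and F: "filtration (space M) F" "\<And>t. subalgebra M (F t)"
    and W: "wiener_process M F T W"
    and B: "fractional_brownian_motion M W H T B"
    and X: "\<And>z. sde_solution M F T b B z (X z)"
    and f: "f \<in> borel_measurable borel" "bounded (range f)" "\<And>z. 1 \<le> f z"
  shows "transition_op M X T (\<lambda>z. ln (f z)) x
           \<le> ln (transition_op M X T f y) + harnack_const T K H * \<bar>x - y\<bar>\<^sup>2"
proof -
  define b' where "b' t z = (if t \<in> {0..T} then b t z else 0)" for t z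
  obtain B1 where B1: "\<forall>u\<in>(\<lambda>t. b t 0) ` {0..T}. norm u \<le> B1" using b_bounded unfolding bounded_iff by blast
  define B0 where "B0 = max B1 0"
  obtain C where "\<forall>u\<in>range f. norm u \<le> C" using f(2) unfolding bounded_iff by blast
  then have "\<bar>f u\<bar> \<le> C" for u by simp
  then have fC: "f u \<le> C" for u by (rule abs_le_D1)
  interpret M: prob_space M by fact
  have basis: "wiener_basis M F T W" by (intro wiener_basis.intro wiener_basis_axioms.intro M T F W)
  have S: "({0..T} \<times> UNIV) \<inter> space (borel :: (real \<times> real) measure) \<in> sets borel"
    by (simp add: borel_prod[symmetric])
  have "(\<lambda>x. indicator ({0..T} \<times> UNIV) x *\<^sub>R (case x of (t, z) \<Rightarrow> b t z)) \<in> borel_measurable borel"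
    using b_measurable unfolding borel_measurable_restrict_space_iff[OF S] .
  also have "(\<lambda>x. indicator ({0..T} \<times> UNIV) x *\<^sub>R (case x of (t, z) \<Rightarrow> b t z)) = (\<lambda>x. b' (fst x) (snd x))"
    by (auto simp: b'_def fun_eq_iff indicator_def)
  finally have b'm: "(\<lambda>x. b' (fst x) (snd x)) \<in> borel_measurable (borel \<Otimes>\<^sub>M borel)" unfolding borel_prod .
  have drift: "lipschitz_drift T K B0 b'"
  proof
    show "\<bar>b' t u - b' t v\<bar> \<le> K * \<bar>u - v\<bar>" for t u v using b_lipschitz[of t u v] K by (simp add: b'_def)
    show "\<bar>b' t 0\<bar> \<le> B0" for t using B1 by (auto simp: b'_def B0_def intro: max.coboundedI1)
  qed (use T K b'm in auto)
  have sol: "AE \<omega> in M. \<forall>t\<in>{0..T}. X z t \<omega> = z + (LBINT s:{0..t}. b' s (X z s \<omega>)) + B t \<omega>" for z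
  proof -
    have "AE \<omega> in M. \<forall>t\<in>{0..T}. X z t \<omega> = z + (LBINT s:{0..t}. b s (X z s \<omega>)) + B t \<omega>"
      using X[of z] by (simp add: sde_solution_def)
    then show ?thesis
    proof eventually_elim
      case (elim \<omega>)
      show ?case
      proof
        fix t assume t: "t \<in> {0..T}"
        have "(LBINT s:{0..t}. b' s (X z s \<omega>)) = (LBINT s:{0..t}. b s (X z s \<omega>))"
          by (rule set_lebesgue_integral_cong) (use t in \<open>auto simp: b'_def\<close>)
        then show "X z t \<omega> = z + (LBINT s:{0..t}. b' s (X z s \<omega>)) + B t \<omega>" using bspec[OF elim t] by simp
      qed
    qed
  qed
  have ad: "X z t \<in> borel_measurable (F t)" if "0 \<le> t" "t \<le> T" for z t
    using X[of z] that by (simp add: sde_solution_def adapted_on_def)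
  have co: "AE \<omega> in M. continuous_on {0..T} (\<lambda>t. X z t \<omega>)" for z
    using X[of z] by (simp add: sde_solution_def continuous_paths_on_def)
  have Bw: "has_wiener_integral M W t (fbm_kernel H t) (B t)" if "0 \<le> t" "t \<le> T" for t
    using B that by (simp add: fractional_brownian_motion_def)
  have YT: "X y T \<in> borel_measurable M" by (rule measurable_from_subalg[OF F(2) ad]) (use T in auto)
  have sde: "fbm_sde M F T W K B0 b' H x y B (X x) (X y)"
    by (rule fbm_sde.intro[OF basis drift fbm_sde_axioms.intro]) (rule H Bw ad co sol YT; assumption)+
  have "(\<integral>\<omega>. ln (f (X x T \<omega>)) \<partial>M) \<le> ln (\<integral>\<omega>. f (X y T \<omega>) \<partial>M) + (fbm_sde.\<eta> T K x y)\<^sup>2 * (frac_const H)\<^sup>2 * T powr (2 - 2 * H) / (2 - 2 * H) / 2"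
    by (rule fbm_sde.log_harnack_measurable[OF sde f(1,3) fC])
  also have "(fbm_sde.\<eta> T K x y)\<^sup>2 * (frac_const H)\<^sup>2 * T powr (2 - 2 * H) / (2 - 2 * H) / 2 \<le> harnack_const T K H * \<bar>x - y\<bar>\<^sup>2"
    unfolding fbm_sde.\<eta>_def[OF sde] fbm_sde.D_def[OF sde] by (rule harnack_constant_le[OF H T K])
  finally show ?thesis unfolding transition_op_def by simp
qed

end
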